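(* Let $\gamma_1,\gamma_2\in\mathbb{R}$ and $s>\frac32$. For every $z_0=(u_0,\rho_0)\in H^s(\mathbb{S})\times H^{s-1}(\mathbb{S})$ there exist a maximal $T=T(\|z_0\|_{H^s\times H^{s-1}})>0$ and a unique solution $z=(u,\rho)$ of the system $$u_t-(u+\gamma_1)u_x=P(D)\Big(2\mu_0u+\tfrac12u_x^2+\tfrac12\rho^2\Big),\qquad \rho_t-(u+2\gamma_2)\rho_x=u_x\rho,$$ $u(0,\cdot)=u_0$, $\rho(0,\cdot)=\rho_0$, $u,\rho$ $1$-periodic in $x$, with $\mu_0=\int_{\mathbb{S}}u_0\,dx$, such that $z\in C([0,T);H^s\times H^{s-1})\cap C^1([0,T);H^{s-1}\times H^{s-2})$. Moreover, the mapping $z_0\mapsto z(\cdot,z_0)$ from $H^s\times H^{s-1}$ to $C([0,T);H^s\times H^{s-1})\cap C^1([0,T);H^{s-1}\times H^{s-2})$ is continuous.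
   Context: $\mathbb{S}=\mathbb{R}/\mathbb{Z}$ and $H^s=H^s(\mathbb{S})$ is the periodic Sobolev space. $P(D)$ is the Fourier multiplier operator on periodic functions with symbol $-\frac{2\pi i\beta}{\delta(\beta)+4\pi^2\beta^2}$ ($\beta\in\mathbb{Z}$), where $\delta(0)=1$ and $\delta(\beta)=0$ for $\beta\ne0$. *)

theory Defs
  imports "HOL-Analysis.Analysis"
begin

text \<open>Elements of the periodic Sobolev space H^s(S), S = R/Z, are identified with their
  Fourier coefficient sequences c k = integral over [0,1] of f x * exp(-2 pi i k x).
  Real-valuedness is the symmetry c(-k) = cnj (c k).  This representation also covers
  negative-order spaces (distributions), which are needed for H^(s-2).\<close>

type_synonym coeffs = "int \<Rightarrow> complex"

definition sob_weight :: "real \<Rightarrow> int \<Rightarrow> real" where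
  "sob_weight s k = (1 + (2 * pi * real_of_int k)^2) powr s"

definition Hs :: "real \<Rightarrow> coeffs set" where
  "Hs s = {c. (\<forall>k. c (- k) = cnj (c k)) \<and>
              (\<lambda>k. sob_weight s k * (cmod (c k))^2) summable_on UNIV}"

definition hs_norm :: "real \<Rightarrow> coeffs \<Rightarrow> real" where
  "hs_norm s c = sqrt (\<Sum>\<^sub>\<infinity>k. sob_weight s k * (cmod (c k))^2)"

definition prod_norm :: "real \<Rightarrow> coeffs \<Rightarrow> coeffs \<Rightarrow> real" where
  "prod_norm s u \<rho> = sqrt ((hs_norm s u)^2 + (hs_norm (s - 1) \<rho>)^2)"

definition csub :: "coeffs \<Rightarrow> coeffs \<Rightarrow> coeffs" where
  "csub a b = (\<lambda>k. a k - b k)"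

definition dx :: "coeffs \<Rightarrow> coeffs" where
  "dx c = (\<lambda>k. 2 * of_real pi * \<i> * of_int k * c k)"

definition cmult :: "coeffs \<Rightarrow> coeffs \<Rightarrow> coeffs" where
  "cmult a b = (\<lambda>k. \<Sum>\<^sub>\<infinity>j::int. a (k - j) * b j)"

definition cst :: "real \<Rightarrow> coeffs" where
  "cst a = (\<lambda>k. if k = 0 then complex_of_real a else 0)"

definition kdelta :: "int \<Rightarrow> real" where
  "kdelta k = (if k = 0 then 1 else 0)"

definition PD :: "coeffs \<Rightarrow> coeffs" where
  "PD c = (\<lambda>k. (- (2 * of_real pi * \<i> * of_int k)
               / complex_of_real (kdelta k + 4 * pi^2 * (real_of_int k)^2)) * c k)"

definition mean :: "coeffs \<Rightarrow> real" where
  "mean c = Re (c 0)"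

definition rhs_u :: "real \<Rightarrow> real \<Rightarrow> coeffs \<Rightarrow> coeffs \<Rightarrow> coeffs" where
  "rhs_u \<gamma>1 \<mu>0 u \<rho> = (\<lambda>k.
     cmult (\<lambda>j. u j + cst \<gamma>1 j) (dx u) k
     + PD (\<lambda>j. 2 * complex_of_real \<mu>0 * u j + 1/2 * cmult (dx u) (dx u) j
                + 1/2 * cmult \<rho> \<rho> j) k)"

definition rhs_rho :: "real \<Rightarrow> coeffs \<Rightarrow> coeffs \<Rightarrow> coeffs" where
  "rhs_rho \<gamma>2 u \<rho> = (\<lambda>k. cmult (\<lambda>j. u j + cst (2 * \<gamma>2) j) (dx \<rho>) k + cmult (dx u) \<rho> k)"

definition cont_curve :: "real \<Rightarrow> real \<Rightarrow> (real \<Rightarrow> coeffs) \<Rightarrow> bool" where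
  "cont_curve s T f \<longleftrightarrow> (\<forall>t\<in>{0..<T}. f t \<in> Hs s) \<and>
     (\<forall>t\<in>{0..<T}. ((\<lambda>\<tau>. hs_norm s (csub (f \<tau>) (f t))) \<longlongrightarrow> 0) (at t within {0..<T}))"

definition hs_deriv :: "real \<Rightarrow> real \<Rightarrow> (real \<Rightarrow> coeffs) \<Rightarrow> coeffs \<Rightarrow> real \<Rightarrow> bool" where
  "hs_deriv s T f f' t \<longleftrightarrow>
     ((\<lambda>\<tau>. hs_norm s (\<lambda>k. (f \<tau> k - f t k) / complex_of_real (\<tau> - t) - f' k)) \<longlongrightarrow> 0)
       (at t within {0..<T})"

definition is_solution ::
  "real \<Rightarrow> real \<Rightarrow> real \<Rightarrow> coeffs \<Rightarrow> coeffs \<Rightarrow> real \<Rightarrow> (real \<Rightarrow> coeffs) \<Rightarrow> (real \<Rightarrow> coeffs) \<Rightarrow> bool"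
where
  "is_solution \<gamma>1 \<gamma>2 s u0 \<rho>0 T u \<rho> \<longleftrightarrow>
     0 < T \<and> u 0 = u0 \<and> \<rho> 0 = \<rho>0 \<and>
     cont_curve s T u \<and> cont_curve (s - 1) T \<rho> \<and>
     cont_curve (s - 1) T (\<lambda>t. rhs_u \<gamma>1 (mean u0) (u t) (\<rho> t)) \<and>
     cont_curve (s - 2) T (\<lambda>t. rhs_rho \<gamma>2 (u t) (\<rho> t)) \<and>
     (\<forall>t\<in>{0..<T}. hs_deriv (s - 1) T u (rhs_u \<gamma>1 (mean u0) (u t) (\<rho> t)) t) \<and>
     (\<forall>t\<in>{0..<T}. hs_deriv (s - 2) T \<rho> (rhs_rho \<gamma>2 (u t) (\<rho> t)) t)"

end

theory Submission
  imports Defs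
begin

text \<open>
  With \<open>q = u\<^sub>x\<close> the system is a pair of transport equations for \<open>(q, \<rho>)\<close> in \<open>H\<^sup>\<sigma>\<close>, \<open>\<sigma> = s - 1 > 1/2\<close>, with a
  velocity \<open>u\<close> that gains one derivative and quadratic terms of order zero; the mean \<open>\<mu>\<^sub>0\<close> is conserved.
  On Fourier coefficients all estimates become bounds for trilinear sums
  \<open>\<Sum>\<^sub>k\<^sub>j \<kappa>(k,j) a\<^sub>k b\<^sub>j c\<^bsub>k-j\<^esub>\<close>, which hold as soon as \<open>|\<kappa>(k,j)| \<le> g k + g j + g (k - j)\<close> for some
  square-summable \<open>g\<close>, here \<open>g k = \<langle>k\<rangle>\<^sup>-\<^sup>a\<close> with \<open>a > 1/2\<close>.

  The energy estimate holds uniformly for the weights \<open>\<langle>k\<rangle>\<^sup>\<sigma> (1 + A min(1, \<langle>k\<rangle>/N))\<close>.  Every initial value, and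
  every initial value close to it, is controlled in such a weight with \<open>A\<close> arbitrarily large and \<open>N\<close> depending
  on \<open>A\<close>.  The solutions therefore have uniformly small high-frequency tails, so that convergence of
  coefficients is already convergence in \<open>H\<^sup>s \<times> H\<^sup>s\<^sup>-\<^sup>1\<close>; this gives continuity in time and continuous
  dependence on the data without regularising the data.  Existence comes from Euler polygons for the
  truncated system and Tychonoff compactness, uniqueness and weak stability from an energy estimate for
  differences in \<open>H\<^sup>a \<times> H\<^sup>a\<^sup>-\<^sup>1\<close>.
\<close>

section \<open>Square-summable bounds through finite sums\<close>

text \<open>The obstacle is the loss of a derivative: the vector field maps \<open>w0\<close> only
  into \<open>w1\<close>, so no contraction argument closes in the solution space, and the energy
  method for differences closes only in a weaker norm. At top order an energy inequality survives,
  because symmetrising in the two frequencies leaves a commutator of the weight. All it asks of the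
  weight f is slow variation, \<open>f (l * x) \<le> l ^ p * f x\<close>, and
  \<open>f x \<ge> x powr a\<close>. The perturbed weights satisfy both with constants free of A and
  N, hence the guaranteed lifespan is the same for all of them. Being at most 1 + A times the
  original weight, they are finite on every datum, so no extra regularity enters. A bound 2R in such
  a weight leaves at most 2R / (1 + A) of the original norm off a finite set of frequencies. The
  exponent a of the difference norm exceeds 1/2 for the product estimates, and stays below 1 so that
  plain powers, also those of negative order a - 1 for the second component, have commutators with
  elementary bounds.\<close>

definition wnorm_le :: "('i \<Rightarrow> real) \<Rightarrow> ('i \<Rightarrow> complex) \<Rightarrow> real \<Rightarrow> bool" where
  "wnorm_le w z B \<longleftrightarrow> (\<forall>S. finite S \<longrightarrow> L2_set (\<lambda>i. w i * cmod (z i)) S \<le> B)"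

lemma wnorm_leD: "wnorm_le w z B \<Longrightarrow> finite S \<Longrightarrow> L2_set (\<lambda>i. w i * cmod (z i)) S \<le> B"
  by (simp add: wnorm_le_def)

lemma wnorm_leI: "(\<And>S. finite S \<Longrightarrow> L2_set (\<lambda>i. w i * cmod (z i)) S \<le> B) \<Longrightarrow> wnorm_le w z B"
  by (simp add: wnorm_le_def)

lemma wnorm_le_nonneg: "wnorm_le w z B \<Longrightarrow> 0 \<le> B"
  using wnorm_leD[of w z B "{}"] by simp

lemma wnorm_le_mono: "wnorm_le w z B \<Longrightarrow> B \<le> B' \<Longrightarrow> wnorm_le w z B'"
  unfolding wnorm_le_def by (meson order_trans)

lemma wnorm_le_coord:
  assumes "wnorm_le w z B" "0 \<le> w i"
  shows "w i * cmod (z i) \<le> B"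
  using wnorm_leD[OF assms(1), of "{i}"] assms(2) by (simp add: L2_set_def)

lemma wnorm_le_weight:
  assumes "wnorm_le w' z B" "\<And>i. 0 \<le> w i" "\<And>i. w i \<le> w' i"
  shows "wnorm_le w z B"
proof (rule wnorm_leI)
  fix S :: "'a set" assume "finite S"
  have "L2_set (\<lambda>i. w i * cmod (z i)) S \<le> L2_set (\<lambda>i. w' i * cmod (z i)) S"
    by (rule L2_set_mono) (auto intro: mult_right_mono mult_nonneg_nonneg assms)
  then show "L2_set (\<lambda>i. w i * cmod (z i)) S \<le> B"
    using wnorm_leD[OF assms(1) \<open>finite S\<close>] by linarith
qed

lemma wnorm_le_sum_mono:
  assumes "wnorm_le w x a" "wnorm_le w y b" "\<And>i. 0 \<le> w i"
    and "\<And>i. cmod (z i) \<le> cmod (x i) + cmod (y i)"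
  shows "wnorm_le w z (a + b)"
proof (rule wnorm_leI)
  fix S :: "'a set" assume S: "finite S"
  have "L2_set (\<lambda>i. w i * cmod (z i)) S \<le> L2_set (\<lambda>i. w i * cmod (x i) + w i * cmod (y i)) S"
  proof (rule L2_set_mono)
    fix i
    show "w i * cmod (z i) \<le> w i * cmod (x i) + w i * cmod (y i)"
      using mult_left_mono[OF assms(4) assms(3), of i i] by (simp add: distrib_left)
    show "0 \<le> w i * cmod (z i)"
      using assms(3) by simp
  qed
  also have "\<dots> \<le> L2_set (\<lambda>i. w i * cmod (x i)) S + L2_set (\<lambda>i. w i * cmod (y i)) S"
    by (rule L2_set_triangle_ineq)
  also have "\<dots> \<le> a + b"
    using wnorm_leD[OF assms(1) S] wnorm_leD[OF assms(2) S] by linarith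
  finally show "L2_set (\<lambda>i. w i * cmod (z i)) S \<le> a + b" .
qed

lemma wnorm_le_add:
  assumes "wnorm_le w x a" "wnorm_le w y b" "\<And>i. 0 \<le> w i"
  shows "wnorm_le w (\<lambda>i. x i + y i) (a + b)"
  using assms by (rule wnorm_le_sum_mono) (rule norm_triangle_ineq)

lemma wnorm_le_diff:
  assumes "wnorm_le w x a" "wnorm_le w y b" "\<And>i. 0 \<le> w i"
  shows "wnorm_le w (\<lambda>i. x i - y i) (a + b)"
  using assms by (rule wnorm_le_sum_mono) (rule norm_triangle_ineq4)

lemma wnorm_le_of_diff:
  assumes "wnorm_le w (\<lambda>i. x i - y i) a" "wnorm_le w y b" "\<And>i. 0 \<le> w i"
  shows "wnorm_le w x (a + b)"
  using wnorm_le_add[OF assms] by simp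

lemma wnorm_le_zero [simp]: "0 \<le> B \<Longrightarrow> wnorm_le w (\<lambda>_. 0) B"
  by (simp add: wnorm_le_def L2_set_def)

text \<open>Fatou's lemma, immediate because the ball is defined by finite partial sums. The filter
  is arbitrary, since later limits run along cluster filters and along
  \<open>finite_subsets_at_top\<close>.\<close>

lemma wnorm_le_limit:
  assumes "G \<noteq> bot" "\<And>i. ((\<lambda>x. f x i) \<longlongrightarrow> z i) G" "eventually (\<lambda>x. wnorm_le w (f x) B) G"
  shows "wnorm_le w z B"
proof (rule wnorm_leI)
  fix S :: "'b set" assume S: "finite S"
  have "((\<lambda>x. L2_set (\<lambda>i. w i * cmod (f x i)) S) \<longlongrightarrow> L2_set (\<lambda>i. w i * cmod (z i)) S) G"
    unfolding L2_set_def by (intro tendsto_intros assms)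
  then show "L2_set (\<lambda>i. w i * cmod (z i)) S \<le> B"
    by (rule tendsto_upperbound)
      (use assms S in \<open>auto elim!: eventually_mono intro: wnorm_leD\<close>)
qed

lemma L2_set_disjoint_union_le:
  assumes "finite S"
  shows "L2_set f S \<le> L2_set f (S \<inter> X) + L2_set f (S - X)"
proof -
  have "(L2_set f S)\<^sup>2 = (L2_set f (S \<inter> X))\<^sup>2 + (L2_set f (S - X))\<^sup>2"
  proof -
    have "(\<Sum>i\<in>S. (f i)\<^sup>2) = (\<Sum>i\<in>S \<inter> X. (f i)\<^sup>2) + (\<Sum>i\<in>S - X. (f i)\<^sup>2)"
      using assms by (rule sum.Int_Diff)
    then show ?thesis
      unfolding L2_set_def by (simp add: sum_nonneg)
  qed
  also have "\<dots> \<le> (L2_set f (S \<inter> X) + L2_set f (S - X))\<^sup>2"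
    by (simp add: power2_sum L2_set_nonneg)
  finally show ?thesis
    by (rule power2_le_imp_le) (simp add: L2_set_nonneg)
qed

lemma L2_set_subset: "finite T \<Longrightarrow> S \<subseteq> T \<Longrightarrow> L2_set f S \<le> L2_set f T"
  unfolding L2_set_def by (simp add: sum_mono2)

text \<open>\<open>X\<close> nearly attains the supremum of the squared partial sums; by Pythagoras
  a finite set disjoint from \<open>X\<close> can add at most \<open>\<epsilon>\<^sup>2\<close> to
  it.\<close>

lemma wnorm_le_tail:
  assumes "wnorm_le w z B" "0 < \<epsilon>"
  obtains X where "finite X"
    "\<And>S. finite S \<Longrightarrow> S \<inter> X = {} \<Longrightarrow> L2_set (\<lambda>i. w i * cmod (z i)) S \<le> \<epsilon>"
proof -
  define f where "f = (\<lambda>i. w i * cmod (z i))"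
  define M where "M = (SUP S\<in>{S. finite S}. (L2_set f S)\<^sup>2)"
  have bd: "bdd_above ((\<lambda>S. (L2_set f S)\<^sup>2) ` {S. finite S})"
    by (rule bdd_aboveI[of _ "B\<^sup>2"])
      (use assms(1) in \<open>auto simp: f_def wnorm_le_def intro!: power_mono\<close>)
  have ne: "{S :: 'a set. finite S} \<noteq> {}"
    by auto
  have "M - \<epsilon>\<^sup>2 < M"
    using assms(2) by simp
  then obtain X where X: "finite X" "M - \<epsilon>\<^sup>2 < (L2_set f X)\<^sup>2"
    unfolding M_def less_cSUP_iff[OF ne bd] by auto
  have "L2_set f S \<le> \<epsilon>" if S: "finite S" "S \<inter> X = {}" for S
  proof (rule power2_le_imp_le)
    have "(L2_set f (S \<union> X))\<^sup>2 = (L2_set f S)\<^sup>2 + (L2_set f X)\<^sup>2"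
      using S X by (simp add: L2_set_def sum.union_disjoint sum_nonneg)
    moreover have "(L2_set f (S \<union> X))\<^sup>2 \<le> M"
      unfolding M_def by (rule cSUP_upper[OF _ bd]) (use S X in auto)
    ultimately show "(L2_set f S)\<^sup>2 \<le> \<epsilon>\<^sup>2"
      using X by linarith
  qed (use assms in auto)
  then show thesis
    using that X unfolding f_def by blast
qed

text \<open>Off the finite set \<open>w \<le> w' / c\<close>, so the heavy bound leaves at most
  \<open>B / c \<le> \<epsilon> / 2\<close>; on it smallness is assumed. In the applications
  \<open>w'\<close> is some \<open>wf A N\<close> and \<open>c = 1 + A\<close>.\<close>

lemma wnorm_le_split:
  assumes small: "L2_set (\<lambda>i. w i * cmod (z i)) {i. w' i < c * w i} \<le> \<epsilon> / 2"
    and z: "wnorm_le w' z B"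
    and w: "\<And>i. 0 \<le> w i" and c: "0 < c" "2 * B \<le> c * \<epsilon>"
    and fin: "finite {i. w' i < c * w i}"
  shows "wnorm_le w z \<epsilon>"
proof (rule wnorm_leI)
  define X where "X = {i. w' i < c * w i}"
  fix S :: "'a set" assume S: "finite S"
  have "L2_set (\<lambda>i. c * (w i * cmod (z i))) (S - X) \<le> L2_set (\<lambda>i. w' i * cmod (z i)) (S - X)"
    by (rule L2_set_mono)
      (use c w in \<open>auto simp: X_def not_less mult.assoc[symmetric] intro!: mult_right_mono\<close>)
  also have "\<dots> \<le> B"
    using z S by (auto intro: wnorm_leD)
  also have "L2_set (\<lambda>i. c * (w i * cmod (z i))) (S - X) = c * L2_set (\<lambda>i. w i * cmod (z i)) (S - X)"
    using c by (simp add: L2_set_right_distrib)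
  finally have "c * (2 * L2_set (\<lambda>i. w i * cmod (z i)) (S - X)) \<le> c * \<epsilon>"
    using c by linarith
  then have 1: "2 * L2_set (\<lambda>i. w i * cmod (z i)) (S - X) \<le> \<epsilon>"
    using c by simp
  have 2: "L2_set (\<lambda>i. w i * cmod (z i)) (S \<inter> X) \<le> L2_set (\<lambda>i. w i * cmod (z i)) X"
    using fin by (intro L2_set_subset) (auto simp: X_def)
  show "L2_set (\<lambda>i. w i * cmod (z i)) S \<le> \<epsilon>"
    using L2_set_disjoint_union_le[OF S, of "\<lambda>i. w i * cmod (z i)" X] 1 2 small
    unfolding X_def by linarith
qed

text \<open>Turns coordinatewise convergence into convergence in norm: the uniform bound in the
  heavier weight takes care of all but finitely many coordinates.\<close>

lemma wnorm_le_upgrade: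
  assumes "\<And>i. ((\<lambda>x. f x i) \<longlongrightarrow> 0) G" "0 < \<epsilon>"
    and "eventually (\<lambda>x. wnorm_le w' (f x) B) G"
    and w: "\<And>i. 0 \<le> w i" and c: "0 < c" "2 * B \<le> c * \<epsilon>"
    and fin: "finite {i. w' i < c * w i}"
  shows "eventually (\<lambda>x. wnorm_le w (f x) \<epsilon>) G"
proof -
  define X where "X = {i. w' i < c * w i}"
  have "((\<lambda>x. L2_set (\<lambda>i. w i * cmod (f x i)) X) \<longlongrightarrow> L2_set (\<lambda>i. w i * cmod 0) X) G"
    unfolding L2_set_def by (intro tendsto_intros assms)
  then have "((\<lambda>x. L2_set (\<lambda>i. w i * cmod (f x i)) X) \<longlongrightarrow> 0) G"
    by (simp add: L2_set_def)
  then have "eventually (\<lambda>x. L2_set (\<lambda>i. w i * cmod (f x i)) X < \<epsilon> / 2) G"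
    by (rule order_tendstoD) (use assms(2) in simp)
  then show ?thesis
    using assms(3)
  proof eventually_elim
    case (elim x)
    then show ?case
      by (intro wnorm_le_split[OF _ _ w c fin]) (auto simp: X_def)
  qed
qed

section \<open>Abstract well-posedness by energy estimates\<close>

lemma within_nonpos_imp_le:
  fixes f :: "real \<Rightarrow> real"
  assumes "\<And>x. 0 \<le> x \<Longrightarrow> x \<le> T \<Longrightarrow> (f has_real_derivative f' x) (at x within {0..T})"
    and "\<And>x. 0 \<le> x \<Longrightarrow> x \<le> T \<Longrightarrow> f' x \<le> 0" and t: "0 \<le> t" "t \<le> T"
  shows "f t \<le> f 0"
proof (cases "t = 0")
  case False
  have "\<exists>x\<in>{0<..<t}. f t - f 0 = (\<lambda>h. f' x * h) (t - 0)"
  proof (rule mvt_simple)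
    show "0 < t" using t False by simp
    fix x assume "0 \<le> x" "x \<le> t"
    then have "(f has_real_derivative f' x) (at x within {0..t})"
      using assms(1)[of x] t by (auto intro: DERIV_subset)
    then show "(f has_derivative (\<lambda>h. f' x * h)) (at x within {0..t})"
      by (simp add: has_field_derivative_def)
  qed
  then obtain x where x: "0 < x" "x < t" "f t - f 0 = f' x * t"
    by auto
  then have "f' x * t \<le> 0"
    using assms(2)[of x] t by (intro mult_nonpos_nonneg) auto
  then show ?thesis using x by linarith
qed auto

text \<open>The weight \<open>w0\<close> measures solutions, \<open>w1\<close> their time derivatives and \<open>wl\<close> differences of
  solutions.  For fixed \<open>A\<close> the weights \<open>wf A N\<close> are comparable to \<open>w0\<close>, exceed it by the factor
  \<open>1 + A\<close> off a finite set, and decrease to \<open>w0\<close> as \<open>N \<rightarrow> \<infinity>\<close>.\<close>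

locale energy_system =
  fixes S :: "nat \<Rightarrow> 'i set" and Sy :: "('i \<Rightarrow> complex) set"
    and F :: "('i \<Rightarrow> complex) \<Rightarrow> 'i \<Rightarrow> complex"
    and w0 w1 wl :: "'i \<Rightarrow> real" and wf :: "real \<Rightarrow> nat \<Rightarrow> 'i \<Rightarrow> real"
    and C0 :: real and CL CD :: "real \<Rightarrow> real" and e :: "nat \<Rightarrow> real"
  assumes finite_S: "finite (S n)"
    and S_ev: "eventually (\<lambda>n. i \<in> S n) sequentially"
    and Sy_zero: "(\<lambda>_. 0) \<in> Sy"
    and Sy_comb: "z \<in> Sy \<Longrightarrow> z' \<in> Sy \<Longrightarrow> (\<lambda>i. z i + of_real h * z' i) \<in> Sy"
    and Sy_trunc: "z \<in> Sy \<Longrightarrow> (\<lambda>i. if i \<in> S n then z i else 0) \<in> Sy"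
    and Sy_limit: "G' \<noteq> bot \<Longrightarrow> (\<And>i. ((\<lambda>x::nat. f' x i) \<longlongrightarrow> z i) G') \<Longrightarrow>
        eventually (\<lambda>x. f' x \<in> Sy) G' \<Longrightarrow> z \<in> Sy"
    and Sy_F: "z \<in> Sy \<Longrightarrow> F z \<in> Sy"
    and w0_ge1: "1 \<le> w0 i" and w1_pos: "0 < w1 i" and wl_pos: "0 < wl i"
    and wl_le: "wl i \<le> w0 i"
    and wf_ge: "0 \<le> A \<Longrightarrow> w0 i \<le> wf A N i"
    and wf_le: "0 \<le> A \<Longrightarrow> wf A N i \<le> (1 + A) * w0 i"
    and wf_tail: "0 \<le> A \<Longrightarrow> finite {i. wf A N i < (1 + A) * w0 i}"
    and wf_lim: "0 \<le> A \<Longrightarrow> (\<lambda>N. wf A N i) \<longlonglongrightarrow> w0 i"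
    and C0_nonneg: "0 \<le> C0" and CL_nonneg: "0 \<le> CL B" and e_nonneg: "0 \<le> e n"
    and e_lim: "e \<longlonglongrightarrow> 0"
    and F_zero: "F (\<lambda>_. 0) = (\<lambda>_. 0)"
    and F_lip: "z \<in> Sy \<Longrightarrow> z' \<in> Sy \<Longrightarrow> wnorm_le w0 z B \<Longrightarrow> wnorm_le w0 z' B \<Longrightarrow>
        wnorm_le w0 (\<lambda>i. z i - z' i) d \<Longrightarrow> wnorm_le w1 (\<lambda>i. F z i - F z' i) (CL B * d)"
    and F_cont: "G \<noteq> bot \<Longrightarrow> (\<And>i. ((\<lambda>x::nat \<times> real. f x i) \<longlongrightarrow> z i) G) \<Longrightarrow>
        eventually (\<lambda>x. f x \<in> Sy \<and> wnorm_le w0 (f x) B) G \<Longrightarrow> ((\<lambda>x. F (f x) i) \<longlongrightarrow> F z i) G"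
    and F_energy: "z \<in> Sy \<Longrightarrow> 0 \<le> A \<Longrightarrow> wnorm_le (wf A N) z B \<Longrightarrow> (\<And>i. i \<notin> S n \<Longrightarrow> z i = 0) \<Longrightarrow>
        (\<Sum>i\<in>S n. (wf A N i)\<^sup>2 * (z i \<bullet> F z i)) \<le> C0 * B ^ 3"
    and F_diff: "z \<in> Sy \<Longrightarrow> z' \<in> Sy \<Longrightarrow> wnorm_le w0 z B \<Longrightarrow> wnorm_le w0 z' B \<Longrightarrow>
        (\<Sum>i\<in>S n. (wl i)\<^sup>2 * ((z i - z' i) \<bullet> (F z i - F z' i)))
        \<le> CD B * ((\<Sum>i\<in>S n. (wl i * cmod (z i - z' i))\<^sup>2) + e n)"
begin

section \<open>Stability and uniqueness of coordinatewise solutions\<close>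

lemma w0_nonneg [simp]: "0 \<le> w0 i" and w1_nonneg [simp]: "0 \<le> w1 i" and wl_nonneg [simp]: "0 \<le> wl i"
  using w0_ge1[of i] w1_pos[of i] wl_pos[of i] by auto

lemma wf_nonneg: "0 \<le> A \<Longrightarrow> 0 \<le> wf A N i"
  using wf_ge[of A i N] w0_nonneg[of i] by linarith

lemma wf_ge1: "0 \<le> A \<Longrightarrow> 1 \<le> wf A N i"
  using wf_ge[of A i N] w0_ge1[of i] by linarith

lemma wf_bound_w0: "0 \<le> A \<Longrightarrow> wnorm_le (wf A N) z B \<Longrightarrow> wnorm_le w0 z B"
  by (rule wnorm_le_weight) (auto intro: wf_ge)

lemma F_bound: "z \<in> Sy \<Longrightarrow> wnorm_le w0 z B \<Longrightarrow> wnorm_le w1 (F z) (CL B * B)"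
  using F_lip[of z "\<lambda>_. 0" B B] Sy_zero by (simp add: F_zero wnorm_le_nonneg)

lemma F_coord_bound:
  assumes "z \<in> Sy" "wnorm_le w0 z B"
  shows "cmod (F z i) \<le> CL B * B / w1 i"
  using wnorm_le_coord[OF F_bound[OF assms], of i] w1_pos[of i]
  by (simp add: pos_le_divide_eq mult.commute)

text \<open>Derivatives are taken coordinate by coordinate: this survives the compactness limit and
  is what the energy argument on finite sums uses. Differentiability in norm is recovered in
  \<open>evol_strong_derivative\<close>.\<close>

definition sol_on :: "real set \<Rightarrow> (real \<Rightarrow> 'i \<Rightarrow> complex) \<Rightarrow> bool" where
  "sol_on I z \<longleftrightarrow> (\<forall>t\<in>I. z t \<in> Sy \<and>
     (\<forall>i. ((\<lambda>\<tau>. z \<tau> i) has_vector_derivative F (z t) i) (at t within I)))"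

text \<open>Gronwall's inequality for the truncated energies \<open>D n\<close>, finite sums that
  can be differentiated term by term. The modes outside \<open>S n\<close> feed back into the
  truncated ones and contribute the error \<open>e n\<close>, which disappears as n tends to
  infinity.\<close>

lemma stability:
  assumes z: "sol_on {0..T} z" "\<And>t. t \<in> {0..T} \<Longrightarrow> wnorm_le w0 (z t) B"
    and y: "sol_on {0..T} y" "\<And>t. t \<in> {0..T} \<Longrightarrow> wnorm_le w0 (y t) B"
    and d: "wnorm_le wl (\<lambda>i. z 0 i - y 0 i) d" and t: "t \<in> {0..T}"
  shows "wnorm_le wl (\<lambda>i. z t i - y t i) (exp (\<bar>CD B\<bar> * t) * d)"
proof -
  define C where "C = \<bar>CD B\<bar>"
  define D where "D = (\<lambda>n \<tau>. \<Sum>i\<in>S n. (wl i)\<^sup>2 * ((z \<tau> i - y \<tau> i) \<bullet> (z \<tau> i - y \<tau> i)))"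
  define D' where "D' = (\<lambda>n \<tau>. 2 * (\<Sum>i\<in>S n. (wl i)\<^sup>2 * ((z \<tau> i - y \<tau> i) \<bullet> (F (z \<tau>) i - F (y \<tau>) i))))"
  have D_eq: "D n \<tau> = (L2_set (\<lambda>i. wl i * cmod (z \<tau> i - y \<tau> i)) (S n))\<^sup>2" for n \<tau>
    unfolding D_def L2_set_def
    by (simp add: sum_nonneg power_mult_distrib dot_square_norm)
  have D_nonneg: "0 \<le> D n \<tau>" for n \<tau>
    by (simp add: D_eq)
  have deriv: "(D n has_real_derivative D' n \<tau>) (at \<tau> within {0..T})" if "\<tau> \<in> {0..T}" for n \<tau>
  proof -
    have *: "((\<lambda>\<tau>. z \<tau> i - y \<tau> i) has_vector_derivative (F (z \<tau>) i - F (y \<tau>) i)) (at \<tau> within {0..T})" for i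
      using z(1) y(1) that unfolding sol_on_def by (auto intro!: has_vector_derivative_diff)
    have "((\<lambda>\<tau>. (z \<tau> i - y \<tau> i) \<bullet> (z \<tau> i - y \<tau> i)) has_vector_derivative
        (z \<tau> i - y \<tau> i) \<bullet> (F (z \<tau>) i - F (y \<tau>) i) + (F (z \<tau>) i - F (y \<tau>) i) \<bullet> (z \<tau> i - y \<tau> i))
        (at \<tau> within {0..T})" for i
      by (rule bounded_bilinear.has_vector_derivative[OF bounded_bilinear_inner * *])
    then have "((\<lambda>\<tau>. (z \<tau> i - y \<tau> i) \<bullet> (z \<tau> i - y \<tau> i)) has_real_derivative
        2 * ((z \<tau> i - y \<tau> i) \<bullet> (F (z \<tau>) i - F (y \<tau>) i))) (at \<tau> within {0..T})" for i
      by (simp add: has_real_derivative_iff_has_vector_derivative inner_commute)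
    then have "(D n has_real_derivative
        (\<Sum>i\<in>S n. (wl i)\<^sup>2 * (2 * ((z \<tau> i - y \<tau> i) \<bullet> (F (z \<tau>) i - F (y \<tau>) i))))) (at \<tau> within {0..T})"
      unfolding D_def by (intro DERIV_sum DERIV_cmult)
    then show ?thesis
      unfolding D'_def by (simp add: sum_distrib_left mult_ac)
  qed
  have le: "D' n \<tau> \<le> 2 * C * (D n \<tau> + e n)" if \<tau>: "\<tau> \<in> {0..T}" for n \<tau>
  proof -
    have "(\<Sum>i\<in>S n. (wl i)\<^sup>2 * ((z \<tau> i - y \<tau> i) \<bullet> (F (z \<tau>) i - F (y \<tau>) i)))
        \<le> CD B * ((\<Sum>i\<in>S n. (wl i * cmod (z \<tau> i - y \<tau> i))\<^sup>2) + e n)"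
      using z y \<tau> unfolding sol_on_def by (intro F_diff) auto
    also have "(\<Sum>i\<in>S n. (wl i * cmod (z \<tau> i - y \<tau> i))\<^sup>2) = D n \<tau>"
      by (simp add: D_def power_mult_distrib dot_square_norm)
    also have "CD B * (D n \<tau> + e n) \<le> C * (D n \<tau> + e n)"
      unfolding C_def using D_nonneg e_nonneg by (intro mult_right_mono) (auto intro: add_nonneg_nonneg)
    finally show ?thesis
      unfolding D'_def by simp
  qed
  have growth: "D n t + e n \<le> exp (2 * C * t) * (d\<^sup>2 + e n)" for n
  proof -
    \<comment> \<open>Integrating factor: \<open>D n + e n\<close> grows at relative rate at most
      \<open>2 * C\<close>, so \<open>\<phi>\<close> is nonincreasing.\<close>
    define \<phi> where "\<phi> = (\<lambda>\<tau>. exp (- (2 * C * \<tau>)) * (D n \<tau> + e n))"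
    have "\<phi> t \<le> \<phi> 0"
    proof (rule within_nonpos_imp_le[where T = T])
      fix x assume x: "0 \<le> x" "x \<le> T"
      show "(\<phi> has_real_derivative exp (- (2 * C * x)) * (D' n x - 2 * C * (D n x + e n))) (at x within {0..T})"
        unfolding \<phi>_def
        by (auto intro!: derivative_eq_intros deriv simp: x algebra_simps)
      show "exp (- (2 * C * x)) * (D' n x - 2 * C * (D n x + e n)) \<le> 0"
        using le[of x n] x by (intro mult_nonneg_nonpos) auto
    qed (use t in auto)
    have "D n t + e n = exp (2 * C * t) * \<phi> t"
      by (simp add: \<phi>_def mult.assoc[symmetric] exp_add[symmetric])
    also have "\<dots> \<le> exp (2 * C * t) * (D n 0 + e n)"
      using \<open>\<phi> t \<le> \<phi> 0\<close> by (intro mult_left_mono) (auto simp: \<phi>_def)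
    also have "D n 0 \<le> d\<^sup>2"
      unfolding D_eq using d finite_S by (intro power_mono wnorm_leD) auto
    finally show ?thesis by simp
  qed
  show ?thesis
  proof (rule wnorm_leI)
    fix X :: "'i set" assume X: "finite X"
    define l where "l = L2_set (\<lambda>i. wl i * cmod (z t i - y t i)) X"
    have "eventually (\<lambda>n. \<forall>i\<in>X. i \<in> S n) sequentially"
      using X S_ev by (intro eventually_ball_finite) auto
    then have ev: "eventually (\<lambda>n. l\<^sup>2 \<le> exp (2 * C * t) * (d\<^sup>2 + e n)) sequentially"
    proof eventually_elim
      case (elim n)
      then have "l \<le> L2_set (\<lambda>i. wl i * cmod (z t i - y t i)) (S n)"
        unfolding l_def by (intro L2_set_subset finite_S) auto
      then have "l\<^sup>2 \<le> D n t"
        unfolding D_eq by (intro power_mono) (auto simp: l_def L2_set_nonneg)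
      then show ?case using growth[of n] e_nonneg[of n] by linarith
    qed
    have "(\<lambda>n. exp (2 * C * t) * (d\<^sup>2 + e n)) \<longlonglongrightarrow> exp (2 * C * t) * (d\<^sup>2 + 0)"
      by (intro tendsto_intros e_lim)
    then have "l\<^sup>2 \<le> exp (2 * C * t) * (d\<^sup>2 + 0)"
      by (rule tendsto_lowerbound) (use ev in auto)
    also have "\<dots> = (exp (C * t) * d)\<^sup>2"
      by (simp add: power_mult_distrib exp_double[symmetric] mult.assoc)
    finally have "l \<le> exp (C * t) * d"
      by (rule power2_le_imp_le) (use wnorm_le_nonneg[OF d] in auto)
    then show "L2_set (\<lambda>i. wl i * cmod (z t i - y t i)) X \<le> exp (\<bar>CD B\<bar> * t) * d"
      by (simp add: l_def C_def)
  qed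
qed

lemma uniqueness:
  assumes z: "sol_on {0..T} z" "\<And>t. t \<in> {0..T} \<Longrightarrow> wnorm_le w0 (z t) B"
    and y: "sol_on {0..T} y" "\<And>t. t \<in> {0..T} \<Longrightarrow> wnorm_le w0 (y t) B'"
    and "z 0 = y 0" and t: "t \<in> {0..T}"
  shows "z t = y t"
proof
  fix i
  have "wnorm_le wl (\<lambda>i. z t i - y t i) (exp (\<bar>CD (max B B')\<bar> * t) * 0)"
    by (rule stability[OF z(1) _ y(1) _ _ t])
      (auto intro: wnorm_le_mono[OF z(2)] wnorm_le_mono[OF y(2)] simp: \<open>z 0 = y 0\<close>)
  from wnorm_le_coord[OF this, of i] show "z t i = y t i"
    using wl_pos[of i] by (simp add: mult_le_0_iff)
qed

text \<open>The time T with \<open>R\<^sup>2 + T * c = (2 * R)\<^sup>2\<close>, where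
  \<open>c = 2 * C0 * (2 * R) ^ 3 + 1\<close> bounds the growth rate of the squared norm as long as
  the norm is at most \<open>2 * R\<close>. The summand 1 absorbs the discretisation error of the
  Euler scheme and keeps the denominator positive. Of the weight only \<open>C0\<close>
  enters.\<close>

definition lifespan :: "real \<Rightarrow> real" where
  "lifespan R = 3 * R\<^sup>2 / (2 * C0 * (2 * R) ^ 3 + 1)"

lemma lifespan_pos: "0 < R \<Longrightarrow> 0 < lifespan R"
  unfolding lifespan_def using C0_nonneg by (intro divide_pos_pos add_nonneg_pos) auto

lemma wnorm_le_supported:
  assumes "\<And>i. i \<notin> S n \<Longrightarrow> y i = 0" "0 \<le> B" "(\<Sum>i\<in>S n. (w i * cmod (y i))\<^sup>2) \<le> B\<^sup>2"
  shows "wnorm_le w y B"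
proof (rule wnorm_leI)
  fix X :: "'i set" assume X: "finite X"
  have "(\<Sum>i\<in>X. (w i * cmod (y i))\<^sup>2) = (\<Sum>i\<in>X \<inter> S n. (w i * cmod (y i))\<^sup>2)"
    by (rule sum.mono_neutral_right) (use X assms(1) in auto)
  also have "\<dots> \<le> (\<Sum>i\<in>S n. (w i * cmod (y i))\<^sup>2)"
    by (rule sum_mono2) (use finite_S in auto)
  also have "\<dots> \<le> B\<^sup>2" by fact
  finally show "L2_set (\<lambda>i. w i * cmod (y i)) X \<le> B"
    unfolding L2_set_def using assms(2) by (simp add: real_le_lsqrt sum_nonneg)
qed

text \<open>Explicit Euler polygons for the truncated system; the step size is so small, depending on
  the truncation, that the quadratic error of the energy increment is harmless.\<close>

lemma local_existence:
  assumes A: "0 \<le> A" and z0: "z0 \<in> Sy" "wnorm_le (wf A N) z0 R" and R: "0 < R"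
  obtains z where "z 0 = z0" "sol_on {0..lifespan R} z"
    "\<And>t. t \<in> {0..lifespan R} \<Longrightarrow> wnorm_le (wf A N) (z t) (2 * R)"
proof -
  define w where "w = wf A N"
  define B where "B = 2 * R"
  define T where "T = lifespan R"
  \<comment> \<open>\<open>b i\<close> bounds the i-th coordinate of \<open>F\<close> on the ball of
    radius \<open>B\<close>; \<open>cK n\<close> then bounds the squared weighted norm of
    \<open>F\<close> truncated to \<open>S n\<close>, and need not be bounded in n.\<close>
  define b where "b = (\<lambda>i. CL B * B / w1 i)"
  define cK where "cK = (\<lambda>n. \<Sum>i\<in>S n. (w i * b i)\<^sup>2)"
  \<comment> \<open>Small enough that \<open>(h n)\<^sup>2 * cK n \<le> h n\<close>: the
    second-order term of one Euler step costs no more than the summand 1 in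
    \<open>c\<close>.\<close>
  define h where "h = (\<lambda>n. 1 / (real n + 1 + cK n))"
  define P where "P = (\<lambda>n (y :: 'i \<Rightarrow> complex) i. if i \<in> S n then y i else 0)"
  define Y where "Y = (\<lambda>n j. ((\<lambda>y i. y i + of_real (h n) * P n (F y) i) ^^ j) (P n z0))"
  define E where "E = (\<lambda>n (y :: 'i \<Rightarrow> complex). \<Sum>i\<in>S n. (w i * cmod (y i))\<^sup>2)"
  define c where "c = 2 * C0 * B ^ 3 + 1"
  have B: "0 < B" using R by (simp add: B_def)
  have T: "0 < T" using lifespan_pos[OF R] by (simp add: T_def)
  have c: "0 < c" unfolding c_def using B C0_nonneg by (intro add_nonneg_pos) auto
  have Tc: "R\<^sup>2 + T * c = B\<^sup>2"
    using c by (simp add: T_def lifespan_def c_def B_def power_mult_distrib)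
  have w: "0 \<le> w i" "1 \<le> w i" for i
    using wf_nonneg[OF A] wf_ge1[OF A] by (auto simp: w_def)
  have b: "0 \<le> b i" for i
    unfolding b_def using CL_nonneg B w1_pos[of i] by (intro divide_nonneg_pos mult_nonneg_nonneg) auto
  have cK: "0 \<le> cK n" for n
    unfolding cK_def by (intro sum_nonneg) auto
  have h: "0 < h n" "h n \<le> 1 / (real n + 1)" "h n * cK n \<le> 1" for n
  proof -
    have "0 < real n + 1 + cK n" using cK[of n] by linarith
    then show "0 < h n" "h n * cK n \<le> 1"
      unfolding h_def by (auto simp: field_simps)
    show "h n \<le> 1 / (real n + 1)"
      unfolding h_def using cK[of n] by (intro divide_left_mono) (auto intro!: mult_pos_pos add_pos_nonneg)
  qed
  have h_lim: "h \<longlonglongrightarrow> 0"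
    by (rule tendsto_sandwich[of "\<lambda>_. 0" _ _ "\<lambda>n. 1 / (real n + 1)"])
      (use h LIMSEQ_inverse_real_of_nat in \<open>auto intro!: always_eventually less_imp_le simp: inverse_eq_divide add.commute\<close>)
  have Fb: "cmod (F y i) \<le> b i" if "y \<in> Sy" "wnorm_le w y B" for y i
    unfolding b_def by (rule F_coord_bound) (use that wf_bound_w0[OF A] in \<open>auto simp: w_def\<close>)
  have Y_Suc: "Y n (Suc j) = (\<lambda>i. Y n j i + of_real (h n) * P n (F (Y n j)) i)" for n j
    by (simp add: Y_def)
  \<comment> \<open>The two bounds feed each other: the ball of radius \<open>B\<close> makes the
    energy inequality applicable at step j, and the energy accumulated up to time \<open>T\<close>
    keeps step j + 1 in that ball. Projecting the vector field preserves the support in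
    \<open>S n\<close>.\<close>
  have inv: "Y n j \<in> Sy \<and> (\<forall>i. i \<notin> S n \<longrightarrow> Y n j i = 0) \<and> E n (Y n j) \<le> R\<^sup>2 + real j * h n * c
      \<and> wnorm_le w (Y n j) B"
    if "real j * h n \<le> T" for n j
    using that
  proof (induction j)
    case 0
    have Y0: "Y n 0 = P n z0" by (simp add: Y_def)
    have "E n (Y n 0) = (L2_set (\<lambda>i. w i * cmod (z0 i)) (S n))\<^sup>2"
      unfolding Y0 E_def L2_set_def by (simp add: P_def sum_nonneg)
    also have "\<dots> \<le> R\<^sup>2"
      using z0(2) finite_S by (intro power_mono wnorm_leD L2_set_nonneg) (auto simp: w_def)
    finally have E: "E n (Y n 0) \<le> R\<^sup>2" .
    have "wnorm_le w (Y n 0) R"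
      by (rule wnorm_le_supported[where n = n]) (use E R in \<open>auto simp: E_def Y0 P_def\<close>)
    then have "wnorm_le w (Y n 0) B"
      by (rule wnorm_le_mono) (use R in \<open>simp add: B_def\<close>)
    then show ?case
      using E Sy_trunc[OF z0(1), of n] by (auto simp: Y0 P_def)
  next
    case (Suc j)
    have le: "real j * h n \<le> T"
      using Suc.prems h(1)[of n] by (simp add: distrib_right)
    note IH = Suc.IH[OF le]
    define y where "y = Y n j"
    have y: "y \<in> Sy" "\<And>i. i \<notin> S n \<Longrightarrow> y i = 0" "E n y \<le> R\<^sup>2 + real j * h n * c" "wnorm_le w y B"
      using IH by (auto simp: y_def)
    have "E n (Y n (Suc j)) = (\<Sum>i\<in>S n. (w i)\<^sup>2 * (cmod (y i + of_real (h n) * F y i))\<^sup>2)"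
      unfolding E_def Y_Suc by (simp add: P_def y_def power_mult_distrib)
    also have "\<dots> = (\<Sum>i\<in>S n. (w i * cmod (y i))\<^sup>2 + 2 * h n * ((w i)\<^sup>2 * (y i \<bullet> F y i))
        + (h n)\<^sup>2 * (w i * cmod (F y i))\<^sup>2)"
    proof (intro sum.cong refl)
      fix i
      have "(cmod (y i + of_real (h n) * F y i))\<^sup>2
          = (cmod (y i))\<^sup>2 + 2 * h n * (y i \<bullet> F y i) + (h n)\<^sup>2 * (cmod (F y i))\<^sup>2"
        unfolding cmod_power2 inner_complex_def by (simp add: power2_eq_square algebra_simps)
      then show "(w i)\<^sup>2 * (cmod (y i + of_real (h n) * F y i))\<^sup>2
          = (w i * cmod (y i))\<^sup>2 + 2 * h n * ((w i)\<^sup>2 * (y i \<bullet> F y i)) + (h n)\<^sup>2 * (w i * cmod (F y i))\<^sup>2"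
        by (simp add: power_mult_distrib algebra_simps)
    qed
    also have "\<dots> = E n y + 2 * h n * (\<Sum>i\<in>S n. (w i)\<^sup>2 * (y i \<bullet> F y i))
        + (h n)\<^sup>2 * (\<Sum>i\<in>S n. (w i * cmod (F y i))\<^sup>2)"
      by (simp add: sum.distrib sum_distrib_left E_def)
    also have "\<dots> \<le> (R\<^sup>2 + real j * h n * c) + 2 * h n * (C0 * B ^ 3) + (h n)\<^sup>2 * cK n"
    proof (intro add_mono mult_left_mono y)
      show "(\<Sum>i\<in>S n. (w i)\<^sup>2 * (y i \<bullet> F y i)) \<le> C0 * B ^ 3"
        unfolding w_def by (rule F_energy[OF y(1) A]) (use y in \<open>auto simp: w_def\<close>)
      show "(\<Sum>i\<in>S n. (w i * cmod (F y i))\<^sup>2) \<le> cK n"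
        unfolding cK_def
        by (intro sum_mono power_mono mult_left_mono Fb y w mult_nonneg_nonneg) auto
    qed (use h(1)[of n] in auto)
    also have "(h n)\<^sup>2 * cK n \<le> h n"
      using mult_left_mono[OF h(3)[of n], of "h n"] h(1)[of n] by (simp add: power2_eq_square mult.assoc)
    also have "R\<^sup>2 + real j * h n * c + 2 * h n * (C0 * B ^ 3) + h n = R\<^sup>2 + real (Suc j) * h n * c"
      by (simp add: c_def algebra_simps)
    finally have E: "E n (Y n (Suc j)) \<le> R\<^sup>2 + real (Suc j) * h n * c"
      by simp
    also have "\<dots> \<le> R\<^sup>2 + T * c"
      using Suc.prems c by (intro add_left_mono mult_right_mono) auto
    finally have EB: "E n (Y n (Suc j)) \<le> B\<^sup>2"
      by (simp add: Tc)
    have supp: "\<forall>i. i \<notin> S n \<longrightarrow> Y n (Suc j) i = 0"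
      unfolding Y_Suc using IH by (auto simp: P_def)
    have "P n (F y) \<in> Sy"
      unfolding P_def by (intro Sy_trunc Sy_F y)
    then have "Y n (Suc j) \<in> Sy"
      unfolding Y_Suc y_def[symmetric] using y(1) by (rule Sy_comb[rotated])
    moreover have "wnorm_le w (Y n (Suc j)) B"
      by (rule wnorm_le_supported[where n = n]) (use EB supp B in \<open>auto simp: E_def\<close>)
    ultimately show ?case
      using E supp by auto
  qed
  \<comment> \<open>Compares the polygon with motion at constant velocity \<open>v\<close>: with
    \<open>v = 0\<close> this yields a Lipschitz bound, with \<open>v = F (z t) i\<close> the
    derivative of the limit.\<close>
  have incr: "cmod (Y n k i - Y n j i - of_real (real (k - j) * h n) * v) \<le> real (k - j) * h n * \<epsilon>"
    if "j \<le> k" "\<And>m. j \<le> m \<Longrightarrow> m < k \<Longrightarrow> cmod (P n (F (Y n m)) i - v) \<le> \<epsilon>" for n i j k v \<epsilon>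
    using that
  proof (induction k rule: dec_induct)
    case base
    show ?case by simp
  next
    case (step k)
    have "Y n (Suc k) i - Y n j i - of_real (real (Suc k - j) * h n) * v
        = (Y n k i - Y n j i - of_real (real (k - j) * h n) * v) + of_real (h n) * (P n (F (Y n k)) i - v)"
      unfolding Y_Suc using step.hyps by (simp add: Suc_diff_le algebra_simps)
    also have "cmod \<dots> \<le> real (k - j) * h n * \<epsilon> + h n * \<epsilon>"
    proof (intro norm_triangle_le add_mono)
      show "cmod (of_real (h n) * (P n (F (Y n k)) i - v)) \<le> h n * \<epsilon>"
        using step.prems[of k] step.hyps h(1)[of n] by (simp add: norm_mult)
    qed (use step in auto)
    also have "\<dots> = real (Suc k - j) * h n * \<epsilon>"
      using step.hyps by (simp add: Suc_diff_le algebra_simps)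
    finally show ?case .
  qed
  \<comment> \<open>\<open>J n t\<close> counts the steps completed by time t. The interpolation
    \<open>X\<close> is constant between grid points, so continuity in time appears only in the
    limit.\<close>
  define J where "J = (\<lambda>n t. nat \<lfloor>t / h n\<rfloor>)"
  have J: "real (J n t) * h n \<le> t" "t < (real (J n t) + 1) * h n" if "0 \<le> t" for n t
  proof -
    have "0 \<le> t / h n" using that h(1)[of n] by simp
    then have "real (J n t) = of_int \<lfloor>t / h n\<rfloor>"
      by (simp add: J_def)
    then have "real (J n t) \<le> t / h n" "t / h n < real (J n t) + 1"
      by linarith+
    then show "real (J n t) * h n \<le> t" "t < (real (J n t) + 1) * h n"
      using h(1)[of n] by (auto simp: field_simps)
  qed
  have J_mono: "J n s \<le> J n t" if "s \<le> t" for n s t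
    unfolding J_def using that h(1)[of n] by (intro nat_mono floor_mono divide_right_mono) auto
  have J_grid: "J n (real m * h n) = m" for n m
    using h(1)[of n] by (simp add: J_def)
  define X where "X = (\<lambda>n t. Y n (J n t))"
  have X: "X n t \<in> Sy" "wnorm_le w (X n t) B" if "t \<in> {0..T}" for n t
    using inv[of "J n t" n] J(1)[of t n] that unfolding X_def by auto
  have Xw0: "wnorm_le w0 (X n t) B" if "t \<in> {0..T}" for n t
    using wf_bound_w0[OF A X(2)[OF that, unfolded w_def]] .
  have X_cmod: "cmod (X n t i) \<le> B" if "t \<in> {0..T}" for n t i
    using wnorm_le_coord[OF X(2)[OF that, of n] w(1), of i] w(2)[of i]
      mult_right_mono[OF w(2)[of i], of "cmod (X n t i)"] by simp
  \<comment> \<open>The first grid point used may precede \<open>s\<close> by less than one step,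
    hence the window \<open>s - h n < r\<close>; the grid distance differs from \<open>t - s\<close>
    by at most \<open>h n\<close>.\<close>
  have X_incr: "cmod (X n t i - X n s i - of_real (t - s) * v) \<le> (t - s + h n) * \<epsilon> + h n * cmod v"
    if st: "0 \<le> s" "s \<le> t" "t \<le> T" and \<epsilon>: "0 \<le> \<epsilon>"
      "\<And>r. 0 \<le> r \<Longrightarrow> s - h n < r \<Longrightarrow> r \<le> t \<Longrightarrow> cmod (P n (F (X n r)) i - v) \<le> \<epsilon>" for n s t i v \<epsilon>
  proof -
    define d where "d = real (J n t - J n s) * h n"
    have "cmod (X n t i - X n s i - of_real d * v) \<le> d * \<epsilon>"
      unfolding X_def d_def
    proof (rule incr[OF J_mono[OF st(2)]])
      fix m assume m: "J n s \<le> m" "m < J n t"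
      have "X n (real m * h n) = Y n m"
        by (simp add: X_def J_grid)
      moreover have "cmod (P n (F (X n (real m * h n))) i - v) \<le> \<epsilon>"
      proof (rule \<epsilon>(2))
        have "(real (J n s) + 1) * h n \<le> (real m + 1) * h n"
          using m h(1)[of n] by (intro mult_right_mono) auto
        then have "s < (real m + 1) * h n"
          using J(2)[OF st(1), of n] by linarith
        then show "s - h n < real m * h n" by (simp add: algebra_simps)
        have "real m * h n \<le> real (J n t) * h n"
          using m h(1)[of n] by (intro mult_right_mono) auto
        then show "real m * h n \<le> t"
          using J(1)[of t n] st by linarith
      qed (use h(1)[of n] in auto)
      ultimately show "cmod (P n (F (Y n m)) i - v) \<le> \<epsilon>" by simp
    qed
    moreover have "X n t i - X n s i - of_real (t - s) * v
        = (X n t i - X n s i - of_real d * v) + of_real (d - (t - s)) * v"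
      by (simp add: algebra_simps)
    moreover have d: "\<bar>d - (t - s)\<bar> \<le> h n"
      using J[of s n] J[of t n] st J_mono[OF st(2), of n]
      by (simp add: d_def of_nat_diff abs_le_iff algebra_simps)
    moreover have "cmod (of_real (d - (t - s)) * v) \<le> h n * cmod v"
      unfolding norm_mult norm_of_real by (intro mult_right_mono d) auto
    moreover have "d * \<epsilon> \<le> (t - s + h n) * \<epsilon>"
      using d \<epsilon> by (intro mult_right_mono) auto
    ultimately show ?thesis
      by (smt (verit) norm_triangle_ineq)
  qed
  have PF: "cmod (P n (F (X n r)) i) \<le> b i" if "r \<in> {0..T}" for n r i
    using Fb[OF X[OF that]] b[of i] by (auto simp: P_def)
  have X_lip: "cmod (X n t i - X n s i) \<le> (\<bar>t - s\<bar> + h n) * b i" if "s \<in> {0..T}" "t \<in> {0..T}" for n s t i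
  proof (cases "s \<le> t")
    case True
    show ?thesis using X_incr[of s t "b i" n i 0] True that b PF by auto
  next
    case False
    show ?thesis using X_incr[of t s "b i" n i 0] False that b PF
      by (auto simp: norm_minus_commute abs_minus_commute)
  qed
  \<comment> \<open>All times and coordinates together form one point of a product of discs; outside
    \<open>{0..T}\<close> the value 0 is a filler that keeps it there. Compactness of the product
    gives a cluster point for all times at once.\<close>
  define XX where "XX = (\<lambda>n (ti :: real \<times> 'i). if fst ti \<in> {0..T} then X n (fst ti) (snd ti) else 0)"
  define K where "K = (PiE UNIV (\<lambda>_. cball 0 B) :: (real \<times> 'i \<Rightarrow> complex) set)"
  have "compactin (product_topology (\<lambda>_. euclidean) UNIV) K"
    unfolding K_def compactin_PiE by auto
  then have "compact K"
    by (simp add: euclidean_product_topology)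
  moreover have "filtermap XX sequentially \<noteq> bot"
    by (simp add: filtermap_bot_iff)
  moreover have "eventually (\<lambda>x. x \<in> K) (filtermap XX sequentially)"
    unfolding eventually_filtermap
    by (intro always_eventually) (auto simp: K_def XX_def X_cmod B less_imp_le)
  ultimately obtain x where x: "inf (nhds x) (filtermap XX sequentially) \<noteq> bot"
    unfolding compact_filter by blast
  \<comment> \<open>A filter finer than \<open>sequentially\<close> along which \<open>XX\<close>
    converges to the cluster point. It replaces a subsequence, which need not exist in a product of
    uncountably many factors.\<close>
  define G where "G = inf sequentially (filtercomap XX (nhds x))"
  have G: "G \<noteq> bot"
  proof
    assume "G = bot"
    then have "eventually (\<lambda>_. False) G" by simp
    then obtain p q where pq: "eventually p sequentially" "eventually q (filtercomap XX (nhds x))"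
      "\<And>n. p n \<Longrightarrow> q n \<Longrightarrow> False"
      unfolding G_def eventually_inf by blast
    then obtain q' where q': "eventually q' (nhds x)" "\<And>n. q' (XX n) \<Longrightarrow> q n"
      unfolding eventually_filtercomap by blast
    have "eventually (\<lambda>y. \<exists>n. p n \<and> y = XX n) (filtermap XX sequentially)"
      unfolding eventually_filtermap using pq(1) by (rule eventually_mono) auto
    then have "eventually (\<lambda>_. False) (inf (nhds x) (filtermap XX sequentially))"
      unfolding eventually_inf using q' pq(3) by blast
    then show False using x by (simp add: trivial_limit_def)
  qed
  have G_seq: "eventually p G" if "eventually p sequentially" for p
    using filter_leD[OF _ that, of G] by (simp add: G_def)
  have XX_lim: "((\<lambda>n. XX n ti) \<longlongrightarrow> x ti) G" for ti
  proof (rule topological_tendstoI)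
    fix U assume U: "open U" "x ti \<in> U"
    have "open ((\<lambda>y :: real \<times> 'i \<Rightarrow> complex. y ti) -` U)"
      by (intro open_vimage U continuous_on_product_coordinates)
    then have "eventually (\<lambda>y. y ti \<in> U) (nhds x)"
      using U(2) unfolding eventually_nhds by (intro exI[of _ "(\<lambda>y. y ti) -` U"]) auto
    moreover have "filterlim XX (nhds x) G"
      by (simp add: filterlim_iff_le_filtercomap G_def)
    ultimately show "eventually (\<lambda>n. XX n ti \<in> U) G"
      unfolding filterlim_iff by blast
  qed
  define z where "z = (\<lambda>t i. x (t, i))"
  have X_lim: "((\<lambda>n. X n t i) \<longlongrightarrow> z t i) G" if "t \<in> {0..T}" for t i
    using XX_lim[of "(t, i)"] that by (simp add: XX_def z_def)
  have z_Sy: "z t \<in> Sy" if "t \<in> {0..T}" for t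
    by (rule Sy_limit[OF G X_lim[OF that]]) (use X that in auto)
  have z_bound: "wnorm_le w (z t) B" if "t \<in> {0..T}" for t
    by (rule wnorm_le_limit[OF G X_lim[OF that]]) (use X that in auto)
  have hG: "(h \<longlongrightarrow> 0) G"
    using h_lim by (rule tendsto_mono[rotated]) (simp add: G_def)
  have z_init: "z 0 = z0"
  proof
    fix i
    have "eventually (\<lambda>n. X n 0 i = z0 i) G"
      by (rule G_seq[OF eventually_mono[OF S_ev[of i]]]) (simp add: X_def J_def Y_def P_def)
    then have "((\<lambda>n. X n 0 i) \<longlongrightarrow> z0 i) G"
      by (rule tendsto_eventually)
    then show "z 0 i = z0 i"
      using tendsto_unique[OF G X_lim] T by auto
  qed
  have deriv: "((\<lambda>\<tau>. z \<tau> i) has_vector_derivative F (z t) i) (at t within {0..T})" if t: "t \<in> {0..T}" for t i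
  proof -
    define v where "v = F (z t) i"
    \<comment> \<open>Times near t inside \<open>{0..T}\<close>, t itself included. Convergence of
      \<open>X n r\<close> to \<open>z t\<close> is required jointly in n and r, hence the product
      of \<open>G\<close> and \<open>H\<close>; \<open>X_lip\<close> provides it.\<close>
    define H where "H = inf (nhds t) (principal {0..T})"
    have H: "H \<noteq> bot"
      using t unfolding H_def trivial_limit_def eventually_inf_principal
      by (auto dest: eventually_nhds_x_imp_x)
    have H_T: "eventually (\<lambda>r. r \<in> {0..T}) H"
      by (simp add: H_def eventually_inf_principal)
    have G_H_T: "eventually (\<lambda>nr. snd nr \<in> {0..T}) (G \<times>\<^sub>F H)"
      unfolding eventually_prod_filter using H_T
      by (intro exI[of _ "\<lambda>_. True"] exI[of _ "\<lambda>r. r \<in> {0..T}"]) auto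
    have lim: "((\<lambda>nr. X (fst nr) (snd nr) l) \<longlongrightarrow> z t l) (G \<times>\<^sub>F H)" for l
    proof -
      have bound: "eventually (\<lambda>nr. norm (X (fst nr) (snd nr) l - X (fst nr) t l)
          \<le> (\<bar>snd nr - t\<bar> + h (fst nr)) * b l) (G \<times>\<^sub>F H)"
        by (rule eventually_mono[OF G_H_T]) (use X_lip t in auto)
      have f: "filterlim fst G (G \<times>\<^sub>F H)" and s: "filterlim snd H (G \<times>\<^sub>F H)"
        by (rule filterlim_fst filterlim_snd)+
      have "((\<lambda>r. r) \<longlongrightarrow> t) H"
        unfolding H_def by (rule tendsto_mono[OF inf_le1]) (rule filterlim_ident)
      then have "((\<lambda>nr. (\<bar>snd nr - t\<bar> + h (fst nr)) * b l) \<longlongrightarrow> (\<bar>t - t\<bar> + 0) * b l) (G \<times>\<^sub>F H)"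
        by (intro tendsto_intros filterlim_compose[OF hG f] filterlim_compose[OF _ s])
      then have "((\<lambda>nr. X (fst nr) (snd nr) l - X (fst nr) t l) \<longlongrightarrow> 0) (G \<times>\<^sub>F H)"
        by (intro Lim_null_comparison[OF bound]) simp
      moreover have "((\<lambda>nr. X (fst nr) t l) \<longlongrightarrow> z t l) (G \<times>\<^sub>F H)"
        by (rule filterlim_compose[OF X_lim[OF t] f])
      ultimately show ?thesis
        using tendsto_add by fastforce
    qed
    have "((\<lambda>nr. F (X (fst nr) (snd nr)) i) \<longlongrightarrow> v) (G \<times>\<^sub>F H)"
      unfolding v_def
    proof (rule F_cont[where B = B, OF _ lim])
      show "G \<times>\<^sub>F H \<noteq> bot" using G H by (simp add: prod_filter_eq_bot)
      show "\<forall>\<^sub>F x in G \<times>\<^sub>F H. X (fst x) (snd x) \<in> Sy \<and> wnorm_le w0 (X (fst x) (snd x)) B"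
        by (rule eventually_mono[OF G_H_T]) (use X(1) Xw0 in auto)
    qed
    \<comment> \<open>The derivative is checked directly: for r near t and n far along
      \<open>G\<close> the velocities are within \<epsilon> of \<open>v\<close>, so the polygons
      satisfy the increment estimate up to terms in \<open>h n\<close>, and these vanish along
      \<open>G\<close> with s fixed.\<close>
    have "\<exists>d>0. \<forall>s\<in>{0..T}. \<bar>s - t\<bar> < d \<longrightarrow> cmod (z s i - z t i - of_real (s - t) * v) \<le> \<epsilon> * \<bar>s - t\<bar>"
      if \<epsilon>: "0 < \<epsilon>" for \<epsilon>
    proof -
      have "eventually (\<lambda>nr. dist (F (X (fst nr) (snd nr)) i) v < \<epsilon>) (G \<times>\<^sub>F H)"
        by (rule tendstoD) fact+
      then obtain p q where pq: "eventually p G" "eventually q H"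
        "\<And>n r. p n \<Longrightarrow> q r \<Longrightarrow> dist (F (X n r) i) v < \<epsilon>"
        unfolding eventually_prod_filter by auto
      then obtain d where d: "0 < d" "\<And>r. r \<in> {0..T} \<Longrightarrow> dist r t < d \<Longrightarrow> q r"
        unfolding H_def eventually_inf_principal eventually_nhds_metric by blast
      have "cmod (z s i - z t i - of_real (s - t) * v) \<le> \<epsilon> * \<bar>s - t\<bar>"
        if s: "s \<in> {0..T}" "\<bar>s - t\<bar> < d / 2" for s
      proof -
        have "eventually (\<lambda>n. h n < d / 2) G"
          using d by (intro order_tendstoD(2)[OF hG]) simp
        moreover have "eventually (\<lambda>n. i \<in> S n) G"
          by (rule G_seq) (rule S_ev)
        ultimately have ev: "eventually (\<lambda>n. cmod (X n s i - X n t i - of_real (s - t) * v)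
            \<le> (\<bar>s - t\<bar> + h n) * \<epsilon> + h n * cmod v) G"
          using pq(1)
        proof eventually_elim
          case (elim n)
          have *: "cmod (P n (F (X n r)) i - v) \<le> \<epsilon>"
            if "0 \<le> r" "min s t - h n < r" "r \<le> max s t" for r
          proof -
            have "r \<in> {0..T}"
              using that s t by auto
            moreover have "dist r t < d"
              using that s(2) elim(1) h(1)[of n] unfolding dist_real_def
              by (cases "s \<le> t") (auto simp: min_def max_def abs_if split: if_splits)
            ultimately have "r \<in> {0..T}" "dist r t < d" .
            then show ?thesis
              using pq(3)[OF elim(3) d(2)[of r]] elim(2) by (simp add: P_def dist_norm less_imp_le)
          qed
          show ?case
          proof (cases "s \<le> t")
            case True
            then have "cmod (X n t i - X n s i - of_real (t - s) * v) \<le> (t - s + h n) * \<epsilon> + h n * cmod v"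
              using * s t \<epsilon> by (intro X_incr) auto
            moreover have "X n s i - X n t i - of_real (s - t) * v
                = - (X n t i - X n s i - of_real (t - s) * v)"
              by (simp add: algebra_simps)
            ultimately show ?thesis
              using True \<epsilon> h(1)[of n] by (simp only: norm_minus_cancel) (simp add: abs_if)
          next
            case False
            then have "cmod (X n s i - X n t i - of_real (s - t) * v) \<le> (s - t + h n) * \<epsilon> + h n * cmod v"
              using * s t \<epsilon> by (intro X_incr) auto
            then show ?thesis using False by simp
          qed
        qed
        have l1: "((\<lambda>n. cmod (X n s i - X n t i - of_real (s - t) * v)) \<longlongrightarrow>
            cmod (z s i - z t i - of_real (s - t) * v)) G"
          by (intro tendsto_intros X_lim s t)
        have l2: "((\<lambda>n. (\<bar>s - t\<bar> + h n) * \<epsilon> + h n * cmod v) \<longlongrightarrow> (\<bar>s - t\<bar> + 0) * \<epsilon> + 0 * cmod v) G"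
          by (intro tendsto_intros hG)
        show ?thesis
          using tendsto_le[OF G l2 l1 ev] by (simp add: mult.commute)
      qed
      then show ?thesis
        using d by (intro exI[of _ "d / 2"]) auto
    qed
    then show ?thesis
      unfolding has_vector_derivative_def has_derivative_within_alt v_def
      by (intro conjI bounded_linear_scaleR_left) (auto simp: scaleR_conv_of_real)
  qed
  have "sol_on {0..lifespan R} z"
    using z_Sy deriv by (auto simp: sol_on_def T_def)
  then show thesis
    using that z_init z_bound unfolding w_def B_def T_def by blast
qed

text \<open>Continuity is in the strong norm, differentiability by coordinates. Filters within
  \<open>{0..}\<close> instead of the interval of existence make the notion local in time and
  independent of the endpoint: one-sided at 0, two-sided at positive times.\<close>

definition evol_at :: "(real \<Rightarrow> 'i \<Rightarrow> complex) \<Rightarrow> real \<Rightarrow> bool" where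
  "evol_at z t \<longleftrightarrow> z t \<in> Sy \<and> (\<exists>B. wnorm_le w0 (z t) B) \<and>
     (\<forall>\<epsilon>>0. eventually (\<lambda>\<tau>. wnorm_le w0 (\<lambda>i. z \<tau> i - z t i) \<epsilon>) (at t within {0..})) \<and>
     (\<forall>i. ((\<lambda>\<tau>. z \<tau> i) has_vector_derivative F (z t) i) (at t within {0..}))"

definition evol :: "(real \<Rightarrow> 'i \<Rightarrow> complex) \<Rightarrow> real \<Rightarrow> bool" where
  "evol z T \<longleftrightarrow> 0 < T \<and> (\<forall>t\<in>{0..<T}. evol_at z t)"

lemma evol_at_cong:
  assumes "evol_at z t" "eventually (\<lambda>\<tau>. y \<tau> = z \<tau>) (at t within {0..})" "y t = z t" "0 \<le> t"
  shows "evol_at y t"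
  unfolding evol_at_def
proof (intro conjI allI impI)
  show "y t \<in> Sy" "\<exists>B. wnorm_le w0 (y t) B"
    using assms by (auto simp: evol_at_def)
next
  fix \<epsilon> :: real assume "0 < \<epsilon>"
  then have "eventually (\<lambda>\<tau>. wnorm_le w0 (\<lambda>i. z \<tau> i - z t i) \<epsilon>) (at t within {0..})"
    using assms by (auto simp: evol_at_def)
  with assms(2) show "eventually (\<lambda>\<tau>. wnorm_le w0 (\<lambda>i. y \<tau> i - y t i) \<epsilon>) (at t within {0..})"
    by eventually_elim (simp add: assms(3))
next
  fix i
  have d: "((\<lambda>\<tau>. z \<tau> i) has_vector_derivative F (y t) i) (at t within {0..})"
    using assms by (auto simp: evol_at_def)
  show "((\<lambda>\<tau>. y \<tau> i) has_vector_derivative F (y t) i) (at t within {0..})"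
    unfolding has_vector_derivative_def
    by (rule has_derivative_transform_eventually[OF d[unfolded has_vector_derivative_def]])
      (use assms in \<open>auto elim!: eventually_mono simp: evol_at_def\<close>)
qed

text \<open>The system is autonomous; the only issue is that times near t be sent into
  \<open>{0..}\<close>. This is isolated as a hypothesis: \<open>filterlim_shift_right\<close>
  supplies it for shifts by \<open>c \<ge> 0\<close>, \<open>filterlim_shift_left\<close> whenever
  \<open>t + c > 0\<close>.\<close>

lemma evol_at_shift:
  assumes z: "evol_at z (t + c)"
    and lim: "filterlim (\<lambda>\<tau>. \<tau> + c) (at (t + c) within {0..}) (at t within {0..})"
  shows "evol_at (\<lambda>\<tau>. z (\<tau> + c)) t"
  unfolding evol_at_def
proof (intro conjI allI impI)
  show "z (t + c) \<in> Sy" "\<exists>B. wnorm_le w0 (z (t + c)) B"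
    using z by (auto simp: evol_at_def)
next
  fix \<epsilon> :: real assume "0 < \<epsilon>"
  then have "eventually (\<lambda>\<tau>. wnorm_le w0 (\<lambda>i. z \<tau> i - z (t + c) i) \<epsilon>) (at (t + c) within {0..})"
    using z by (auto simp: evol_at_def)
  then show "eventually (\<lambda>\<tau>. wnorm_le w0 (\<lambda>i. z (\<tau> + c) i - z (t + c) i) \<epsilon>) (at t within {0..})"
    using lim by (rule eventually_compose_filterlim)
next
  fix i
  have d: "((\<lambda>\<tau>. z \<tau> i) has_vector_derivative F (z (t + c)) i) (at (t + c) within {0..})"
    using z by (auto simp: evol_at_def)
  then have "((\<lambda>y. (z y i - (z (t + c) i + (y - (t + c)) *\<^sub>R F (z (t + c)) i)) /\<^sub>R norm (y - (t + c))) \<longlongrightarrow> 0)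
      (at (t + c) within {0..})"
    unfolding has_vector_derivative_def has_derivative_within by (simp add: inverse_eq_divide)
  from filterlim_compose[OF this lim]
  show "((\<lambda>\<tau>. z (\<tau> + c) i) has_vector_derivative F (z (t + c)) i) (at t within {0..})"
    unfolding has_vector_derivative_def has_derivative_within
    by (intro conjI bounded_linear_scaleR_left) (simp add: inverse_eq_divide)
qed

lemma filterlim_shift_right:
  fixes t c :: real
  assumes "0 \<le> c"
  shows "filterlim (\<lambda>\<tau>. \<tau> + c) (at (t + c) within {0..}) (at t within {0..})"
  unfolding filterlim_at
proof
  show "((\<lambda>\<tau>. \<tau> + c) \<longlongrightarrow> t + c) (at t within {0..})"
    by (intro tendsto_intros)
  show "eventually (\<lambda>\<tau>. \<tau> + c \<in> {0..} \<and> \<tau> + c \<noteq> t + c) (at t within {0..})"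
    unfolding eventually_at_filter using assms by (intro always_eventually) auto
qed

lemma filterlim_shift_left:
  fixes t c :: real
  assumes "0 < t + c"
  shows "filterlim (\<lambda>\<tau>. \<tau> + c) (at (t + c) within {0..}) (at t within {0..})"
  unfolding filterlim_at
proof
  show lim: "((\<lambda>\<tau>. \<tau> + c) \<longlongrightarrow> t + c) (at t within {0..})"
    by (intro tendsto_intros)
  have "eventually (\<lambda>\<tau>. 0 < \<tau> + c) (at t within {0..})"
    by (rule order_tendstoD(1)[OF lim assms])
  moreover have "eventually (\<lambda>\<tau>. \<tau> \<noteq> t) (at t within {0..})"
    by (simp add: eventually_at_filter)
  ultimately show "eventually (\<lambda>\<tau>. \<tau> + c \<in> {0..} \<and> \<tau> + c \<noteq> t + c) (at t within {0..})"
    by eventually_elim auto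
qed

lemma eventually_lt_within:
  fixes t T :: real
  shows "t < T \<Longrightarrow> eventually (\<lambda>\<tau>. 0 \<le> \<tau> \<and> \<tau> < T) (at t within {0..})"
  unfolding eventually_at_topological by (intro exI[of _ "{..<T}"]) auto

lemma eventually_gt_within:
  fixes t a :: real
  shows "a < t \<Longrightarrow> eventually (\<lambda>\<tau>. a < \<tau>) (at t within {0..})"
  unfolding eventually_at_topological by (intro exI[of _ "{a<..}"]) auto

text \<open>Strong continuity bounds the norm near each time; compactness of \<open>{0..T'}\<close>
  reduces this to finitely many bounds.\<close>

lemma evol_bound:
  assumes "evol z T" "T' < T"
  obtains B where "0 < B" "\<And>t. t \<in> {0..T'} \<Longrightarrow> wnorm_le w0 (z t) B"
proof -
  have "\<exists>U B. open U \<and> t \<in> U \<and> (\<forall>\<tau>\<in>U \<inter> {0..}. wnorm_le w0 (z \<tau>) B)" if "t \<in> {0..T'}" for t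
  proof -
    have e: "evol_at z t" using assms that by (auto simp: evol_def)
    then obtain B where B: "wnorm_le w0 (z t) B" by (auto simp: evol_at_def)
    have "eventually (\<lambda>\<tau>. wnorm_le w0 (\<lambda>i. z \<tau> i - z t i) 1) (at t within {0..})"
      using e by (auto simp: evol_at_def)
    then obtain U where U: "open U" "t \<in> U"
      "\<And>\<tau>. \<tau> \<in> U \<Longrightarrow> \<tau> \<noteq> t \<Longrightarrow> \<tau> \<in> {0..} \<Longrightarrow> wnorm_le w0 (\<lambda>i. z \<tau> i - z t i) 1"
      unfolding eventually_at_topological by blast
    have "wnorm_le w0 (z \<tau>) (1 + B)" if "\<tau> \<in> U \<inter> {0..}" for \<tau>
      using wnorm_le_of_diff[OF U(3) B] wnorm_le_mono[OF B, of "1 + B"] that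
      by (cases "\<tau> = t") auto
    then show ?thesis using U by blast
  qed
  then obtain U B where UB: "\<And>t. t \<in> {0..T'} \<Longrightarrow> open (U t) \<and> t \<in> U t \<and>
      (\<forall>\<tau>\<in>U t \<inter> {0..}. wnorm_le w0 (z \<tau>) (B t))"
    by metis
  obtain C where C: "C \<subseteq> {0..T'}" "finite C" "{0..T'} \<subseteq> (\<Union>c\<in>C. U c)"
    by (rule compactE_image[of "{0..T'}" "{0..T'}" U]) (use UB in auto)
  have "wnorm_le w0 (z t) (1 + (\<Sum>c\<in>C. \<bar>B c\<bar>))" if t: "t \<in> {0..T'}" for t
  proof -
    obtain c where c: "c \<in> C" "t \<in> U c" using C t by auto
    then have "wnorm_le w0 (z t) (B c)" using UB C t by auto
    then show ?thesis
      by (rule wnorm_le_mono)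
        (use member_le_sum[OF c(1), of "\<lambda>c. \<bar>B c\<bar>"] C in auto)
  qed
  moreover have "0 < 1 + (\<Sum>c\<in>C. \<bar>B c\<bar>)"
    by (intro add_pos_nonneg sum_nonneg) auto
  ultimately show thesis using that by blast
qed

lemma evol_sol_on:
  assumes "evol z T" "T' < T"
  shows "sol_on {0..T'} z"
proof -
  have "evol_at z t" if "t \<in> {0..T'}" for t
    using assms that by (auto simp: evol_def)
  moreover have "{0..T'} \<subseteq> {0..}" by auto
  ultimately show ?thesis
    unfolding sol_on_def evol_at_def using has_vector_derivative_within_subset by blast
qed

lemma evol_unique:
  assumes z: "evol z T" and y: "evol y T'" and "z 0 = y 0" "0 \<le> t" "t < T" "t < T'"
  shows "z t = y t"
proof -
  obtain B where "\<And>s. s \<in> {0..t} \<Longrightarrow> wnorm_le w0 (z s) B"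
    using evol_bound[OF z \<open>t < T\<close>] by blast
  moreover obtain B' where "\<And>s. s \<in> {0..t} \<Longrightarrow> wnorm_le w0 (y s) B'"
    using evol_bound[OF y \<open>t < T'\<close>] by blast
  ultimately show ?thesis
    by (rule uniqueness[OF evol_sol_on[OF z \<open>t < T\<close>] _ evol_sol_on[OF y \<open>t < T'\<close>]])
      (use assms in auto)
qed

text \<open>Off a finite set \<open>X\<close> the datum is so small that even the factor
  \<open>1 + A\<close> is harmless, and on \<open>X\<close> the weights converge to
  \<open>w0\<close> as N grows. So the heavier norm comes arbitrarily close to the original one,
  with N chosen after the datum and A.\<close>

lemma wf_data:
  assumes A: "0 \<le> A" and z0: "wnorm_le w0 z0 R" and "0 < \<eta>"
  obtains N where "wnorm_le (wf A N) z0 (R + \<eta>)"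
proof -
  obtain X where X: "finite X"
    "\<And>S. finite S \<Longrightarrow> S \<inter> X = {} \<Longrightarrow> L2_set (\<lambda>i. w0 i * cmod (z0 i)) S \<le> \<eta> / (2 * (1 + A))"
    using wnorm_le_tail[OF z0, of "\<eta> / (2 * (1 + A))"] assms by auto
  have "(\<lambda>N. L2_set (\<lambda>i. (wf A N i - w0 i) * cmod (z0 i)) X) \<longlonglongrightarrow>
      L2_set (\<lambda>i. (w0 i - w0 i) * cmod (z0 i)) X"
    unfolding L2_set_def by (intro tendsto_intros wf_lim A)
  then have "(\<lambda>N. L2_set (\<lambda>i. (wf A N i - w0 i) * cmod (z0 i)) X) \<longlonglongrightarrow> 0"
    by (simp add: L2_set_def)
  then have "eventually (\<lambda>N. L2_set (\<lambda>i. (wf A N i - w0 i) * cmod (z0 i)) X < \<eta> / 2) sequentially"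
    by (rule order_tendstoD) (use assms in simp)
  then obtain N where N: "L2_set (\<lambda>i. (wf A N i - w0 i) * cmod (z0 i)) X < \<eta> / 2"
    by (auto simp: eventually_sequentially)
  have "wnorm_le (wf A N) z0 (R + \<eta>)"
  proof (rule wnorm_leI)
    fix Q :: "'i set" assume Q: "finite Q"
    have "L2_set (\<lambda>i. wf A N i * cmod (z0 i)) Q
        = L2_set (\<lambda>i. w0 i * cmod (z0 i) + (wf A N i - w0 i) * cmod (z0 i)) Q"
      by (simp add: algebra_simps)
    also have "\<dots> \<le> L2_set (\<lambda>i. w0 i * cmod (z0 i)) Q + L2_set (\<lambda>i. (wf A N i - w0 i) * cmod (z0 i)) Q"
      by (rule L2_set_triangle_ineq)
    also have "L2_set (\<lambda>i. w0 i * cmod (z0 i)) Q \<le> R"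
      using z0 Q by (rule wnorm_leD)
    also have "L2_set (\<lambda>i. (wf A N i - w0 i) * cmod (z0 i)) Q
        \<le> L2_set (\<lambda>i. (wf A N i - w0 i) * cmod (z0 i)) (Q \<inter> X) + L2_set (\<lambda>i. (wf A N i - w0 i) * cmod (z0 i)) (Q - X)"
      by (rule L2_set_disjoint_union_le[OF Q])
    also have "L2_set (\<lambda>i. (wf A N i - w0 i) * cmod (z0 i)) (Q \<inter> X) \<le> L2_set (\<lambda>i. (wf A N i - w0 i) * cmod (z0 i)) X"
      using X by (intro L2_set_subset) auto
    also have "L2_set (\<lambda>i. (wf A N i - w0 i) * cmod (z0 i)) (Q - X)
        \<le> L2_set (\<lambda>i. (1 + A) * (w0 i * cmod (z0 i))) (Q - X)"
    proof (rule L2_set_mono)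
      fix i
      have "wf A N i - w0 i \<le> (1 + A) * w0 i"
        using wf_le[OF A, of N i] w0_nonneg[of i] by linarith
      then show "(wf A N i - w0 i) * cmod (z0 i) \<le> (1 + A) * (w0 i * cmod (z0 i))"
        by (metis mult.assoc mult_right_mono norm_ge_zero)
      show "0 \<le> (wf A N i - w0 i) * cmod (z0 i)"
        using wf_ge[OF A, of i N] by simp
    qed
    also have "\<dots> = (1 + A) * L2_set (\<lambda>i. w0 i * cmod (z0 i)) (Q - X)"
      using A by (simp add: L2_set_right_distrib)
    also have "\<dots> \<le> (1 + A) * (\<eta> / (2 * (1 + A)))"
      using A Q X by (intro mult_left_mono) auto
    also have "\<dots> = \<eta> / 2" using A by (simp add: field_simps)
    finally show "L2_set (\<lambda>i. wf A N i * cmod (z0 i)) Q \<le> R + \<eta>"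
      using N by simp
  qed
  then show thesis using that by blast
qed

text \<open>Since \<open>lifespan\<close> does not see the weight, one may solve on the same
  interval starting from \<open>wf 0 0\<close> or from any \<open>wf A N\<close> in which the datum
  is bounded by \<open>R'\<close>. Uniqueness identifies these solutions, so a single one inherits
  all the bounds. The gap between \<open>R\<close> and \<open>R'\<close> is the room that
  \<open>wf_data\<close> takes up.\<close>

lemma local_solution:
  assumes z0: "z0 \<in> Sy" "wnorm_le w0 z0 R" and "R < R'"
  obtains z where "z 0 = z0" "evol z (lifespan R')" "sol_on {0..lifespan R'} z"
    "\<And>A N t. 0 \<le> A \<Longrightarrow> wnorm_le (wf A N) z0 R' \<Longrightarrow> t \<in> {0..lifespan R'} \<Longrightarrow>
       wnorm_le (wf A N) (z t) (2 * R')"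
proof -
  have R': "0 < R'" using wnorm_le_nonneg[OF z0(2)] assms by linarith
  define L where "L = lifespan R'"
  have L: "0 < L" using lifespan_pos[OF R'] by (simp add: L_def)
  have "wnorm_le (wf 0 0) z0 R'"
  proof -
    have "wnorm_le w0 z0 R'" using wnorm_le_mono[OF z0(2)] assms by simp
    then show ?thesis
      by (rule wnorm_le_weight) (use wf_le[of 0 0] wf_nonneg[of 0 0] in auto)
  qed
  then obtain z where z: "z 0 = z0" "sol_on {0..L} z"
    "\<And>t. t \<in> {0..L} \<Longrightarrow> wnorm_le (wf 0 0) (z t) (2 * R')"
    using local_existence[of 0 z0 0 R'] z0 R' unfolding L_def by auto
  have zb: "wnorm_le w0 (z t) (2 * R')" if "t \<in> {0..L}" for t
    using wf_bound_w0[OF _ z(3)[OF that]] by simp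
  have zw: "wnorm_le (wf A N) (z t) (2 * R')"
    if A: "0 \<le> A" "wnorm_le (wf A N) z0 R'" and t: "t \<in> {0..L}" for A N t
  proof -
    obtain y where y: "y 0 = z0" "sol_on {0..L} y" "\<And>t. t \<in> {0..L} \<Longrightarrow> wnorm_le (wf A N) (y t) (2 * R')"
      using local_existence[OF A(1) z0(1) A(2) R'] unfolding L_def by auto
    have "z t = y t"
      by (rule uniqueness[OF z(2) zb y(2)]) (use wf_bound_w0[OF A(1) y(3)] z y t in auto)
    then show ?thesis using y(3)[OF t] by simp
  qed
  have "evol_at z t" if t: "t \<in> {0..<L}" for t
    unfolding evol_at_def
  proof (intro conjI allI impI)
    show "z t \<in> Sy" using z(2) t by (auto simp: sol_on_def)
    show "\<exists>B. wnorm_le w0 (z t) B" using zb[of t] t by auto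
  next
    fix i
    have "((\<lambda>\<tau>. z \<tau> i) has_vector_derivative F (z t) i) (at t within {0..L})"
      using z(2) t by (auto simp: sol_on_def)
    moreover have "at t within {0..L} = at t within {0..}"
      by (rule at_within_nhd[of _ "{..<L}"]) (use t in auto)
    ultimately show "((\<lambda>\<tau>. z \<tau> i) has_vector_derivative F (z t) i) (at t within {0..})"
      by simp
  next
    fix \<epsilon> :: real assume \<epsilon>: "0 < \<epsilon>"
    \<comment> \<open>Two values of the solution, each bounded by \<open>2 * R'\<close> in the
      heavier weight, differ by at most \<open>4 * R'\<close>; this A makes
      \<open>2 * (4 * R') \<le> (1 + A) * \<epsilon>\<close>, as \<open>wnorm_le_upgrade\<close>
      requires.\<close>
    define A where "A = 8 * R' / \<epsilon>"
    have A: "0 \<le> A" using R' \<epsilon> by (simp add: A_def)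
    obtain N where N: "wnorm_le (wf A N) z0 (R + (R' - R))"
      using wf_data[OF A z0(2), of "R' - R"] assms(3) by auto
    show "eventually (\<lambda>\<tau>. wnorm_le w0 (\<lambda>i. z \<tau> i - z t i) \<epsilon>) (at t within {0..})"
    proof (rule wnorm_le_upgrade[where w' = "wf A N" and c = "1 + A" and B = "2 * R' + 2 * R'"])
      fix i
      have d: "((\<lambda>\<tau>. z \<tau> i) has_vector_derivative F (z t) i) (at t within {0..L})"
        using z(2) t by (auto simp: sol_on_def)
      have "at t within {0..L} = at t within {0..}"
        by (rule at_within_nhd[of _ "{..<L}"]) (use t in auto)
      then have "((\<lambda>\<tau>. z \<tau> i) \<longlongrightarrow> z t i) (at t within {0..})"
        using has_vector_derivative_continuous[OF d] by (simp add: continuous_within)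
      then show "((\<lambda>\<tau>. z \<tau> i - z t i) \<longlongrightarrow> 0) (at t within {0..})"
        by (simp add: LIM_zero_iff)
    next
      have "eventually (\<lambda>\<tau>. 0 \<le> \<tau> \<and> \<tau> < L) (at t within {0..})"
        by (rule eventually_lt_within) (use t in auto)
      then show "eventually (\<lambda>\<tau>. wnorm_le (wf A N) (\<lambda>i. z \<tau> i - z t i) (2 * R' + 2 * R')) (at t within {0..})"
      proof eventually_elim
        case (elim \<tau>)
        then show ?case
          using zw[OF A, of N] N t wf_nonneg[OF A] by (intro wnorm_le_diff) auto
      qed
    next
      have "(1 + A) * \<epsilon> = \<epsilon> + 8 * R'" using \<epsilon> by (simp add: A_def field_simps)
      then show "2 * (2 * R' + 2 * R') \<le> (1 + A) * \<epsilon>" using \<epsilon> by simp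
    qed (use \<epsilon> A wf_tail in auto)
  qed
  then have "evol z L" using L by (simp add: evol_def)
  then show thesis
    using that z zw unfolding L_def by blast
qed

text \<open>High frequencies are small for both solutions because both obey the heavier weight; on
  the remaining finite set all norms are equivalent and the weak stability estimate suffices. Nearby
  data share A and N, which makes the tails uniform in the datum.\<close>

lemma local_dependence:
  assumes z0: "z0 \<in> Sy" "wnorm_le w0 z0 R" and R: "0 \<le> R" and z: "evol z (lifespan (R + 1))" "z 0 = z0"
    and \<epsilon>: "0 < \<epsilon>"
  obtains \<delta> where "0 < \<delta>"
    "\<And>v. v \<in> Sy \<Longrightarrow> wnorm_le w0 (\<lambda>i. v i - z0 i) \<delta> \<Longrightarrow>
      \<exists>y. y 0 = v \<and> evol y (lifespan (R + 1)) \<and>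
        (\<forall>t\<in>{0..<lifespan (R + 1)}. wnorm_le w0 (\<lambda>i. y t i - z t i) \<epsilon>)"
proof -
  define L where "L = lifespan (R + 1)"
  define B where "B = 2 * (R + 1)"
  obtain zz where zz: "zz 0 = z0" "evol zz L" "sol_on {0..L} zz"
    "\<And>A N t. 0 \<le> A \<Longrightarrow> wnorm_le (wf A N) z0 (R + 1) \<Longrightarrow> t \<in> {0..L} \<Longrightarrow> wnorm_le (wf A N) (zz t) B"
    using local_solution[OF z0, of "R + 1"] unfolding L_def B_def by auto
  have eq: "z t = zz t" if "t \<in> {0..<L}" for t
    by (rule evol_unique[OF z(1) zz(2)]) (use z zz that in \<open>auto simp: L_def\<close>)
  define A where "A = 4 * B / \<epsilon>"
  have A: "0 \<le> A" using R \<epsilon> by (simp add: A_def B_def)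
  have Ae: "2 * (B + B) \<le> (1 + A) * \<epsilon>"
    using \<epsilon> by (simp add: A_def field_simps)
  obtain N where N: "wnorm_le (wf A N) z0 (R + 1 / 2)"
    using wf_data[OF A z0(2), of "1/2"] by auto
  define X where "X = {i. wf A N i < (1 + A) * w0 i}"
  \<comment> \<open>The Gronwall factor over the lifespan times the cost of passing from
    \<open>wl\<close> to \<open>w0\<close> on the finite set \<open>X\<close>.\<close>
  define K where "K = exp (\<bar>CD B\<bar> * L) * (\<Sum>i\<in>X. w0 i / wl i)"
  have K: "0 \<le> K" unfolding K_def
    by (intro mult_nonneg_nonneg sum_nonneg divide_nonneg_pos) (auto simp: wl_pos)
  \<comment> \<open>The first bound keeps the perturbation below 1/2 in \<open>wf A N\<close>, which
    is at most \<open>1 + A\<close> times \<open>w0\<close>, so that perturbed data stay below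
    \<open>R + 1\<close>; the second makes the contribution of the frequencies in \<open>X\<close>
    at most \<open>\<epsilon> / 2\<close>.\<close>
  define \<delta> where "\<delta> = min (1 / (2 * (1 + A))) (\<epsilon> / (2 * (1 + K)))"
  have \<delta>: "0 < \<delta>" "(1 + A) * \<delta> \<le> 1 / 2" "K * \<delta> \<le> \<epsilon> / 2"
  proof -
    show pos: "0 < \<delta>" using A K \<epsilon> by (auto simp: \<delta>_def)
    have "(1 + A) * \<delta> \<le> (1 + A) * (1 / (2 * (1 + A)))"
      using A by (intro mult_left_mono) (auto simp: \<delta>_def)
    also have "\<dots> = 1 / 2" using A by (simp add: field_simps)
    finally show "(1 + A) * \<delta> \<le> 1 / 2" .
    have "(1 + K) * \<delta> \<le> (1 + K) * (\<epsilon> / (2 * (1 + K)))"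
      using K by (intro mult_left_mono) (auto simp: \<delta>_def)
    also have "\<dots> = \<epsilon> / 2" using K by (simp add: field_simps)
    finally show "K * \<delta> \<le> \<epsilon> / 2" using pos by (simp add: distrib_right)
  qed
  have main: "\<exists>y. y 0 = v \<and> evol y L \<and> (\<forall>t\<in>{0..<L}. wnorm_le w0 (\<lambda>i. y t i - z t i) \<epsilon>)"
    if v: "v \<in> Sy" "wnorm_le w0 (\<lambda>i. v i - z0 i) \<delta>" for v
  proof -
    have "wnorm_le w0 v (\<delta> + R)"
      by (rule wnorm_le_of_diff[OF v(2) z0(2)]) simp
    moreover have "\<delta> < 1"
      using \<delta>(1,2) A mult_right_mono[of 1 "1 + A" \<delta>] by linarith
    ultimately obtain y where y: "y 0 = v" "evol y L" "sol_on {0..L} y"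
      "\<And>A N t. 0 \<le> A \<Longrightarrow> wnorm_le (wf A N) v (R + 1) \<Longrightarrow> t \<in> {0..L} \<Longrightarrow> wnorm_le (wf A N) (y t) B"
      using local_solution[OF v(1), of "\<delta> + R" "R + 1"] unfolding L_def B_def by auto
    have w0v: "wnorm_le w0 (\<lambda>i. (1 + A) *\<^sub>R (v i - z0 i)) (1 / 2)"
    proof (rule wnorm_leI)
      fix Q :: "'i set" assume "finite Q"
      have "L2_set (\<lambda>i. w0 i * cmod ((1 + A) *\<^sub>R (v i - z0 i))) Q
          = L2_set (\<lambda>i. (1 + A) * (w0 i * cmod (v i - z0 i))) Q"
        using A by (simp only: norm_scaleR) (simp add: mult_ac)
      also have "\<dots> = (1 + A) * L2_set (\<lambda>i. w0 i * cmod (v i - z0 i)) Q"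
        using A by (simp add: L2_set_right_distrib)
      also have "\<dots> \<le> (1 + A) * \<delta>"
        using A wnorm_leD[OF v(2) \<open>finite Q\<close>] by (intro mult_left_mono) auto
      finally show "L2_set (\<lambda>i. w0 i * cmod ((1 + A) *\<^sub>R (v i - z0 i))) Q \<le> 1 / 2"
        using \<delta> by simp
    qed
    have "wnorm_le (wf A N) (\<lambda>i. v i - z0 i) (1 / 2)"
    proof (rule wnorm_leI)
      fix Q :: "'i set" assume Q: "finite Q"
      have "L2_set (\<lambda>i. wf A N i * cmod (v i - z0 i)) Q
          \<le> L2_set (\<lambda>i. w0 i * cmod ((1 + A) *\<^sub>R (v i - z0 i))) Q"
      proof (rule L2_set_mono)
        fix i
        have "wf A N i * cmod (v i - z0 i) \<le> (1 + A) * w0 i * cmod (v i - z0 i)"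
          by (intro mult_right_mono wf_le A) auto
        then show "wf A N i * cmod (v i - z0 i) \<le> w0 i * cmod ((1 + A) *\<^sub>R (v i - z0 i))"
          using A by (simp only: norm_scaleR) (simp add: mult_ac)
      qed (use wf_nonneg[OF A] in auto)
      then show "L2_set (\<lambda>i. wf A N i * cmod (v i - z0 i)) Q \<le> 1 / 2"
        using wnorm_leD[OF w0v Q] by linarith
    qed
    from wnorm_le_of_diff[OF this N wf_nonneg[OF A]] have vN: "wnorm_le (wf A N) v (R + 1)"
      by (simp add: add.commute)
    have zN: "wnorm_le (wf A N) z0 (R + 1)"
      using N by (rule wnorm_le_mono) simp
    have "wnorm_le w0 (\<lambda>i. y t i - zz t i) \<epsilon>" if t: "t \<in> {0..<L}" for t
    proof (rule wnorm_le_split[where w' = "wf A N" and c = "1 + A" and B = "B + B"])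
      show "wnorm_le (wf A N) (\<lambda>i. y t i - zz t i) (B + B)"
        using t by (intro wnorm_le_diff y(4) zz(4) A vN zN wf_nonneg) auto
      have "wnorm_le wl (\<lambda>i. y t i - zz t i) (exp (\<bar>CD B\<bar> * t) * \<delta>)"
      proof (rule stability[OF y(3) _ zz(3)])
        show "wnorm_le w0 (y t) B" "wnorm_le w0 (zz t) B" if "t \<in> {0..L}" for t
          using wf_bound_w0[OF A y(4)[OF A vN that]] wf_bound_w0[OF A zz(4)[OF A zN that]] by auto
        show "wnorm_le wl (\<lambda>i. y 0 i - zz 0 i) \<delta>"
          using wnorm_le_weight[OF v(2) wl_nonneg wl_le] by (simp add: y zz)
      qed (use t in auto)
      then have "wnorm_le wl (\<lambda>i. y t i - zz t i) (exp (\<bar>CD B\<bar> * L) * \<delta>)"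
        by (rule wnorm_le_mono) (use t \<delta> in \<open>auto intro!: mult_right_mono mult_left_mono\<close>)
      from wnorm_le_coord[OF this wl_nonneg]
      have c: "w0 i * cmod (y t i - zz t i) \<le> w0 i / wl i * (exp (\<bar>CD B\<bar> * L) * \<delta>)" for i
        using mult_left_mono[of "wl i * cmod (y t i - zz t i)" "exp (\<bar>CD B\<bar> * L) * \<delta>" "w0 i / wl i"]
          wl_pos[of i] by simp
      have "L2_set (\<lambda>i. w0 i * cmod (y t i - zz t i)) X \<le> (\<Sum>i\<in>X. \<bar>w0 i * cmod (y t i - zz t i)\<bar>)"
        by (rule L2_set_le_sum_abs)
      also have "\<dots> \<le> (\<Sum>i\<in>X. w0 i / wl i * (exp (\<bar>CD B\<bar> * L) * \<delta>))"
        using c by (intro sum_mono) auto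
      also have "\<dots> = K * \<delta>"
        unfolding sum_distrib_right[symmetric] by (simp add: K_def mult_ac)
      also have "\<dots> \<le> \<epsilon> / 2" by (rule \<delta>)
      finally show "L2_set (\<lambda>i. w0 i * cmod (y t i - zz t i)) {i. wf A N i < (1 + A) * w0 i} \<le> \<epsilon> / 2"
        by (simp add: X_def)
    qed (use A Ae wf_tail in auto)
    then show ?thesis using y eq by auto
  qed
  show thesis
    by (rule that[OF \<delta>(1)]) (use main in \<open>auto simp: L_def\<close>)
qed

section \<open>Maximal existence time and the flow\<close>

definition max_time :: "('i \<Rightarrow> complex) \<Rightarrow> ereal" where
  "max_time z0 = Sup {ereal T | T. \<exists>z. evol z T \<and> z 0 = z0}"

text \<open>For each t separately some evolution living beyond t is picked and evaluated there; by
  uniqueness the choice is immaterial, so the maximal solution requires no gluing of a family of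
  solutions.\<close>

definition flow :: "('i \<Rightarrow> complex) \<Rightarrow> real \<Rightarrow> 'i \<Rightarrow> complex" where
  "flow z0 t = (SOME z. \<exists>T>t. evol z T \<and> z 0 = z0) t"

lemma evol_le_max_time: "evol z T \<Longrightarrow> z 0 = z0 \<Longrightarrow> ereal T \<le> max_time z0"
  unfolding max_time_def by (rule Sup_upper) auto

lemma flow_eq:
  assumes "evol z T" "z 0 = z0" "0 \<le> t" "t < T"
  shows "flow z0 t = z t"
proof -
  define y where "y = (SOME z. \<exists>T>t. evol z T \<and> z 0 = z0)"
  have "\<exists>T>t. evol y T \<and> y 0 = z0"
    unfolding y_def by (rule someI[of "\<lambda>z. \<exists>T>t. evol z T \<and> z 0 = z0" z]) (use assms in auto)
  then obtain T' where y: "t < T'" "evol y T'" "y 0 = z0" by blast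
  have "y t = z t"
    by (rule evol_unique[OF y(2) assms(1)]) (use y assms in auto)
  then show ?thesis by (simp add: flow_def y_def)
qed

lemma lt_max_time:
  assumes "ereal t < max_time z0"
  obtains z T where "t < T" "evol z T" "z 0 = z0"
  using assms unfolding max_time_def less_Sup_iff by auto

text \<open>The endpoint \<open>T = max_time z0\<close> is included: every time before T lies
  strictly inside the interval of some evolution, and nearby the flow coincides with that
  evolution.\<close>

lemma evol_flow:
  assumes "0 < T" "ereal T \<le> max_time z0"
  shows "evol (flow z0) T" "flow z0 0 = z0"
proof -
  have ex: "\<exists>z T1. t < T1 \<and> evol z T1 \<and> z 0 = z0" if "t < T" for t
  proof -
    have "ereal t < max_time z0"
      by (rule less_le_trans[OF _ assms(2)]) (use that in simp)
    then show ?thesis by (rule lt_max_time) blast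
  qed
  have "evol_at (flow z0) t" if t: "t \<in> {0..<T}" for t
  proof -
    obtain z T1 where z: "t < T1" "evol z T1" "z 0 = z0"
      using ex[of t] t by auto
    show ?thesis
    proof (rule evol_at_cong)
      show "evol_at z t" using z t by (auto simp: evol_def)
      show "eventually (\<lambda>\<tau>. flow z0 \<tau> = z \<tau>) (at t within {0..})"
        by (rule eventually_mono[OF eventually_lt_within[OF z(1)]]) (use flow_eq z in auto)
      show "flow z0 t = z t" using flow_eq z t by auto
    qed (use t in auto)
  qed
  then show "evol (flow z0) T" using assms by (auto simp: evol_def)
  obtain z T1 where "0 < T1" "evol z T1" "z 0 = z0"
    using ex[OF assms(1)] by blast
  then show "flow z0 0 = z0"
    using flow_eq[of z T1 z0 0] by simp
qed

lemma evol_restart: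
  assumes "evol z T" "0 \<le> a" "a < T"
  shows "evol (\<lambda>\<tau>. z (\<tau> + a)) (T - a)"
  unfolding evol_def
proof (intro conjI ballI)
  fix t assume "t \<in> {0..<T - a}"
  then show "evol_at (\<lambda>\<tau>. z (\<tau> + a)) t"
    using assms by (intro evol_at_shift filterlim_shift_right) (auto simp: evol_def)
qed (use assms in auto)

lemma evol_glue:
  assumes z: "evol z T" and y: "evol y T2" and a: "0 \<le> a" "a < T" and init: "y 0 = z a"
  shows "evol (\<lambda>t. if t \<le> a then z t else y (t - a)) (a + T2)"
  unfolding evol_def
proof (intro conjI ballI)
  show "0 < a + T2" using y a by (simp add: evol_def)
  fix t assume t: "t \<in> {0..<a + T2}"
  define x where "x = (\<lambda>t. if t \<le> a then z t else y (t - a))"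
  show "evol_at (\<lambda>t. if t \<le> a then z t else y (t - a)) t"
    unfolding x_def[symmetric]
  proof (cases "t \<le> a")
    case True
    \<comment> \<open>The first evolution lives beyond \<open>a\<close>, where uniqueness forces it
      to agree with the second; so nothing has to be matched at the seam.\<close>
    have eq: "x \<tau> = z \<tau>" if "0 \<le> \<tau>" "\<tau> < min T (a + T2)" for \<tau>
    proof (cases "\<tau> \<le> a")
      case False
      have "y (\<tau> - a) = z ((\<tau> - a) + a)"
        by (rule evol_unique[OF y evol_restart[OF z a]]) (use init that False in auto)
      then show ?thesis using False by (simp add: x_def)
    qed (simp add: x_def)
    show "evol_at x t"
    proof (rule evol_at_cong)
      show "evol_at z t" using z t a True by (auto simp: evol_def)
      have "t < min T (a + T2)" using t True a by auto
      then show "eventually (\<lambda>\<tau>. x \<tau> = z \<tau>) (at t within {0..})"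
        by (intro eventually_mono[OF eventually_lt_within[of t "min T (a + T2)"]]) (use eq in auto)
    qed (use t True in \<open>auto simp: x_def\<close>)
  next
    case False
    show "evol_at x t"
    proof (rule evol_at_cong)
      show "evol_at (\<lambda>\<tau>. y (\<tau> + - a)) t"
        using y t False by (intro evol_at_shift filterlim_shift_left) (auto simp: evol_def)
      show "eventually (\<lambda>\<tau>. x \<tau> = y (\<tau> + - a)) (at t within {0..})"
        using False by (intro eventually_mono[OF eventually_gt_within[of a t]]) (auto simp: x_def)
    qed (use t False in \<open>auto simp: x_def\<close>)
  qed
qed

lemma flow_restart:
  assumes "evol z T" "z 0 = z0" "0 \<le> a" "a < T" "evol y T2" "y 0 = z a"
  shows "ereal (a + T2) \<le> max_time z0" "\<And>t. 0 \<le> t \<Longrightarrow> t < T2 \<Longrightarrow> flow z0 (a + t) = y t"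
proof -
  let ?x = "\<lambda>t. if t \<le> a then z t else y (t - a)"
  have x: "evol ?x (a + T2)" "?x 0 = z0"
    using evol_glue[OF assms(1,5,3,4,6)] assms by auto
  show "ereal (a + T2) \<le> max_time z0"
    by (rule evol_le_max_time[OF x])
  fix t assume "0 \<le> t" "t < T2"
  then show "flow z0 (a + t) = y t"
    using flow_eq[OF x, of "a + t"] assms by (cases "t = 0") auto
qed

lemma lifespan_le_max_time:
  assumes "z0 \<in> Sy" "wnorm_le w0 z0 R" "R < R'"
  shows "ereal (lifespan R') \<le> max_time z0"
  by (rule local_solution[OF assms]) (rule evol_le_max_time)

lemma max_time_pos:
  assumes "z0 \<in> Sy" "wnorm_le w0 z0 R"
  shows "0 < max_time z0" "flow z0 0 = z0"
proof -
  have *: "0 < lifespan (R + 1)"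
    using wnorm_le_nonneg[OF assms(2)] by (intro lifespan_pos) auto
  have le: "ereal (lifespan (R + 1)) \<le> max_time z0"
    using lifespan_le_max_time[OF assms, of "R + 1"] by simp
  show "0 < max_time z0"
    by (rule less_le_trans[OF _ le]) (use * in simp)
  show "flow z0 0 = z0"
    by (rule evol_flow(2)[OF * le])
qed

lemma flow_bound:
  assumes "0 < T" "ereal T < max_time z0"
  obtains M where "0 < M" "\<And>t. t \<in> {0..T} \<Longrightarrow> wnorm_le w0 (flow z0 t) M"
    "\<And>t. t \<in> {0..T} \<Longrightarrow> flow z0 t \<in> Sy"
proof -
  obtain z T1 where z: "T < T1" "evol z T1" "z 0 = z0"
    using lt_max_time[OF assms(2)] by blast
  then have le: "ereal T1 \<le> max_time z0" by (intro evol_le_max_time)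
  have fl: "evol (flow z0) T1" by (rule evol_flow(1)[OF _ le]) (use z assms in auto)
  obtain M where M: "0 < M" "\<And>t. t \<in> {0..T} \<Longrightarrow> wnorm_le w0 (flow z0 t) M"
    using evol_bound[OF fl z(1)] by blast
  have "flow z0 t \<in> Sy" if "t \<in> {0..T}" for t
    using fl that z(1) by (auto simp: evol_def evol_at_def)
  with M show thesis using that by blast
qed

text \<open>The flow is bounded by some \<open>M\<close> on \<open>{0..T}\<close>, so local
  dependence can be restarted anywhere with one step length \<open>h\<close>, and finitely many
  restarts reach T. The survival of perturbed solutions past T comes out of the same
  induction.\<close>

lemma continuous_dependence:
  assumes z0: "z0 \<in> Sy" "wnorm_le w0 z0 B0" and T: "0 < T" "ereal T < max_time z0" and "0 < \<epsilon>"
  obtains \<delta> where "0 < \<delta>"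
    "\<And>v. v \<in> Sy \<Longrightarrow> wnorm_le w0 (\<lambda>i. v i - z0 i) \<delta> \<Longrightarrow>
      ereal T < max_time v \<and> (\<forall>t\<in>{0..T}. wnorm_le w0 (\<lambda>i. flow v t i - flow z0 t i) \<epsilon>)"
proof -
  obtain M where M: "0 < M" "\<And>t. t \<in> {0..T} \<Longrightarrow> wnorm_le w0 (flow z0 t) M"
    "\<And>t. t \<in> {0..T} \<Longrightarrow> flow z0 t \<in> Sy"
    using flow_bound[OF T] by blast
  define h where "h = lifespan (M + 1)"
  have h: "0 < h" unfolding h_def using M by (intro lifespan_pos) auto
  obtain zT T1 where zT: "T < T1" "evol zT T1" "zT 0 = z0"
    using lt_max_time[OF T(2)] by blast
  \<comment> \<open>\<epsilon> is quantified inside \<open>P\<close>, since a restart at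
    \<open>a\<close> demands closeness there in terms of the \<delta> belonging to the next
    step.\<close>
  define P where "P = (\<lambda>a. \<forall>\<epsilon>>0. \<exists>\<delta>>0. \<forall>v\<in>Sy. wnorm_le w0 (\<lambda>i. v i - z0 i) \<delta> \<longrightarrow>
      ereal a < max_time v \<and> (\<forall>t\<in>{0..a}. wnorm_le w0 (\<lambda>i. flow v t i - flow z0 t i) \<epsilon>))"
  have P0: "P 0"
    unfolding P_def
  proof (intro allI impI)
    fix \<epsilon> :: real assume "0 < \<epsilon>"
    have "ereal 0 < max_time v \<and> (\<forall>t\<in>{0..0}. wnorm_le w0 (\<lambda>i. flow v t i - flow z0 t i) \<epsilon>)"
      if v: "v \<in> Sy" "wnorm_le w0 (\<lambda>i. v i - z0 i) \<epsilon>" for v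
    proof -
      have "wnorm_le w0 v (\<epsilon> + B0)"
        by (rule wnorm_le_of_diff[OF v(2) z0(2)]) simp
      from max_time_pos[OF v(1) this] max_time_pos[OF z0] v(2) show ?thesis
        by (simp add: zero_ereal_def)
    qed
    then show "\<exists>\<delta>>0. \<forall>v\<in>Sy. wnorm_le w0 (\<lambda>i. v i - z0 i) \<delta> \<longrightarrow>
        ereal 0 < max_time v \<and> (\<forall>t\<in>{0..0}. wnorm_le w0 (\<lambda>i. flow v t i - flow z0 t i) \<epsilon>)"
      using \<open>0 < \<epsilon>\<close> by blast
  qed
  have step: "P b" if a: "P a" "0 \<le> a" "a \<le> b" "b < a + h" "b \<le> T" for a b
    unfolding P_def
  proof (intro allI impI)
    fix \<epsilon> :: real assume \<epsilon>: "0 < \<epsilon>"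
    have aT: "a \<in> {0..T}" using a by auto
    obtain zz where zz: "zz 0 = flow z0 a" "evol zz h"
      by (rule local_solution[OF M(3)[OF aT] M(2)[OF aT], of "M + 1"]) (auto simp: h_def)
    have zTa: "zz 0 = zT a"
      using zz flow_eq[OF zT(2,3), of a] aT zT(1) by auto
    have zz_eq: "flow z0 (a + t) = zz t" if "0 \<le> t" "t < h" for t
      by (rule flow_restart(2)[OF zT(2,3) _ _ zz(2) zTa that]) (use aT zT(1) in auto)
    obtain \<delta>1 where \<delta>1: "0 < \<delta>1" "\<And>v. v \<in> Sy \<Longrightarrow> wnorm_le w0 (\<lambda>i. v i - flow z0 a i) \<delta>1 \<Longrightarrow>
        \<exists>y. y 0 = v \<and> evol y h \<and> (\<forall>t\<in>{0..<h}. wnorm_le w0 (\<lambda>i. y t i - zz t i) \<epsilon>)"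
      by (rule local_dependence[where z = zz and R = M and \<epsilon> = \<epsilon>, OF M(3)[OF aT] M(2)[OF aT]])
        (use zz M(1) \<epsilon> in \<open>auto simp: h_def\<close>)
    have "0 < min \<epsilon> \<delta>1" using \<epsilon> \<delta>1 by simp
    then obtain \<delta> where \<delta>: "0 < \<delta>" "\<And>v. v \<in> Sy \<Longrightarrow> wnorm_le w0 (\<lambda>i. v i - z0 i) \<delta> \<Longrightarrow>
        ereal a < max_time v \<and> (\<forall>t\<in>{0..a}. wnorm_le w0 (\<lambda>i. flow v t i - flow z0 t i) (min \<epsilon> \<delta>1))"
      using a(1) unfolding P_def by blast
    have "ereal b < max_time v \<and> (\<forall>t\<in>{0..b}. wnorm_le w0 (\<lambda>i. flow v t i - flow z0 t i) \<epsilon>)"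
      if v: "v \<in> Sy" "wnorm_le w0 (\<lambda>i. v i - z0 i) \<delta>" for v
    proof -
      note d = \<delta>(2)[OF v]
      then obtain zv Tv where zv: "a < Tv" "evol zv Tv" "zv 0 = v"
        using lt_max_time by blast
      have fl: "flow v a = zv a" using flow_eq[OF zv(2,3) a(2) zv(1)] .
      have "wnorm_le w0 (\<lambda>i. flow v a i - flow z0 a i) (min \<epsilon> \<delta>1)"
        using d a(2) by auto
      then have "wnorm_le w0 (\<lambda>i. flow v a i - flow z0 a i) \<delta>1"
        by (rule wnorm_le_mono) simp
      moreover have "flow v a \<in> Sy"
        using zv a(2) unfolding fl by (auto simp: evol_def evol_at_def)
      ultimately obtain y where y: "y 0 = flow v a" "evol y h"
        "\<And>t. t \<in> {0..<h} \<Longrightarrow> wnorm_le w0 (\<lambda>i. y t i - zz t i) \<epsilon>"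
        using \<delta>1(2) by blast
      have y0: "y 0 = zv a" using y(1) fl by simp
      note r = flow_restart[OF zv(2,3) a(2) zv(1) y(2) y0]
      have "ereal b < max_time v"
        by (rule less_le_trans[OF _ r(1)]) (use a(4) in simp)
      moreover have "wnorm_le w0 (\<lambda>i. flow v t i - flow z0 t i) \<epsilon>" if t: "t \<in> {0..b}" for t
      proof (cases "t \<le> a")
        case True
        then have "wnorm_le w0 (\<lambda>i. flow v t i - flow z0 t i) (min \<epsilon> \<delta>1)"
          using d t by auto
        then show ?thesis by (rule wnorm_le_mono) simp
      next
        case False
        have "flow v t = y (t - a)" "flow z0 t = zz (t - a)"
          using r(2)[of "t - a"] zz_eq[of "t - a"] False t a by auto
        then show ?thesis using y(3)[of "t - a"] False t a by auto
      qed
      ultimately show ?thesis by blast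
    qed
    then show "\<exists>\<delta>>0. \<forall>v\<in>Sy. wnorm_le w0 (\<lambda>i. v i - z0 i) \<delta> \<longrightarrow>
        ereal b < max_time v \<and> (\<forall>t\<in>{0..b}. wnorm_le w0 (\<lambda>i. flow v t i - flow z0 t i) \<epsilon>)"
      using \<delta>(1) by blast
  qed
  \<comment> \<open>Steps of length \<open>h / 2\<close>, because a single step must be strictly
    shorter than \<open>h\<close>.\<close>
  have "P (min T (real n * (h / 2)))" for n
  proof (induction n)
    case 0
    then show ?case using P0 T by simp
  next
    case (Suc n)
    show ?case
      by (rule step[OF Suc]) (use h T in \<open>auto simp: min_def algebra_simps\<close>)
  qed
  moreover obtain n where "T / (h / 2) \<le> real n"
    using real_arch_simple by blast
  then have "min T (real n * (h / 2)) = T"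
    using h by (simp add: field_simps)
  ultimately have "P T" by metis
  then show thesis using that \<open>0 < \<epsilon>\<close> unfolding P_def by blast
qed

section \<open>Time derivatives in the norm of \<open>w1\<close>\<close>

lemma F_evol_continuous:
  assumes z: "evol z T" and t: "t \<in> {0..<T}" and "0 < \<epsilon>"
  shows "eventually (\<lambda>\<tau>. wnorm_le w1 (\<lambda>i. F (z \<tau>) i - F (z t) i) \<epsilon>) (at t within {0..})"
proof -
  obtain B where B: "0 < B" "\<And>\<tau>. \<tau> \<in> {0..(t + T) / 2} \<Longrightarrow> wnorm_le w0 (z \<tau>) B"
    using evol_bound[OF z, of "(t + T) / 2"] t by auto
  define \<delta> where "\<delta> = \<epsilon> / (1 + CL B)"
  have C: "0 \<le> CL B" by (rule CL_nonneg)
  have \<delta>: "0 < \<delta>" "CL B * \<delta> \<le> \<epsilon>"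
    using C \<open>0 < \<epsilon>\<close> by (auto simp: \<delta>_def field_simps intro!: divide_pos_pos add_pos_nonneg)
  have e: "evol_at z t" using z t by (auto simp: evol_def)
  have "eventually (\<lambda>\<tau>. wnorm_le w0 (\<lambda>i. z \<tau> i - z t i) \<delta>) (at t within {0..})"
    using e \<delta> by (auto simp: evol_at_def)
  moreover have "eventually (\<lambda>\<tau>. 0 \<le> \<tau> \<and> \<tau> < (t + T) / 2) (at t within {0..})"
    by (rule eventually_lt_within) (use t in auto)
  ultimately show ?thesis
  proof eventually_elim
    case (elim \<tau>)
    have "evol_at z \<tau>" using z elim t by (auto simp: evol_def)
    then have "wnorm_le w1 (\<lambda>i. F (z \<tau>) i - F (z t) i) (CL B * \<delta>)"
      using e elim t B by (intro F_lip) (auto simp: evol_at_def)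
    then show ?case using \<delta> by (auto intro: wnorm_le_mono)
  qed
qed

text \<open>A mean value inequality by duality: the error \<open>q\<close> of the difference
  quotient is paired with itself, which reduces the claim to the mean value theorem for one real
  function and the norm continuity of \<open>F\<close> along the solution.\<close>

lemma evol_strong_derivative:
  assumes z: "evol z T" and t: "t \<in> {0..<T}" and "0 < \<epsilon>"
  shows "eventually (\<lambda>\<tau>. wnorm_le w1 (\<lambda>i. (z \<tau> i - z t i) / of_real (\<tau> - t) - F (z t) i) \<epsilon>) (at t within {0..})"
proof -
  have "eventually (\<lambda>\<tau>. wnorm_le w1 (\<lambda>i. F (z \<tau>) i - F (z t) i) \<epsilon>) (at t within {0..})"
    by (rule F_evol_continuous[OF assms])
  moreover have "eventually (\<lambda>\<tau>. 0 \<le> \<tau> \<and> \<tau> < T) (at t within {0..})"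
    by (rule eventually_lt_within) (use t in auto)
  ultimately have "eventually (\<lambda>\<tau>. wnorm_le w1 (\<lambda>i. F (z \<tau>) i - F (z t) i) \<epsilon> \<and> \<tau> < T) (at t within {0..})"
    by eventually_elim auto
  then obtain d where d: "0 < d" "\<And>\<tau>. \<tau> \<in> {0..} \<Longrightarrow> \<tau> \<noteq> t \<Longrightarrow> dist \<tau> t < d \<Longrightarrow>
      wnorm_le w1 (\<lambda>i. F (z \<tau>) i - F (z t) i) \<epsilon> \<and> \<tau> < T"
    unfolding eventually_at by blast
  have near: "wnorm_le w1 (\<lambda>i. F (z r) i - F (z t) i) \<epsilon> \<and> r < T" if "0 \<le> r" "dist r t < d" for r
    using d(2)[of r] that t \<open>0 < \<epsilon>\<close> by (cases "r = t") auto
  have main: "wnorm_le w1 (\<lambda>i. (z \<tau> i - z t i) / of_real (\<tau> - t) - F (z t) i) \<epsilon>"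
    if \<tau>: "0 \<le> \<tau>" "\<tau> \<noteq> t" "dist \<tau> t < d" for \<tau>
  proof (rule wnorm_leI)
    fix X :: "'i set" assume X: "finite X"
    define q where "q = (\<lambda>i. (z \<tau> i - z t i) / of_real (\<tau> - t) - F (z t) i)"
    \<comment> \<open>\<open>\<phi> \<tau> - \<phi> t\<close> is \<open>\<tau> - t\<close> times the
      squared norm of \<open>q\<close> on \<open>X\<close>, while the derivative of
      \<open>\<phi>\<close> pairs \<open>q\<close> with \<open>F (z r) - F (z t)\<close>, of norm at
      most \<epsilon>; one factor of the norm of \<open>q\<close> cancels.\<close>
    define \<phi> where "\<phi> = (\<lambda>r. \<Sum>i\<in>X. (w1 i)\<^sup>2 * (q i \<bullet> (z r i - of_real r * F (z t) i)))"
    define \<phi>' where "\<phi>' = (\<lambda>r. \<Sum>i\<in>X. (w1 i)\<^sup>2 * (q i \<bullet> (F (z r) i - F (z t) i)))"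
    define lo hi where "lo = min \<tau> t" and "hi = max \<tau> t"
    have dv: "(\<phi> has_real_derivative \<phi>' r) (at r within {0..})" if r: "0 \<le> r" "r < T" for r
    proof -
      have "((\<lambda>r. z r i - of_real r * F (z t) i) has_vector_derivative F (z r) i - F (z t) i) (at r within {0..})" for i
      proof -
        have "((\<lambda>r. z r i) has_vector_derivative F (z r) i) (at r within {0..})"
          using z r by (auto simp: evol_def evol_at_def)
        moreover have "((\<lambda>r. of_real r * F (z t) i) has_vector_derivative F (z t) i) (at r within {0..})"
          by (auto intro!: derivative_eq_intros simp: has_vector_derivative_def scaleR_conv_of_real)
        ultimately show ?thesis by (rule has_vector_derivative_diff)
      qed
      then have "((\<lambda>r. q i \<bullet> (z r i - of_real r * F (z t) i)) has_vector_derivative q i \<bullet> (F (z r) i - F (z t) i)) (at r within {0..})" for i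
        by (rule bounded_linear.has_vector_derivative[OF bounded_linear_inner_right])
      then show ?thesis
        unfolding \<phi>_def \<phi>'_def has_real_derivative_iff_has_vector_derivative[symmetric]
        by (intro DERIV_sum DERIV_cmult)
    qed
    have "\<exists>r\<in>{lo<..<hi}. \<phi> hi - \<phi> lo = (\<lambda>h. \<phi>' r * h) (hi - lo)"
    proof (rule mvt_simple)
      show "lo < hi" using \<tau> by (auto simp: lo_def hi_def)
      fix r assume r: "lo \<le> r" "r \<le> hi"
      have "0 \<le> r" "r < T"
        using r \<tau> t near[of \<tau>] by (auto simp: lo_def hi_def min_def max_def split: if_splits)
      then have "(\<phi> has_real_derivative \<phi>' r) (at r within {lo..hi})"
        by (intro DERIV_subset[OF dv]) (use \<tau> t in \<open>auto simp: lo_def min_def split: if_splits\<close>)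
      then show "(\<phi> has_derivative (\<lambda>h. \<phi>' r * h)) (at r within {lo..hi})"
        by (simp add: has_field_derivative_def)
    qed
    then obtain r where r: "lo < r" "r < hi" "\<phi> hi - \<phi> lo = \<phi>' r * (hi - lo)" by auto
    have eq: "\<phi> \<tau> - \<phi> t = \<phi>' r * (\<tau> - t)"
      using r(3) by (cases "\<tau> \<le> t") (auto simp: lo_def hi_def min_def max_def algebra_simps split: if_splits)
    have "\<phi> \<tau> - \<phi> t = (\<Sum>i\<in>X. (w1 i)\<^sup>2 * ((\<tau> - t) * (q i \<bullet> q i)))"
      unfolding \<phi>_def sum_subtractf[symmetric]
    proof (intro sum.cong refl)
      fix i
      have "(\<tau> - t) *\<^sub>R q i = (z \<tau> i - z t i) - of_real (\<tau> - t) * F (z t) i"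
        unfolding q_def scaleR_conv_of_real right_diff_distrib using \<tau>(2) by simp
      then have "z \<tau> i - of_real \<tau> * F (z t) i - (z t i - of_real t * F (z t) i) = (\<tau> - t) *\<^sub>R q i"
        by (simp add: algebra_simps)
      then show "(w1 i)\<^sup>2 * (q i \<bullet> (z \<tau> i - of_real \<tau> * F (z t) i)) - (w1 i)\<^sup>2 * (q i \<bullet> (z t i - of_real t * F (z t) i))
          = (w1 i)\<^sup>2 * ((\<tau> - t) * (q i \<bullet> q i))"
        by (metis inner_diff_right inner_scaleR_right right_diff_distrib)
    qed
    also have "\<dots> = (\<tau> - t) * (\<Sum>i\<in>X. (w1 i * cmod (q i))\<^sup>2)"
      by (simp add: sum_distrib_left power_mult_distrib dot_square_norm mult_ac)
    finally have "(\<Sum>i\<in>X. (w1 i * cmod (q i))\<^sup>2) = \<phi>' r"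
      using eq \<tau> by simp
    also have "\<phi>' r \<le> (\<Sum>i\<in>X. \<bar>w1 i * cmod (q i)\<bar> * \<bar>w1 i * cmod (F (z r) i - F (z t) i)\<bar>)"
      unfolding \<phi>'_def
    proof (rule sum_mono)
      fix i
      have "q i \<bullet> (F (z r) i - F (z t) i) \<le> cmod (q i) * cmod (F (z r) i - F (z t) i)"
        by (rule norm_cauchy_schwarz)
      then have "(w1 i)\<^sup>2 * (q i \<bullet> (F (z r) i - F (z t) i)) \<le> (w1 i)\<^sup>2 * (cmod (q i) * cmod (F (z r) i - F (z t) i))"
        by (intro mult_left_mono) auto
      then show "(w1 i)\<^sup>2 * (q i \<bullet> (F (z r) i - F (z t) i))
          \<le> \<bar>w1 i * cmod (q i)\<bar> * \<bar>w1 i * cmod (F (z r) i - F (z t) i)\<bar>"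
        by (simp add: power2_eq_square mult_ac)
    qed
    also have "\<dots> \<le> L2_set (\<lambda>i. w1 i * cmod (q i)) X * L2_set (\<lambda>i. w1 i * cmod (F (z r) i - F (z t) i)) X"
      by (rule L2_set_mult_ineq)
    also have "\<dots> \<le> L2_set (\<lambda>i. w1 i * cmod (q i)) X * \<epsilon>"
    proof (intro mult_left_mono L2_set_nonneg wnorm_leD[OF _ X])
      have "0 \<le> r" "dist r t < d"
        using r \<tau> t by (auto simp: lo_def hi_def dist_real_def min_def max_def split: if_splits)
      then show "wnorm_le w1 (\<lambda>i. F (z r) i - F (z t) i) \<epsilon>" using near by blast
    qed
    finally have "L2_set (\<lambda>i. w1 i * cmod (q i)) X * L2_set (\<lambda>i. w1 i * cmod (q i)) X
        \<le> L2_set (\<lambda>i. w1 i * cmod (q i)) X * \<epsilon>"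
      by (simp add: L2_set_def sum_nonneg)
    then have "L2_set (\<lambda>i. w1 i * cmod (q i)) X \<le> \<epsilon>"
      using L2_set_nonneg[of "\<lambda>i. w1 i * cmod (q i)" X] \<open>0 < \<epsilon>\<close>
      by (cases "L2_set (\<lambda>i. w1 i * cmod (q i)) X = 0") (simp_all add: mult_le_cancel_left)
    then show "L2_set (\<lambda>i. w1 i * cmod ((z \<tau> i - z t i) / of_real (\<tau> - t) - F (z t) i)) X \<le> \<epsilon>"
      by (simp only: q_def)
  qed
  show ?thesis
    unfolding eventually_at using d(1) main by auto
qed

end

section \<open>Trilinear estimates\<close>

lemma sum_mult_le_of_L2:
  fixes p q :: "'a \<Rightarrow> real"
  assumes "\<And>i. 0 \<le> p i" "\<And>i. 0 \<le> q i" "L2_set p X \<le> P" "L2_set q X \<le> Q"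
  shows "(\<Sum>i\<in>X. p i * q i) \<le> P * Q"
proof -
  have "(\<Sum>i\<in>X. p i * q i) = (\<Sum>i\<in>X. \<bar>p i\<bar> * \<bar>q i\<bar>)"
    using assms by simp
  also have "\<dots> \<le> L2_set p X * L2_set q X"
    by (rule L2_set_mult_ineq)
  also have "\<dots> \<le> P * Q"
    using assms(3,4) L2_set_nonneg[of p X] L2_set_nonneg[of q X] by (intro mult_mono) linarith+
  finally show ?thesis .
qed

lemma L2_set_reindex:
  assumes "inj_on h X"
  shows "L2_set (\<lambda>i. f (h i)) X = L2_set f (h ` X)"
  unfolding L2_set_def using assms by (simp add: sum.reindex)

text \<open>Cauchy-Schwarz twice: in j for fixed k, where injectivity of \<open>h k\<close> turns
  the shifted factor into a rearrangement, then in k, where the square-summable \<open>g\<close>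
  serves as the second factor.\<close>

lemma convolution_sum_le:
  fixes g p q r :: "int \<Rightarrow> real"
  assumes nn: "\<And>i. 0 \<le> g i" "\<And>i. 0 \<le> p i" "\<And>i. 0 \<le> q i" "\<And>i. 0 \<le> r i"
    and G: "\<And>X. finite X \<Longrightarrow> L2_set g X \<le> G" and P: "\<And>X. finite X \<Longrightarrow> L2_set p X \<le> P"
    and Q: "\<And>X. finite X \<Longrightarrow> L2_set q X \<le> Q" and R: "\<And>X. finite X \<Longrightarrow> L2_set r X \<le> R"
    and fin: "finite X" "\<And>k. finite (Y k)" and inj: "\<And>k. inj (h k)"
  shows "(\<Sum>k\<in>X. \<Sum>j\<in>Y k. g k * p k * q j * r (h k j)) \<le> G * P * Q * R"
proof -
  have "(\<Sum>k\<in>X. \<Sum>j\<in>Y k. g k * p k * q j * r (h k j))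
      = (\<Sum>k\<in>X. g k * p k * (\<Sum>j\<in>Y k. q j * r (h k j)))"
    by (simp add: sum_distrib_left mult.assoc)
  also have "\<dots> \<le> (\<Sum>k\<in>X. g k * p k * (Q * R))"
  proof (intro sum_mono mult_left_mono sum_mult_le_of_L2 nn Q fin mult_nonneg_nonneg)
    fix k
    have "inj_on (h k) (Y k)" using inj[of k] by (rule inj_on_subset) auto
    then show "L2_set (\<lambda>j. r (h k j)) (Y k) \<le> R"
      using R fin by (simp add: L2_set_reindex)
  qed
  also have "\<dots> = (\<Sum>k\<in>X. g k * p k) * (Q * R)"
    by (simp add: sum_distrib_right)
  also have "\<dots> \<le> (G * P) * (Q * R)"
    using Q[of "{}"] R[of "{}"] by (intro mult_right_mono sum_mult_le_of_L2 nn G P fin) auto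
  finally show ?thesis by (simp add: mult.assoc)
qed

text \<open>For each of the three placements of \<open>g\<close>, the variable carrying it is made
  the outer one; the other two functions form the inner convolution.\<close>

lemma trilinear_sum_le:
  fixes g p q r :: "int \<Rightarrow> real"
  assumes nn: "\<And>i. 0 \<le> g i" "\<And>i. 0 \<le> p i" "\<And>i. 0 \<le> q i" "\<And>i. 0 \<le> r i"
    and G: "\<And>X. finite X \<Longrightarrow> L2_set g X \<le> G" and P: "\<And>X. finite X \<Longrightarrow> L2_set p X \<le> P"
    and Q: "\<And>X. finite X \<Longrightarrow> L2_set q X \<le> Q" and R: "\<And>X. finite X \<Longrightarrow> L2_set r X \<le> R"
    and fin: "finite X" "finite Y"
  shows "(\<Sum>k\<in>X. \<Sum>j\<in>Y. (g k + g j + g (k - j)) * (p k * q j * r (k - j))) \<le> 3 * (G * P * Q * R)"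
proof -
  have inj: "inj (\<lambda>j. k - j)" "inj (\<lambda>l. l - k)" for k :: int
    by (auto simp: inj_on_def)
  have 1: "(\<Sum>k\<in>X. \<Sum>j\<in>Y. g k * p k * q j * r (k - j)) \<le> G * P * Q * R"
    by (rule convolution_sum_le[OF nn G P Q R]) (use fin inj in auto)
  have "(\<Sum>k\<in>X. \<Sum>j\<in>Y. g j * q j * p k * r (k - j)) = (\<Sum>j\<in>Y. \<Sum>k\<in>X. g j * q j * p k * r (k - j))"
    by (rule sum.swap)
  also have "\<dots> \<le> G * Q * P * R"
    by (rule convolution_sum_le[OF nn(1,3,2,4) G Q P R]) (use fin inj in auto)
  finally have 2: "(\<Sum>k\<in>X. \<Sum>j\<in>Y. g j * q j * p k * r (k - j)) \<le> G * Q * P * R" .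
  \<comment> \<open>In the third placement the outer variable is l = k - j. The sheared index set is
    enlarged to a rectangle, which nonnegativity permits.\<close>
  define Z where "Z = (\<lambda>(k, j). k - j) ` (X \<times> Y)"
  have Z: "finite Z" using fin by (simp add: Z_def)
  have "(\<Sum>k\<in>X. \<Sum>j\<in>Y. g (k - j) * r (k - j) * p k * q j)
      \<le> (\<Sum>k\<in>X. \<Sum>l\<in>Z. g l * r l * p k * q (k - l))"
  proof (rule sum_mono)
    fix k assume k: "k \<in> X"
    have "(\<Sum>j\<in>Y. g (k - j) * r (k - j) * p k * q j) = (\<Sum>l\<in>(\<lambda>j. k - j) ` Y. g l * r l * p k * q (k - l))"
      by (subst sum.reindex) (auto simp: inj_on_def)
    also have "\<dots> \<le> (\<Sum>l\<in>Z. g l * r l * p k * q (k - l))"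
      by (rule sum_mono2) (use Z k nn in \<open>auto simp: Z_def intro!: mult_nonneg_nonneg\<close>)
    finally show "(\<Sum>j\<in>Y. g (k - j) * r (k - j) * p k * q j) \<le> (\<Sum>l\<in>Z. g l * r l * p k * q (k - l))" .
  qed
  also have "\<dots> = (\<Sum>l\<in>Z. \<Sum>k\<in>X. g l * r l * p k * q (k - l))"
    by (rule sum.swap)
  also have "\<dots> \<le> G * R * P * Q"
    by (rule convolution_sum_le[OF nn(1,4,2,3) G R P Q]) (use fin Z inj in auto)
  finally have 3: "(\<Sum>k\<in>X. \<Sum>j\<in>Y. g (k - j) * r (k - j) * p k * q j) \<le> G * R * P * Q" .
  have "(\<Sum>k\<in>X. \<Sum>j\<in>Y. (g k + g j + g (k - j)) * (p k * q j * r (k - j)))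
      = (\<Sum>k\<in>X. \<Sum>j\<in>Y. g k * p k * q j * r (k - j)) + (\<Sum>k\<in>X. \<Sum>j\<in>Y. g j * q j * p k * r (k - j))
        + (\<Sum>k\<in>X. \<Sum>j\<in>Y. g (k - j) * r (k - j) * p k * q j)"
    by (simp add: sum.distrib[symmetric] algebra_simps)
  then show ?thesis using 1 2 3 by (simp add: mult_ac)
qed

section \<open>Symbol calculus\<close>

text \<open>The bracket of the overview; the factor 2 pi makes \<open>sob_weight r k\<close> the
  square of \<open>jap k powr r\<close>.\<close>

definition jap :: "int \<Rightarrow> real" where
  "jap k = sqrt (1 + (2 * pi * real_of_int k)\<^sup>2)"

lemma jap_ge1 [simp]: "1 \<le> jap k"
  by (simp add: jap_def)

lemma jap_pos [simp]: "0 < jap k" and jap_nonneg [simp]: "0 \<le> jap k" and jap_ne0 [simp]: "jap k \<noteq> 0"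
  using jap_ge1[of k] by linarith+

lemma jap_minus [simp]: "jap (- k) = jap k"
  by (simp add: jap_def)

lemma jap_0 [simp]: "jap 0 = 1"
  by (simp add: jap_def)

lemma jap_minus_commute: "jap (j - k) = jap (k - j)"
  using jap_minus[of "k - j"] by simp

lemma abs_le_jap: "\<bar>2 * pi * real_of_int k\<bar> \<le> jap k"
  unfolding jap_def by (rule real_le_rsqrt) simp

lemma abs_int_le_jap: "\<bar>real_of_int k\<bar> \<le> jap k"
proof -
  have "1 * \<bar>real_of_int k\<bar> \<le> 2 * pi * \<bar>real_of_int k\<bar>"
    using pi_gt3 by (intro mult_right_mono) auto
  then show ?thesis using abs_le_jap[of k] by (simp add: abs_mult)
qed

lemma jap_triangle: "jap k \<le> jap j + jap (k - j)"
proof -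
  define a b where "a = 2 * pi * real_of_int j" and "b = 2 * pi * real_of_int (k - j)"
  have "\<bar>a\<bar> * \<bar>b\<bar> \<le> jap j * jap (k - j)"
    unfolding a_def b_def by (intro mult_mono abs_le_jap) auto
  then have "a * b \<le> jap j * jap (k - j)"
    by (metis abs_ge_self abs_mult order_trans)
  moreover have "(jap j)\<^sup>2 = 1 + a\<^sup>2" "(jap (k - j))\<^sup>2 = 1 + b\<^sup>2"
    by (simp_all add: jap_def a_def b_def)
  moreover have "1 + (2 * pi * real_of_int k)\<^sup>2 = 1 + (a + b)\<^sup>2"
    by (simp add: a_def b_def algebra_simps)
  ultimately have "1 + (2 * pi * real_of_int k)\<^sup>2 \<le> (jap j + jap (k - j))\<^sup>2"
    by (simp add: power2_sum)
  then show ?thesis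
    unfolding jap_def[of k] by (rule real_le_lsqrt[rotated]) (auto intro: add_nonneg_nonneg)
qed

lemma jap_diff: "\<bar>jap k - jap j\<bar> \<le> jap (k - j)"
  using jap_triangle[of k j] jap_triangle[of j k] by (simp add: jap_minus_commute[of j k] abs_le_iff)

lemma jap_mono: "\<bar>k\<bar> \<le> \<bar>j\<bar> \<Longrightarrow> jap k \<le> jap j"
proof -
  assume "\<bar>k\<bar> \<le> \<bar>j\<bar>"
  then have "\<bar>real_of_int k\<bar> \<le> \<bar>real_of_int j\<bar>" by linarith
  then have "(real_of_int k)\<^sup>2 \<le> (real_of_int j)\<^sup>2" by (simp add: abs_le_square_iff)
  then show ?thesis by (simp add: jap_def power_mult_distrib)
qed

lemma finite_jap_less: "finite {k. jap k < c}"
proof (rule finite_subset)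
  show "{k. jap k < c} \<subseteq> {- \<lceil>c\<rceil>..\<lceil>c\<rceil>}"
  proof
    fix k assume "k \<in> {k. jap k < c}"
    then have "\<bar>real_of_int k\<bar> < c" using abs_int_le_jap[of k] by simp
    then show "k \<in> {- \<lceil>c\<rceil>..\<lceil>c\<rceil>}" by (simp add: abs_less_iff) linarith
  qed
qed simp

text \<open>Comparison with the sum of (1 + |k|)^(-2a), convergent because 2a > 1, on each half-line
  separately.\<close>

lemma jap_powr_L2_bound:
  assumes "1 / 2 < a"
  obtains G where "0 \<le> G" "\<And>X. finite X \<Longrightarrow> L2_set (\<lambda>k. jap k powr - a) X \<le> G"
    "(\<lambda>k. jap k powr (- 2 * a)) summable_on UNIV"
proof -
  have s: "summable (\<lambda>n. real (Suc n) powr (- 2 * a))"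
    using assms summable_Suc_iff[of "\<lambda>n. real n powr (- 2 * a)"] summable_real_powr_iff[of "- 2 * a"]
    by simp
  define M where "M = (\<Sum>n. real (Suc n) powr (- 2 * a))"
  have half: "(\<Sum>n\<in>Z. real (Suc n) powr (- 2 * a)) \<le> M" if "finite Z" for Z
    unfolding M_def by (rule sum_le_suminf[OF s that]) auto
  have le: "jap k powr (- 2 * a) \<le> real (Suc (nat \<bar>k\<bar>)) powr (- 2 * a) * 2 powr (2 * a)" for k
  proof -
    have "real (Suc (nat \<bar>k\<bar>)) \<le> 2 * jap k"
    proof -
      have "real (Suc (nat \<bar>k\<bar>)) = 1 + \<bar>real_of_int k\<bar>" by simp
      then show ?thesis using abs_int_le_jap[of k] jap_ge1[of k] by linarith
    qed
    then have "(2 * jap k) powr (- 2 * a) \<le> real (Suc (nat \<bar>k\<bar>)) powr (- 2 * a)"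
      using assms by (intro powr_mono2') auto
    moreover have "(2 * jap k) powr (- 2 * a) * 2 powr (2 * a) = jap k powr (- 2 * a)"
      by (simp add: powr_mult powr_minus field_simps)
    ultimately show ?thesis
      by (metis mult_right_mono powr_ge_zero)
  qed
  have bound: "(\<Sum>k\<in>X. jap k powr (- 2 * a)) \<le> 2 * M * 2 powr (2 * a)" if X: "finite X" for X
  proof -
    have *: "(\<Sum>k\<in>Z. real (Suc (nat \<bar>k\<bar>)) powr (- 2 * a)) \<le> M"
      if Z: "finite Z" "inj_on (\<lambda>k. nat \<bar>k\<bar>) Z" for Z :: "int set"
    proof -
      have "(\<Sum>k\<in>Z. real (Suc (nat \<bar>k\<bar>)) powr (- 2 * a)) = (\<Sum>n\<in>(\<lambda>k. nat \<bar>k\<bar>) ` Z. real (Suc n) powr (- 2 * a))"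
        using Z by (simp add: sum.reindex)
      also have "\<dots> \<le> M" using Z by (intro half) auto
      finally show ?thesis .
    qed
    have "(\<Sum>k\<in>X. jap k powr (- 2 * a)) \<le> (\<Sum>k\<in>X. real (Suc (nat \<bar>k\<bar>)) powr (- 2 * a)) * 2 powr (2 * a)"
      unfolding sum_distrib_right by (rule sum_mono) (rule le)
    also have "(\<Sum>k\<in>X. real (Suc (nat \<bar>k\<bar>)) powr (- 2 * a))
        = (\<Sum>k\<in>X \<inter> {0..}. real (Suc (nat \<bar>k\<bar>)) powr (- 2 * a)) + (\<Sum>k\<in>X - {0..}. real (Suc (nat \<bar>k\<bar>)) powr (- 2 * a))"
      using X by (rule sum.Int_Diff)
    also have "\<dots> \<le> M + M"
      using X by (intro add_mono *) (auto simp: inj_on_def)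
    finally show ?thesis by (simp add: mult_right_mono)
  qed
  have M: "0 \<le> M" using half[of "{}"] by simp
  show thesis
  proof
    show "0 \<le> sqrt (2 * M * 2 powr (2 * a))" using M by simp
    show "L2_set (\<lambda>k. jap k powr - a) X \<le> sqrt (2 * M * 2 powr (2 * a))" if "finite X" for X
    proof -
      have "(jap k powr - a)\<^sup>2 = jap k powr (- 2 * a)" for k
        by (simp add: power2_eq_square powr_add[symmetric])
      then show ?thesis
        unfolding L2_set_def using bound[OF that] by simp
    qed
    show "(\<lambda>k. jap k powr (- 2 * a)) summable_on UNIV"
    proof (rule nonneg_bdd_above_summable_on)
      show "bdd_above (sum (\<lambda>k. jap k powr (- 2 * a)) ` {F. F \<subseteq> UNIV \<and> finite F})"
        by (rule bdd_aboveI[of _ "2 * M * 2 powr (2 * a)"]) (use bound in auto)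
    qed simp
  qed
qed

text \<open>The argument of \<open>f\<close> stands for \<open>jap k\<close>.\<close>

definition moderate :: "real \<Rightarrow> nat \<Rightarrow> (real \<Rightarrow> real) \<Rightarrow> bool" where
  "moderate a p f \<longleftrightarrow> (\<forall>x y. 1 \<le> x \<longrightarrow> x \<le> y \<longrightarrow> f x \<le> f y) \<and>
     (\<forall>l x. 1 \<le> l \<longrightarrow> 1 \<le> x \<longrightarrow> f (l * x) \<le> l ^ p * f x) \<and> (\<forall>x\<ge>1. x powr a \<le> f x)"

section \<open>Algebra property and commutators for moderate weights\<close>

context
  fixes a :: real and p :: nat and f :: "real \<Rightarrow> real"
  assumes mod: "moderate a p f" and a: "0 \<le> a"
begin

lemma moderate_mono: "1 \<le> x \<Longrightarrow> x \<le> y \<Longrightarrow> f x \<le> f y"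
  and moderate_scale: "1 \<le> l \<Longrightarrow> 1 \<le> x \<Longrightarrow> f (l * x) \<le> l ^ p * f x"
  and moderate_ge: "1 \<le> x \<Longrightarrow> x powr a \<le> f x"
  using mod unfolding moderate_def by blast+

lemma moderate_ge1: "1 \<le> x \<Longrightarrow> 1 \<le> f x"
  using moderate_ge[of x] ge_one_powr_ge_zero[of x a] a by linarith

lemma moderate_pos: "1 \<le> x \<Longrightarrow> 0 < f x"
  using moderate_ge1[of x] by linarith

lemma moderate_inv: "1 \<le> x \<Longrightarrow> 1 \<le> f x * x powr - a"
  using moderate_ge[of x] by (simp add: powr_minus field_simps)

text \<open>The origin of the square-summable factor: where a weight \<open>f d\<close> is missing,
  it is inserted as \<open>f d * d powr - a\<close>, which is at least 1.\<close>

lemma moderate_sum_le_prod: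
  assumes "1 \<le> y" "1 \<le> d"
  shows "f y + f d \<le> f y * f d * (y powr - a + d powr - a)"
proof -
  have "f y * 1 \<le> f y * (f d * d powr - a)" "f d * 1 \<le> f d * (f y * y powr - a)"
    using mult_left_mono[OF moderate_inv[OF assms(2)], of "f y"] mult_left_mono[OF moderate_inv[OF assms(1)], of "f d"]
      moderate_pos[of y] moderate_pos[of d] assms by simp_all
  then show ?thesis by (simp add: algebra_simps)
qed

lemma moderate_subadditive:
  assumes "1 \<le> x" "1 \<le> y" "1 \<le> d" "x \<le> y + d"
  shows "f x \<le> 2 ^ p * (f y + f d)"
proof -
  have *: "f x \<le> 2 ^ p * f w" if "1 \<le> w" "x \<le> 2 * w" for w
    using moderate_mono[of x "2 * w"] moderate_scale[of 2 w] assms that by linarith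
  have le: "2 ^ p * f y \<le> 2 ^ p * (f y + f d)" "2 ^ p * f d \<le> 2 ^ p * (f y + f d)"
    using moderate_pos[of y] moderate_pos[of d] assms by (auto intro: mult_left_mono)
  show ?thesis
  proof (cases "d \<le> y")
    case True
    then have "f x \<le> 2 ^ p * f y" using *[of y] assms by simp
    then show ?thesis using le(1) by linarith
  next
    case False
    then have "f x \<le> 2 ^ p * f d" using *[of d] assms by simp
    then show ?thesis using le(2) by linarith
  qed
qed

lemma moderate_algebra:
  assumes "1 \<le> x" "1 \<le> y" "1 \<le> d" "x \<le> y + d"
  shows "f x \<le> 2 ^ p * (f y * f d * (y powr - a + d powr - a))"
proof -
  have "2 ^ p * (f y + f d) \<le> 2 ^ p * (f y * f d * (y powr - a + d powr - a))"
    by (intro mult_left_mono moderate_sum_le_prod assms) auto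
  then show ?thesis using moderate_subadditive[OF assms] by linarith
qed

lemma power_diff_le:
  fixes l :: real
  assumes "1 \<le> l" "l \<le> 2"
  shows "l ^ p - 1 \<le> real p * 2 ^ p * (l - 1)"
proof -
  have "(\<Sum>i<p. l ^ i) \<le> (\<Sum>i<p. 2 ^ p)"
  proof (rule sum_mono)
    fix i assume i: "i \<in> {..<p}"
    have "l ^ i \<le> 2 ^ i" using assms by (intro power_mono) auto
    also have "(2::real) ^ i \<le> 2 ^ p" using i by (intro power_increasing) auto
    finally show "l ^ i \<le> 2 ^ p" .
  qed
  then have "(l - 1) * (\<Sum>i<p. l ^ i) \<le> (l - 1) * (real p * 2 ^ p)"
    using assms by (intro mult_left_mono) auto
  then show ?thesis
    by (simp add: power_diff_1_eq mult_ac)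
qed

text \<open>A discrete form of x |f'(x)| \<le> p f(x). If \<open>y \<le> d\<close>, both arguments
  are at most \<open>2 * d\<close> and doubling suffices. Otherwise \<open>x \<le> 2 * y\<close>,
  and the scaling bound gives an increment proportional to \<open>d / y\<close>: for
  \<open>y \<le> x\<close> by expanding \<open>l ^ p - 1\<close>, for \<open>x < y\<close> by
  Bernoulli's inequality.\<close>

lemma moderate_slow:
  assumes x: "1 \<le> x" and y: "1 \<le> y" and d: "1 \<le> d" "\<bar>x - y\<bar> \<le> d"
  shows "x * \<bar>f x - f y\<bar> \<le> (real p + 1) * 2 ^ (p + 1) * (d * (f y + f d))"
proof -
  have fp: "0 < f x" "0 < f y" "0 < f d" using moderate_pos x y d by auto
  have p2: "(1::real) \<le> 2 ^ p" by simp
  show ?thesis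
  proof (cases "y \<le> d")
    case True
    have "f x \<le> f (2 * d)" "f y \<le> f (2 * d)"
      using x y d True by (auto intro!: moderate_mono)
    moreover have "f (2 * d) \<le> 2 ^ p * f d" using moderate_scale[of 2 d] d by simp
    ultimately have "\<bar>f x - f y\<bar> \<le> 2 ^ p * f d" using fp by linarith
    then have "x * \<bar>f x - f y\<bar> \<le> (2 * d) * (2 ^ p * f d)"
      using x d True by (intro mult_mono) auto
    also have "\<dots> = 1 * 2 ^ (p + 1) * (d * f d)" by simp
    also have "\<dots> \<le> (real p + 1) * 2 ^ (p + 1) * (d * (f y + f d))"
      using fp d by (intro mult_mono) auto
    finally show ?thesis .
  next
    case False
    have x2: "x \<le> 2 * y" using False d by linarith
    have "\<bar>f x - f y\<bar> \<le> real p * 2 ^ p * (d / y) * f y"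
    proof (cases "y \<le> x")
      case True
      have l: "1 \<le> x / y" "x / y \<le> 2" using True x2 y by (auto simp: field_simps)
      have "f x \<le> (x / y) ^ p * f y"
        using moderate_scale[of "x / y" y] l y by simp
      then have "f x - f y \<le> ((x / y) ^ p - 1) * f y" by (simp add: algebra_simps)
      also have "\<dots> \<le> (real p * 2 ^ p * (x / y - 1)) * f y"
        using power_diff_le[OF l] fp by (intro mult_right_mono) auto
      also have "x / y - 1 \<le> d / y"
        using divide_right_mono[of "x - y" d y] d y by (simp add: diff_divide_distrib)
      then have "(real p * 2 ^ p * (x / y - 1)) * f y \<le> (real p * 2 ^ p * (d / y)) * f y"
        using fp by (intro mult_right_mono mult_left_mono) auto
      finally show ?thesis
        using moderate_mono[of y x] True y by (simp add: abs_of_nonneg)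
    next
      case False
      have "f y \<le> (y / x) ^ p * f x"
        using moderate_scale[of "y / x" x] False x by simp
      then have "(x / y) ^ p * f y \<le> (x / y) ^ p * ((y / x) ^ p * f x)"
        using x y by (intro mult_left_mono) auto
      also have "\<dots> = f x" using x y by (simp add: power_divide)
      finally have "f y - f x \<le> (1 - (x / y) ^ p) * f y" by (simp add: algebra_simps)
      also have "1 + real p * (x / y - 1) \<le> (1 + (x / y - 1)) ^ p"
        using x y by (intro Bernoulli_inequality) auto
      then have "1 - (x / y) ^ p \<le> real p * (1 - x / y)"
        by (simp add: algebra_simps)
      also have "\<dots> \<le> real p * (d / y)"
        using divide_right_mono[of "y - x" d y] d y by (intro mult_left_mono) (auto simp: diff_divide_distrib)
      also have "\<dots> \<le> real p * 2 ^ p * (d / y)"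
        using p2 d y by (intro mult_right_mono) (auto simp: mult_le_cancel_left1)
      finally show ?thesis
        using moderate_mono[of x y] False x fp by (simp add: abs_if)
    qed
    then have "x * \<bar>f x - f y\<bar> \<le> (2 * y) * (real p * 2 ^ p * (d / y) * f y)"
      using x x2 by (intro mult_mono) auto
    also have "\<dots> = real p * 2 ^ (p + 1) * (d * f y)" using y by (simp add: field_simps)
    also have "\<dots> \<le> (real p + 1) * 2 ^ (p + 1) * (d * (f y + f d))"
      using fp d by (intro mult_mono) auto
    finally show ?thesis .
  qed
qed

lemma moderate_slow_algebra:
  assumes x: "1 \<le> x" and y: "1 \<le> y" and d: "1 \<le> d" "\<bar>x - y\<bar> \<le> d"
  shows "x * \<bar>f x - f y\<bar> \<le> (real p + 1) * 2 ^ (p + 1) * (d * (f y * f d * (y powr - a + d powr - a)))"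
proof -
  have "(real p + 1) * 2 ^ (p + 1) * (d * (f y + f d))
      \<le> (real p + 1) * 2 ^ (p + 1) * (d * (f y * f d * (y powr - a + d powr - a)))"
    using d by (intro mult_left_mono moderate_sum_le_prod y) auto
  then show ?thesis using moderate_slow[OF assms] by linarith
qed

text \<open>Commutator of \<open>(x f(x))\<^sup>2\<close> with the transport term \<open>u \<partial>\<^sub>x u\<close>.\<close>

lemma commutator_u:
  assumes x: "1 \<le> x" and y: "1 \<le> y" and d: "1 \<le> d" "\<bar>x - y\<bar> \<le> d"
    and kk: "\<bar>kk\<bar> \<le> x" "\<bar>jj\<bar> \<le> y" "\<bar>kk - jj\<bar> \<le> d"
  shows "\<bar>(x * f x)\<^sup>2 * jj - (y * f y)\<^sup>2 * kk\<bar>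
    \<le> (2 * ((real p + 1) * 2 ^ (p + 1)) + 3) * ((d * f d) * (y * f y) * (x * f x) * (x powr - a + y powr - a + d powr - a))"
proof -
  define C where "C = (real p + 1) * 2 ^ (p + 1)"
  define S where "S = x powr - a + y powr - a + d powr - a"
  define Mx My where "Mx = x * f x" and "My = y * f y"
  have fp: "0 < f x" "0 < f y" "0 < f d" using moderate_pos x y d by auto
  have Mp: "0 < Mx" "0 < My" using fp x y by (auto simp: Mx_def My_def)
  have C: "0 \<le> C" by (simp add: C_def)
  have S: "y powr - a + d powr - a \<le> S" "x powr - a + d powr - a \<le> S" "d powr - a \<le> S"
    by (auto simp: S_def)
  \<comment> \<open>Product rule for \<open>x * f x\<close>. The right side carries the weight of
    the second argument; it is used in both orders, so that in the splitting below the symbol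
    bounded by y meets \<open>f y\<close> and the one bounded by x meets \<open>f x\<close>.\<close>
  have diff: "\<bar>x' * f x' - y' * f y'\<bar> \<le> (C + 1) * (d * (f y' * f d * S))"
    if "1 \<le> x'" "1 \<le> y'" "\<bar>x' - y'\<bar> \<le> d" "y' powr - a + d powr - a \<le> S" for x' y'
  proof -
    have fy: "0 < f y'" using that moderate_pos by auto
    have "x' * \<bar>f x' - f y'\<bar> \<le> C * (d * (f y' * f d * (y' powr - a + d powr - a)))"
      unfolding C_def by (rule moderate_slow_algebra) (use that d in auto)
    also have "\<dots> \<le> C * (d * (f y' * f d * S))"
      using that C d fp fy by (intro mult_left_mono) auto
    finally have 1: "x' * \<bar>f x' - f y'\<bar> \<le> C * (d * (f y' * f d * S))" .
    have "1 \<le> f d * d powr - a" by (rule moderate_inv[OF d(1)])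
    also have "\<dots> \<le> f d * S" using fp S by (intro mult_left_mono) auto
    finally have "d * (f y' * 1) \<le> d * (f y' * (f d * S))"
      using d fy by (intro mult_left_mono) auto
    moreover have "\<bar>x' - y'\<bar> * f y' \<le> d * f y'"
      using that fy by (intro mult_right_mono) auto
    ultimately have 2: "\<bar>x' - y'\<bar> * f y' \<le> d * (f y' * f d * S)" by (simp add: mult.assoc)
    have "x' * f x' - y' * f y' = x' * (f x' - f y') + (x' - y') * f y'" by (simp add: algebra_simps)
    then have "\<bar>x' * f x' - y' * f y'\<bar> \<le> x' * \<bar>f x' - f y'\<bar> + \<bar>x' - y'\<bar> * f y'"
      using that fy by (metis abs_mult abs_of_pos abs_triangle_ineq less_le_trans zero_less_one)
    then show ?thesis using 1 2 by (simp add: distrib_right)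
  qed
  have d1: "\<bar>Mx - My\<bar> \<le> (C + 1) * (d * (f y * f d * S))"
    unfolding Mx_def My_def by (rule diff) (use x y d S in auto)
  have "\<bar>My - Mx\<bar> \<le> (C + 1) * (d * (f x * f d * S))"
    unfolding Mx_def My_def by (rule diff) (use x y d S in \<open>auto simp: abs_minus_commute\<close>)
  then have d2: "\<bar>Mx - My\<bar> \<le> (C + 1) * (d * (f x * f d * S))" by (simp add: abs_minus_commute)
  have "Mx\<^sup>2 * jj - My\<^sup>2 * kk = Mx * (jj * (Mx - My)) - Mx * My * (kk - jj) + My * (kk * (Mx - My))"
    by (simp add: power2_eq_square algebra_simps)
  also have "\<bar>\<dots>\<bar> \<le> \<bar>Mx * (jj * (Mx - My))\<bar> + \<bar>Mx * My * (kk - jj)\<bar> + \<bar>My * (kk * (Mx - My))\<bar>"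
    by linarith
  also have "\<bar>Mx * (jj * (Mx - My))\<bar> \<le> Mx * (y * ((C + 1) * (d * (f y * f d * S))))"
    unfolding abs_mult using Mp kk d1 y by (intro mult_mono) auto
  also have "\<bar>My * (kk * (Mx - My))\<bar> \<le> My * (x * ((C + 1) * (d * (f x * f d * S))))"
    unfolding abs_mult using Mp kk d2 x by (intro mult_mono) auto
  also have "\<bar>Mx * My * (kk - jj)\<bar> \<le> Mx * My * (d * (f d * S))"
  proof -
    have "1 \<le> f d * d powr - a" by (rule moderate_inv[OF d(1)])
    also have "\<dots> \<le> f d * S" using fp S by (intro mult_left_mono) auto
    finally have "d * 1 \<le> d * (f d * S)" using d by (intro mult_left_mono) auto
    then have "\<bar>kk - jj\<bar> \<le> d * (f d * S)" using kk by linarith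
    then show ?thesis
      unfolding abs_mult using Mp by (intro mult_mono) auto
  qed
  finally have "\<bar>Mx\<^sup>2 * jj - My\<^sup>2 * kk\<bar> \<le> (2 * C + 3) * ((d * f d) * My * Mx * S)"
    by (simp add: Mx_def My_def algebra_simps)
  then show ?thesis by (simp add: C_def S_def Mx_def My_def)
qed

text \<open>Commutator of \<open>f\<^sup>2\<close> with the conservative transport term \<open>\<partial>\<^sub>x (u \<rho>)\<close>.\<close>

lemma commutator_rho:
  assumes x: "1 \<le> x" and y: "1 \<le> y" and d: "1 \<le> d" "\<bar>x - y\<bar> \<le> d"
    and kk: "\<bar>kk\<bar> \<le> x" "\<bar>jj\<bar> \<le> y" "\<bar>kk - jj\<bar> \<le> d"
  shows "\<bar>(f x)\<^sup>2 * kk - (f y)\<^sup>2 * jj\<bar>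
    \<le> (2 * ((real p + 1) * 2 ^ (p + 1)) + 1) * ((d * f d) * f y * f x * (x powr - a + y powr - a + d powr - a))"
proof -
  define C where "C = (real p + 1) * 2 ^ (p + 1)"
  define S where "S = x powr - a + y powr - a + d powr - a"
  have fp: "0 < f x" "0 < f y" "0 < f d" using moderate_pos x y d by auto
  have C: "0 \<le> C" by (simp add: C_def)
  have S: "y powr - a + d powr - a \<le> S" "x powr - a + d powr - a \<le> S" "d powr - a \<le> S"
    by (auto simp: S_def)
  have "x * \<bar>f x - f y\<bar> \<le> C * (d * (f y * f d * (y powr - a + d powr - a)))"
    unfolding C_def by (rule moderate_slow_algebra[OF x y d])
  also have "\<dots> \<le> C * (d * (f y * f d * S))"
    using S C d fp by (intro mult_left_mono) auto
  finally have d1: "x * \<bar>f x - f y\<bar> \<le> C * (d * (f y * f d * S))" .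
  have "y * \<bar>f y - f x\<bar> \<le> C * (d * (f x * f d * (x powr - a + d powr - a)))"
    unfolding C_def by (rule moderate_slow_algebra[OF y x]) (use d in \<open>auto simp: abs_minus_commute\<close>)
  also have "\<dots> \<le> C * (d * (f x * f d * S))"
    using S C d fp by (intro mult_left_mono) auto
  finally have d2: "y * \<bar>f x - f y\<bar> \<le> C * (d * (f x * f d * S))" by (simp add: abs_minus_commute)
  have "(f x)\<^sup>2 * kk - (f y)\<^sup>2 * jj = f x * (kk * (f x - f y)) + f x * f y * (kk - jj) + f y * (jj * (f x - f y))"
    by (simp add: power2_eq_square algebra_simps)
  also have "\<bar>\<dots>\<bar> \<le> \<bar>f x * (kk * (f x - f y))\<bar> + \<bar>f x * f y * (kk - jj)\<bar> + \<bar>f y * (jj * (f x - f y))\<bar>"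
    by linarith
  also have "\<bar>f x * (kk * (f x - f y))\<bar> \<le> f x * (C * (d * (f y * f d * S)))"
  proof -
    have "\<bar>kk * (f x - f y)\<bar> \<le> x * \<bar>f x - f y\<bar>"
      unfolding abs_mult using kk by (intro mult_right_mono) auto
    then show ?thesis using d1 fp by (simp add: abs_mult)
  qed
  also have "\<bar>f y * (jj * (f x - f y))\<bar> \<le> f y * (C * (d * (f x * f d * S)))"
  proof -
    have "\<bar>jj * (f x - f y)\<bar> \<le> y * \<bar>f x - f y\<bar>"
      unfolding abs_mult using kk by (intro mult_right_mono) auto
    then show ?thesis using d2 fp by (simp add: abs_mult)
  qed
  also have "\<bar>f x * f y * (kk - jj)\<bar> \<le> f x * f y * (d * (f d * S))"
  proof -
    have "1 \<le> f d * d powr - a" by (rule moderate_inv[OF d(1)])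
    also have "\<dots> \<le> f d * S" using fp S by (intro mult_left_mono) auto
    finally have "d * 1 \<le> d * (f d * S)" using d by (intro mult_left_mono) auto
    then have "\<bar>kk - jj\<bar> \<le> d * (f d * S)" using kk by linarith
    then show ?thesis
      unfolding abs_mult using fp by (intro mult_mono) auto
  qed
  finally have "\<bar>(f x)\<^sup>2 * kk - (f y)\<^sup>2 * jj\<bar> \<le> (2 * C + 1) * ((d * f d) * f y * f x * S)"
    by (simp add: algebra_simps)
  then show ?thesis by (simp add: C_def S_def)
qed

end

text \<open>For \<open>b \<le> 1\<close> the function t powr (b - 1) is nonincreasing, so the
  increment is linear in \<open>x - y\<close> with constant 1 and free of doubling
  constants.\<close>

lemma powr_diff_le:
  fixes x y b :: real
  assumes "1 \<le> x" "1 \<le> y" "0 \<le> b" "b \<le> 1"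
  shows "x * \<bar>x powr b - y powr b\<bar> \<le> \<bar>x - y\<bar> * x powr b"
proof -
  have *: "v * (u powr b - v powr b) \<le> (u - v) * v powr b" "u * (u powr b - v powr b) \<le> (u - v) * u powr b"
    if "1 \<le> v" "v \<le> u" for u v :: real
  proof -
    have "u powr b = u powr (b - 1) * u" "v powr b = v powr (b - 1) * v"
      using that by (simp_all add: powr_diff)
    moreover have "u powr (b - 1) \<le> v powr (b - 1)"
      using that assms by (intro powr_mono2') auto
    ultimately have "u powr b * v \<le> v powr b * u"
      using that by (simp add: mult.assoc mult.commute[of v u] mult_right_mono)
    then show "v * (u powr b - v powr b) \<le> (u - v) * v powr b" "u * (u powr b - v powr b) \<le> (u - v) * u powr b"
      by (simp_all add: algebra_simps)
  qed
  show ?thesis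
  proof (cases "y \<le> x")
    case True
    then have "y powr b \<le> x powr b" using assms by (intro powr_mono2) auto
    then show ?thesis using *(2)[of y x] True assms by simp
  next
    case False
    then have "x powr b \<le> y powr b" using assms by (intro powr_mono2) auto
    then show ?thesis using *(1)[of x y] False assms by simp
  qed
qed

text \<open>For the difference norm. The coefficient enters through \<open>d\<close> alone, without
  a weight or a square-summable factor; this is possible because the exponent lies in
  [0, 1].\<close>

lemma commutator_powr:
  fixes x y d a kk jj :: real
  assumes "1 \<le> x" "1 \<le> y" "\<bar>x - y\<bar> \<le> d" "0 \<le> a" "a \<le> 1"
    and kk: "\<bar>kk\<bar> \<le> x" "\<bar>jj\<bar> \<le> y" "\<bar>kk - jj\<bar> \<le> d"
  shows "\<bar>(x powr a)\<^sup>2 * jj - (y powr a)\<^sup>2 * kk\<bar> \<le> 3 * (d * y powr a * x powr a)"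
proof -
  define u v where "u = x powr a" and "v = y powr a"
  have uv: "0 \<le> u" "0 \<le> v" by (auto simp: u_def v_def)
  have "x * \<bar>u - v\<bar> \<le> \<bar>x - y\<bar> * u" "y * \<bar>v - u\<bar> \<le> \<bar>y - x\<bar> * v"
    unfolding u_def v_def using assms by (auto intro!: powr_diff_le)
  moreover have "\<bar>x - y\<bar> * u \<le> d * u" "\<bar>y - x\<bar> * v \<le> d * v"
    using assms uv by (auto intro!: mult_right_mono)
  ultimately have *: "x * \<bar>u - v\<bar> \<le> d * u" "y * \<bar>u - v\<bar> \<le> d * v"
    by (auto simp: abs_minus_commute)
  have "u\<^sup>2 * jj - v\<^sup>2 * kk = u * (jj * (u - v)) - u * v * (kk - jj) + v * (kk * (u - v))"
    by (simp add: power2_eq_square algebra_simps)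
  also have "\<bar>\<dots>\<bar> \<le> \<bar>u * (jj * (u - v))\<bar> + \<bar>u * v * (kk - jj)\<bar> + \<bar>v * (kk * (u - v))\<bar>"
    by linarith
  also have "\<dots> \<le> u * (d * v) + u * v * d + v * (d * u)"
  proof (intro add_mono)
    have "\<bar>jj\<bar> * \<bar>u - v\<bar> \<le> d * v" "\<bar>kk\<bar> * \<bar>u - v\<bar> \<le> d * u"
      using * kk mult_right_mono[of "\<bar>jj\<bar>" y "\<bar>u - v\<bar>"] mult_right_mono[of "\<bar>kk\<bar>" x "\<bar>u - v\<bar>"] by linarith+
    then show "\<bar>u * (jj * (u - v))\<bar> \<le> u * (d * v)" "\<bar>v * (kk * (u - v))\<bar> \<le> v * (d * u)"
      using uv by (auto simp: abs_mult intro!: mult_left_mono)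
    show "\<bar>u * v * (kk - jj)\<bar> \<le> u * v * d"
      using uv kk by (auto simp: abs_mult intro!: mult_left_mono)
  qed
  finally show ?thesis by (simp add: u_def v_def mult_ac)
qed

text \<open>Reduced to positive exponents by \<open>u - v = u * v * (y powr b - x powr b)\<close>.
  It serves the second component, whose difference norm has the negative order a - 1.\<close>

lemma commutator_powr_neg:
  fixes x y d b kk jj :: real
  assumes "1 \<le> x" "1 \<le> y" "\<bar>x - y\<bar> \<le> d" "0 \<le> b" "b \<le> 1"
    and kk: "\<bar>kk\<bar> \<le> x" "\<bar>jj\<bar> \<le> y" "\<bar>kk - jj\<bar> \<le> d"
  shows "\<bar>(x powr - b)\<^sup>2 * kk - (y powr - b)\<^sup>2 * jj\<bar> \<le> 3 * (d * y powr - b * x powr - b)"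
proof -
  define u v where "u = x powr - b" and "v = y powr - b"
  have uv: "0 < u" "0 < v" using assms by (auto simp: u_def v_def)
  have inv: "u * x powr b = 1" "v * y powr b = 1"
    using assms by (auto simp: u_def v_def powr_minus)
  have "u - v = u * v * (y powr b - x powr b)"
  proof -
    have "u * v * (y powr b - x powr b) = u * (v * y powr b) - v * (u * x powr b)"
      by (simp add: algebra_simps)
    then show ?thesis using inv by simp
  qed
  then have eq: "\<bar>u - v\<bar> = u * v * \<bar>x powr b - y powr b\<bar>"
    using uv by (simp add: abs_mult abs_minus_commute)
  have "x * \<bar>x powr b - y powr b\<bar> \<le> \<bar>x - y\<bar> * x powr b" "y * \<bar>y powr b - x powr b\<bar> \<le> \<bar>y - x\<bar> * y powr b"
    using assms by (auto intro!: powr_diff_le)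
  moreover have "\<bar>x - y\<bar> * x powr b \<le> d * x powr b" "\<bar>y - x\<bar> * y powr b \<le> d * y powr b"
    using assms by (auto intro!: mult_right_mono)
  ultimately have p: "x * \<bar>x powr b - y powr b\<bar> \<le> d * x powr b" "y * \<bar>x powr b - y powr b\<bar> \<le> d * y powr b"
    by (auto simp: abs_minus_commute)
  have "x * \<bar>u - v\<bar> = u * v * (x * \<bar>x powr b - y powr b\<bar>)" "y * \<bar>u - v\<bar> = u * v * (y * \<bar>x powr b - y powr b\<bar>)"
    unfolding eq by simp_all
  moreover have "u * v * (x * \<bar>x powr b - y powr b\<bar>) \<le> u * v * (d * x powr b)"
    "u * v * (y * \<bar>x powr b - y powr b\<bar>) \<le> u * v * (d * y powr b)"
    using p uv by (auto intro!: mult_left_mono)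
  moreover have "u * v * (d * x powr b) = d * v * (u * x powr b)" "u * v * (d * y powr b) = d * u * (v * y powr b)"
    by simp_all
  ultimately have *: "x * \<bar>u - v\<bar> \<le> d * v" "y * \<bar>u - v\<bar> \<le> d * u"
    unfolding inv by linarith+
  have "u\<^sup>2 * kk - v\<^sup>2 * jj = u * (kk * (u - v)) + u * v * (kk - jj) + v * (jj * (u - v))"
    by (simp add: power2_eq_square algebra_simps)
  also have "\<bar>\<dots>\<bar> \<le> \<bar>u * (kk * (u - v))\<bar> + \<bar>u * v * (kk - jj)\<bar> + \<bar>v * (jj * (u - v))\<bar>"
    by linarith
  also have "\<dots> \<le> u * (d * v) + u * v * d + v * (d * u)"
  proof (intro add_mono)
    have "\<bar>kk\<bar> * \<bar>u - v\<bar> \<le> d * v" "\<bar>jj\<bar> * \<bar>u - v\<bar> \<le> d * u"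
      using * kk mult_right_mono[of "\<bar>jj\<bar>" y "\<bar>u - v\<bar>"] mult_right_mono[of "\<bar>kk\<bar>" x "\<bar>u - v\<bar>"] by linarith+
    then show "\<bar>u * (kk * (u - v))\<bar> \<le> u * (d * v)" "\<bar>v * (jj * (u - v))\<bar> \<le> v * (d * u)"
      using uv by (auto simp: abs_mult intro!: mult_left_mono)
    show "\<bar>u * v * (kk - jj)\<bar> \<le> u * v * d"
      using uv kk by (auto simp: abs_mult intro!: mult_left_mono)
  qed
  finally show ?thesis by (simp add: u_def v_def mult_ac)
qed

text \<open>The multiplication estimate \<open>H\<^sup>a \<cdot> H\<^sup>a\<^sup>-\<^sup>1 \<subseteq> H\<^sup>a\<^sup>-\<^sup>1\<close> on the level of symbols; it is here that
  \<open>a > 1/2\<close> is used.\<close>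

lemma powr_low_le:
  fixes x y d a :: real
  assumes "1 \<le> x" "1 \<le> y" "1 \<le> d" "y \<le> x + d" "1 / 2 < a" "a < 1"
  shows "y powr (1 - a) \<le> 4 * (x powr (1 - a) * d powr a * (x powr - a + d powr - a))"
proof -
  have add: "t powr u * t powr v = t powr (u + v)" for t u v :: real
    by (simp add: powr_add)
  have y: "y powr (1 - a) \<le> 2 * w powr (1 - a)" if w: "1 \<le> w" "y \<le> 2 * w" for w
  proof -
    have "y powr (1 - a) \<le> (2 * w) powr (1 - a)" using w assms by (intro powr_mono2) auto
    also have "\<dots> = 2 powr (1 - a) * w powr (1 - a)" using w by (simp add: powr_mult)
    also have "(2::real) powr (1 - a) \<le> 2 powr 1" using assms by (intro powr_mono) auto
    then have "2 powr (1 - a) * w powr (1 - a) \<le> 2 * w powr (1 - a)"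
      by (intro mult_right_mono) auto
    finally show ?thesis .
  qed
  have x1: "x powr (1 - a) * d powr a * d powr - a = x powr (1 - a)"
    using assms by (simp add: mult.assoc add)
  have d1: "d powr (1 - a) = d powr (1 - 2 * a) * d powr a"
    by (simp add: add)
  have x2: "x powr (1 - a) * d powr a * x powr - a = x powr (1 - 2 * a) * d powr a"
    using add[of x "1 - a" "- a"] by (simp add: mult_ac)
  define K where "K = x powr (1 - a) * d powr a * (x powr - a + d powr - a)"
  have K1: "x powr (1 - a) \<le> K"
    unfolding K_def distrib_left x1 by simp
  have K2: "d powr (1 - a) \<le> K"
  proof (cases "x \<le> d")
    case True
    \<comment> \<open>The exponent \<open>1 - 2 * a\<close> is negative, so the power at the smaller
      argument \<open>x\<close> dominates.\<close>
    have "d powr (1 - 2 * a) \<le> x powr (1 - 2 * a)"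
      using True assms by (intro powr_mono2') auto
    then have "d powr (1 - a) \<le> x powr (1 - 2 * a) * d powr a"
      unfolding d1 by (intro mult_right_mono) auto
    then show ?thesis unfolding K_def distrib_left x2 by (simp add: add_increasing2)
  next
    case False
    then have "d powr (1 - a) \<le> x powr (1 - a)" using assms by (intro powr_mono2) auto
    then show ?thesis using K1 by linarith
  qed
  have K0: "0 \<le> K" by (simp add: K_def)
  have "y powr (1 - a) \<le> 2 * K"
    using y[of x] y[of d] K1 K2 assms by (cases "d \<le> x") auto
  then have "y powr (1 - a) \<le> 4 * K" using K0 by linarith
  then show ?thesis by (simp only: K_def)
qed

section \<open>Bilinear convolution operators\<close>

lemma inner_eq_Re: "z \<bullet> w = Re (cnj z * w)"
  by (simp add: inner_complex_def)

lemma Re_mult_of_real: "Re (of_real r * z) = r * Re z"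
  by simp

text \<open>The inner index runs over a finite \<open>Y\<close>, so that interchanging and
  symmetrising sums involves no convergence; the passage to all integers is made in
  \<open>FY_tendsto\<close>.\<close>

definition bil :: "(int \<Rightarrow> int \<Rightarrow> complex) \<Rightarrow> (int \<Rightarrow> complex) \<Rightarrow> (int \<Rightarrow> complex) \<Rightarrow> int set \<Rightarrow> int \<Rightarrow> complex" where
  "bil \<kappa> x y Y k = (\<Sum>j\<in>Y. \<kappa> k j * x (k - j) * y j)"

text \<open>The splitting is deliberately asymmetric. In the first term the coefficient is still the
  solution \<open>x\<close>, real-valued as the transport estimate requires, and acts on the
  difference; the term with the difference as coefficient is estimated directly.\<close>

lemma bil_diff:
  "bil \<kappa> x y Y k - bil \<kappa> x' y' Y k = bil \<kappa> x (\<lambda>j. y j - y' j) Y k + bil \<kappa> (\<lambda>j. x j - x' j) y' Y k"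
  unfolding bil_def sum_subtractf[symmetric] sum.distrib[symmetric]
  by (rule sum.cong) (auto simp: algebra_simps)

lemma bil_split: "finite Y \<Longrightarrow> X \<subseteq> Y \<Longrightarrow> bil \<kappa> x y Y k = bil \<kappa> x y X k + bil \<kappa> x y (Y - X) k"
  unfolding bil_def by (simp add: sum.subset_diff add.commute)

lemma bil_add_kernel: "bil (\<lambda>k j. \<kappa> k j + \<kappa>' k j) x y Y k = bil \<kappa> x y Y k + bil \<kappa>' x y Y k"
  by (simp add: bil_def sum.distrib distrib_right)

locale square_summable =
  fixes g :: "int \<Rightarrow> real" and G :: real
  assumes g_nonneg: "0 \<le> g k" and g_L2: "finite X \<Longrightarrow> L2_set g X \<le> G"
begin

lemma G_nonneg: "0 \<le> G"
  using g_L2[of "{}"] by simp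

lemma trilinear_cmod_le:
  fixes x y z :: "int \<Rightarrow> complex"
  assumes X: "finite X" "finite Y" and w: "\<And>i. 0 \<le> wX i" "\<And>i. 0 \<le> wY i" "\<And>i. 0 \<le> wZ i"
    and \<kappa>: "\<And>k j. k \<in> X \<Longrightarrow> j \<in> Y \<Longrightarrow> \<bar>\<kappa> k j\<bar> \<le> C * (wX (k - j) * wY j * wZ k * (g k + g j + g (k - j)))"
    and xyz: "wnorm_le wX x A" "wnorm_le wY y B" "wnorm_le wZ z D" and C: "0 \<le> C"
  shows "(\<Sum>k\<in>X. \<Sum>j\<in>Y. \<bar>\<kappa> k j\<bar> * (cmod (x (k - j)) * cmod (y j) * cmod (z k))) \<le> 3 * C * G * (A * B * D)"
proof -
  have "(\<Sum>k\<in>X. \<Sum>j\<in>Y. \<bar>\<kappa> k j\<bar> * (cmod (x (k - j)) * cmod (y j) * cmod (z k)))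
      \<le> (\<Sum>k\<in>X. \<Sum>j\<in>Y. C * ((g k + g j + g (k - j)) *
          ((wZ k * cmod (z k)) * (wY j * cmod (y j)) * (wX (k - j) * cmod (x (k - j))))))"
  proof (intro sum_mono)
    fix k j assume "k \<in> X" "j \<in> Y"
    then have "\<bar>\<kappa> k j\<bar> * (cmod (x (k - j)) * cmod (y j) * cmod (z k))
        \<le> C * (wX (k - j) * wY j * wZ k * (g k + g j + g (k - j))) * (cmod (x (k - j)) * cmod (y j) * cmod (z k))"
      by (intro mult_right_mono \<kappa>) auto
    then show "\<bar>\<kappa> k j\<bar> * (cmod (x (k - j)) * cmod (y j) * cmod (z k))
        \<le> C * ((g k + g j + g (k - j)) * ((wZ k * cmod (z k)) * (wY j * cmod (y j)) * (wX (k - j) * cmod (x (k - j)))))"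
      by (simp add: mult_ac)
  qed
  also have "\<dots> = C * (\<Sum>k\<in>X. \<Sum>j\<in>Y. (g k + g j + g (k - j)) *
          ((wZ k * cmod (z k)) * (wY j * cmod (y j)) * (wX (k - j) * cmod (x (k - j)))))"
    by (simp add: sum_distrib_left)
  also have "\<dots> \<le> C * (3 * (G * D * B * A))"
    using X by (intro mult_left_mono C trilinear_sum_le g_nonneg g_L2 mult_nonneg_nonneg w norm_ge_zero
        wnorm_leD[OF xyz(1)] wnorm_leD[OF xyz(2)] wnorm_leD[OF xyz(3)])
  finally show ?thesis by (simp add: mult_ac)
qed

lemma bil_inner_le:
  assumes X: "finite X" "finite Y" and w: "\<And>i. 0 \<le> wX i" "\<And>i. 0 \<le> wY i" "\<And>i. 0 \<le> wZ i"
    and \<kappa>: "\<And>k j. k \<in> X \<Longrightarrow> j \<in> Y \<Longrightarrow>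
      \<bar>W k\<bar> * cmod (\<kappa> k j) \<le> C * (wX (k - j) * wY j * wZ k * (g k + g j + g (k - j)))"
    and xyz: "wnorm_le wX x A" "wnorm_le wY y B" "wnorm_le wZ z D" and C: "0 \<le> C"
  shows "(\<Sum>k\<in>X. W k * (z k \<bullet> bil \<kappa> x y Y k)) \<le> 3 * C * G * (A * B * D)"
proof -
  have "(\<Sum>k\<in>X. W k * (z k \<bullet> bil \<kappa> x y Y k))
      \<le> (\<Sum>k\<in>X. \<Sum>j\<in>Y. \<bar>\<bar>W k\<bar> * cmod (\<kappa> k j)\<bar> * (cmod (x (k - j)) * cmod (y j) * cmod (z k)))"
    unfolding bil_def inner_sum_right sum_distrib_left
  proof (intro sum_mono)
    fix k j
    have "\<bar>W k\<bar> * \<bar>z k \<bullet> (\<kappa> k j * x (k - j) * y j)\<bar> \<le> \<bar>W k\<bar> * (cmod (z k) * cmod (\<kappa> k j * x (k - j) * y j))"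
      by (intro mult_left_mono Cauchy_Schwarz_ineq2) auto
    then have "W k * (z k \<bullet> (\<kappa> k j * x (k - j) * y j)) \<le> \<bar>W k\<bar> * (cmod (z k) * cmod (\<kappa> k j * x (k - j) * y j))"
      unfolding abs_mult[symmetric, of "W k"] by (rule abs_le_D1)
    then show "W k * (z k \<bullet> (\<kappa> k j * x (k - j) * y j))
        \<le> \<bar>\<bar>W k\<bar> * cmod (\<kappa> k j)\<bar> * (cmod (x (k - j)) * cmod (y j) * cmod (z k))"
      by (simp add: norm_mult mult_ac abs_mult)
  qed
  also have "\<dots> \<le> 3 * C * G * (A * B * D)"
    by (rule trilinear_cmod_le[OF X w _ xyz C]) (use \<kappa> in auto)
  finally show ?thesis .
qed

text \<open>For real-valued \<open>x\<close>, exchanging \<open>k\<close> and \<open>j\<close> and conjugating turns the kernel \<open>W k * \<alpha> k j\<close>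
  into its negative transpose, so that only the commutator survives.\<close>

lemma bil_transport_le:
  assumes X: "finite X" and w: "\<And>i. 0 \<le> wX i" "\<And>i. 0 \<le> wY i"
    and \<alpha>: "\<And>k j. k \<in> X \<Longrightarrow> j \<in> X \<Longrightarrow>
      \<bar>W k * \<alpha> k j - W j * \<alpha> j k\<bar> \<le> C * (wX (k - j) * wY j * wY k * (g k + g j + g (k - j)))"
    and x: "\<And>l. x (- l) = cnj (x l)" "wnorm_le wX x A" and b: "wnorm_le wY b B" and C: "0 \<le> C"
  shows "(\<Sum>k\<in>X. W k * (b k \<bullet> bil (\<lambda>k j. \<i> * of_real (\<alpha> k j)) x b X k)) \<le> 3 * C * G * (A * B * B)"
proof -
  define r where "r = (\<lambda>k j. Re (\<i> * (cnj (b k) * x (k - j) * b j)))"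
  have inner: "b k \<bullet> (\<i> * of_real (\<alpha> k j) * x (k - j) * b j) = \<alpha> k j * r k j" for k j
  proof -
    have "b k \<bullet> (\<i> * of_real (\<alpha> k j) * x (k - j) * b j)
        = Re (of_real (\<alpha> k j) * (\<i> * (cnj (b k) * x (k - j) * b j)))"
      unfolding inner_eq_Re by (simp only: mult_ac)
    then show ?thesis unfolding r_def by (simp only: Re_mult_of_real)
  qed
  have r_swap: "r j k = - r k j" for k j
  proof -
    have "x (j - k) = cnj (x (k - j))" using x(1)[of "k - j"] by simp
    then have "cnj (\<i> * (cnj (b k) * x (k - j) * b j)) = - (\<i> * (cnj (b j) * x (j - k) * b k))"
      by (simp add: mult_ac)
    from arg_cong[OF this, of Re] show ?thesis
      unfolding r_def by (simp only: cnj.sel uminus_complex.sel)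
  qed
  define s where "s = (\<Sum>k\<in>X. W k * (b k \<bullet> bil (\<lambda>k j. \<i> * of_real (\<alpha> k j)) x b X k))"
  have s1: "s = (\<Sum>k\<in>X. \<Sum>j\<in>X. W k * \<alpha> k j * r k j)"
    unfolding s_def bil_def inner_sum_right inner sum_distrib_left by (simp add: mult.assoc)
  also have "\<dots> = (\<Sum>k\<in>X. \<Sum>j\<in>X. W j * \<alpha> j k * r j k)"
    by (rule sum.swap)
  also have "\<dots> = (\<Sum>k\<in>X. \<Sum>j\<in>X. - (W j * \<alpha> j k * r k j))"
    by (intro sum.cong refl, subst r_swap) simp
  finally have s2: "s = (\<Sum>k\<in>X. \<Sum>j\<in>X. - (W j * \<alpha> j k * r k j))" .
  have "2 * s = (\<Sum>k\<in>X. \<Sum>j\<in>X. (W k * \<alpha> k j - W j * \<alpha> j k) * r k j)"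
  proof -
    have "2 * s = (\<Sum>k\<in>X. \<Sum>j\<in>X. W k * \<alpha> k j * r k j) + (\<Sum>k\<in>X. \<Sum>j\<in>X. - (W j * \<alpha> j k * r k j))"
      using s1 s2 by linarith
    then show ?thesis
      unfolding sum.distrib[symmetric] by (simp add: left_diff_distrib)
  qed
  also have "\<dots> \<le> (\<Sum>k\<in>X. \<Sum>j\<in>X. \<bar>W k * \<alpha> k j - W j * \<alpha> j k\<bar> * (cmod (x (k - j)) * cmod (b j) * cmod (b k)))"
  proof (intro sum_mono)
    fix k j
    have "\<bar>r k j\<bar> \<le> cmod (\<i> * (cnj (b k) * x (k - j) * b j))"
      unfolding r_def by (rule abs_Re_le_cmod)
    then have "\<bar>r k j\<bar> \<le> cmod (x (k - j)) * cmod (b j) * cmod (b k)"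
      by (simp add: norm_mult mult_ac)
    then have "\<bar>W k * \<alpha> k j - W j * \<alpha> j k\<bar> * \<bar>r k j\<bar>
        \<le> \<bar>W k * \<alpha> k j - W j * \<alpha> j k\<bar> * (cmod (x (k - j)) * cmod (b j) * cmod (b k))"
      by (intro mult_left_mono) auto
    then show "(W k * \<alpha> k j - W j * \<alpha> j k) * r k j
        \<le> \<bar>W k * \<alpha> k j - W j * \<alpha> j k\<bar> * (cmod (x (k - j)) * cmod (b j) * cmod (b k))"
      unfolding abs_mult[symmetric] by (rule abs_le_D1)
  qed
  also have "\<dots> \<le> 3 * C * G * (A * B * B)"
    by (rule trilinear_cmod_le[OF X X w w(2) \<alpha> x(2) b b C])
  finally have "2 * s \<le> 3 * C * G * (A * B * B)" .
  moreover have "0 \<le> 3 * C * G * (A * B * B)"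
    using C G_nonneg wnorm_le_nonneg[OF x(2)] wnorm_le_nonneg[OF b] by (intro mult_nonneg_nonneg) auto
  ultimately have "s \<le> 3 * C * G * (A * B * B)" by linarith
  then show ?thesis by (simp only: s_def)
qed

text \<open>Duality: the trilinear bound is applied with the weighted modulus of \<open>bil\<close>
  on \<open>Q\<close> as third function, which gives \<open>L * L\<close> at most \<open>L\<close>
  times the claimed bound.\<close>

lemma bil_bound:
  assumes Y: "finite Y" and w: "\<And>i. 0 \<le> wX i" "\<And>i. 0 \<le> wY i" "\<And>i. 0 \<le> W i"
    and \<kappa>: "\<And>k j. W k * cmod (\<kappa> k j) \<le> C * (wX (k - j) * wY j * (g k + g j + g (k - j)))"
    and xy: "wnorm_le wX x A" "wnorm_le wY y B" and C: "0 \<le> C"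
  shows "wnorm_le W (bil \<kappa> x y Y) (3 * C * G * (A * B))"
proof (rule wnorm_leI)
  fix Q :: "int set" assume Q: "finite Q"
  define b where "b = (\<lambda>k. if k \<in> Q then W k * cmod (bil \<kappa> x y Y k) else 0)"
  define L where "L = L2_set (\<lambda>k. W k * cmod (bil \<kappa> x y Y k)) Q"
  have b0: "0 \<le> b k" for k using w by (simp add: b_def)
  have L0: "0 \<le> L" by (simp add: L_def L2_set_nonneg)
  have bL: "wnorm_le (\<lambda>_. 1) (\<lambda>k. of_real (b k)) L"
  proof (rule wnorm_leI)
    fix Z :: "int set" assume Z: "finite Z"
    have "L2_set (\<lambda>i. 1 * cmod (of_real (b i))) Z = L2_set b Z"
      using b0 by simp
    also have "\<dots> = L2_set b (Z \<inter> Q)"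
      unfolding L2_set_def
      by (intro arg_cong[of _ _ sqrt] sum.mono_neutral_right) (use Z in \<open>auto simp: b_def\<close>)
    also have "\<dots> \<le> L2_set b Q" using Q by (intro L2_set_subset) auto
    also have "\<dots> = L" unfolding L_def by (intro L2_set_cong) (auto simp: b_def)
    finally show "L2_set (\<lambda>i. 1 * cmod (of_real (b i))) Z \<le> L" .
  qed
  have "L * L = (\<Sum>k\<in>Q. (W k * cmod (bil \<kappa> x y Y k)) * b k)"
    unfolding L_def L2_set_def by (simp add: sum_nonneg b_def power2_eq_square)
  also have "\<dots> \<le> (\<Sum>k\<in>Q. \<Sum>j\<in>Y. \<bar>W k * cmod (\<kappa> k j)\<bar> * (cmod (x (k - j)) * cmod (y j) * cmod (of_real (b k))))"
  proof (rule sum_mono)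
    fix k
    have "cmod (bil \<kappa> x y Y k) \<le> (\<Sum>j\<in>Y. cmod (\<kappa> k j) * cmod (x (k - j)) * cmod (y j))"
      unfolding bil_def by (rule order_trans[OF norm_sum]) (simp add: norm_mult)
    then have "W k * cmod (bil \<kappa> x y Y k) * b k \<le> W k * (\<Sum>j\<in>Y. cmod (\<kappa> k j) * cmod (x (k - j)) * cmod (y j)) * b k"
      using w b0 by (intro mult_right_mono mult_left_mono) auto
    also have "\<dots> = (\<Sum>j\<in>Y. \<bar>W k * cmod (\<kappa> k j)\<bar> * (cmod (x (k - j)) * cmod (y j) * cmod (of_real (b k))))"
      using w b0 by (simp add: sum_distrib_left sum_distrib_right mult_ac abs_mult)
    finally show "W k * cmod (bil \<kappa> x y Y k) * b k
        \<le> (\<Sum>j\<in>Y. \<bar>W k * cmod (\<kappa> k j)\<bar> * (cmod (x (k - j)) * cmod (y j) * cmod (of_real (b k))))" .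
  qed
  also have "\<dots> \<le> 3 * C * G * (A * B * L)"
    by (rule trilinear_cmod_le[OF Q Y w(1,2) _ _ xy bL C]) (use \<kappa> w in auto)
  finally have "L * L \<le> L * (3 * C * G * (A * B))" by (simp add: mult_ac)
  then show "L2_set (\<lambda>i. W i * cmod (bil \<kappa> x y Y i)) Q \<le> 3 * C * G * (A * B)"
    unfolding L_def[symmetric]
    using L0 C G_nonneg wnorm_le_nonneg[OF xy(1)] wnorm_le_nonneg[OF xy(2)]
    by (cases "L = 0") (simp_all add: mult_le_cancel_left)
qed

end

section \<open>The two-component system\<close>

text \<open>Index \<open>(k, True)\<close> carries the k-th coefficient of u and
  \<open>(k, False)\<close> that of \<rho>; a single weighted l2 norm over pairs then is the product
  norm.\<close>

definition pw :: "(real \<Rightarrow> real) \<Rightarrow> (real \<Rightarrow> real) \<Rightarrow> int \<times> bool \<Rightarrow> real" where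
  "pw f h i = (if snd i then f (jap (fst i)) else h (jap (fst i)))"

lemma pw_simps [simp]: "pw f h (k, True) = f (jap k)" "pw f h (k, False) = h (jap k)"
  by (simp_all add: pw_def)

lemma sum_times_bool:
  fixes f :: "int \<times> bool \<Rightarrow> 'b::comm_monoid_add"
  shows "(\<Sum>i\<in>X \<times> UNIV. f i) = (\<Sum>k\<in>X. f (k, True)) + (\<Sum>k\<in>X. f (k, False))"
proof -
  have "(\<Sum>i\<in>X \<times> UNIV. f i) = (\<Sum>k\<in>X. \<Sum>b\<in>UNIV. f (k, b))"
    by (simp add: sum.cartesian_product)
  then show ?thesis
    by (simp add: UNIV_bool sum.distrib add.commute)
qed

lemma wnorm_le_components:
  assumes "wnorm_le (pw f h) z B"
  shows "wnorm_le (\<lambda>k. f (jap k)) (\<lambda>k. z (k, True)) B" "wnorm_le (\<lambda>k. h (jap k)) (\<lambda>k. z (k, False)) B"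
proof -
  have *: "L2_set (\<lambda>k. pw f h (k, b) * cmod (z (k, b))) X \<le> B" if "finite X" for X b
  proof -
    have "L2_set (\<lambda>k. pw f h (k, b) * cmod (z (k, b))) X = L2_set (\<lambda>i. pw f h i * cmod (z i)) ((\<lambda>k. (k, b)) ` X)"
      by (subst L2_set_reindex[symmetric]) (auto simp: inj_on_def)
    then show ?thesis using wnorm_leD[OF assms, of "(\<lambda>k. (k, b)) ` X"] that by simp
  qed
  show "wnorm_le (\<lambda>k. f (jap k)) (\<lambda>k. z (k, True)) B"
    using *[of _ True] by (simp add: wnorm_le_def)
  show "wnorm_le (\<lambda>k. h (jap k)) (\<lambda>k. z (k, False)) B"
    using *[of _ False] by (simp add: wnorm_le_def)
qed

lemma wnorm_le_pair:
  assumes "wnorm_le (\<lambda>k. f (jap k)) (\<lambda>k. z (k, True)) A" "wnorm_le (\<lambda>k. h (jap k)) (\<lambda>k. z (k, False)) B"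
  shows "wnorm_le (pw f h) z (sqrt (A\<^sup>2 + B\<^sup>2))"
proof (rule wnorm_leI)
  fix Q :: "(int \<times> bool) set" assume Q: "finite Q"
  define X where "X = fst ` Q"
  have X: "finite X" "Q \<subseteq> X \<times> UNIV" using Q by (auto simp: X_def intro: rev_image_eqI)
  have "L2_set (\<lambda>i. pw f h i * cmod (z i)) Q \<le> L2_set (\<lambda>i. pw f h i * cmod (z i)) (X \<times> UNIV)"
    using X by (intro L2_set_subset) auto
  also have "\<dots> = sqrt ((L2_set (\<lambda>k. f (jap k) * cmod (z (k, True))) X)\<^sup>2
      + (L2_set (\<lambda>k. h (jap k) * cmod (z (k, False))) X)\<^sup>2)"
    unfolding L2_set_def sum_times_bool by (simp add: sum_nonneg)
  also have "\<dots> \<le> sqrt (A\<^sup>2 + B\<^sup>2)"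
    by (intro real_sqrt_le_mono add_mono power_mono wnorm_leD[OF assms(1)] wnorm_leD[OF assms(2)] X L2_set_nonneg)
  finally show "L2_set (\<lambda>i. pw f h i * cmod (z i)) Q \<le> sqrt (A\<^sup>2 + B\<^sup>2)" .
qed

lemma inner_imaginary_multiple: "z \<bullet> (\<i> * of_real r * z) = 0"
  by (simp add: inner_complex_def)

locale mu_ch2 =
  fixes \<gamma>1 \<gamma>2 s :: real
  assumes s: "3 / 2 < s"
begin

definition \<sigma> :: real where "\<sigma> = s - 1"
text \<open>Exponent of the norm for differences: above 1/2 for the product estimates, at most
  \<open>\<sigma>\<close> to be dominated by the solution norm, below 1 for the commutators of plain
  powers. 3/4 is one choice between 1/2 and 1.\<close>

definition a :: real where "a = min \<sigma> (3 / 4)"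
text \<open>Growth exponent common to all \<open>fw A N\<close>: the rounded-up
  \<open>\<sigma>\<close> for the power, one more for the factor containing
  \<open>min\<close>.\<close>

definition p :: nat where "p = nat \<lceil>\<sigma>\<rceil> + 1"

lemma a_facts: "1 / 2 < a" "a < 1" "0 \<le> a" "a \<le> \<sigma>" "a \<le> 1" and \<sigma>_pos: "0 < \<sigma>"
  using s by (auto simp: a_def \<sigma>_def)

definition fw :: "real \<Rightarrow> nat \<Rightarrow> real \<Rightarrow> real" where
  "fw A N x = x powr \<sigma> * (1 + A * min 1 (x / (real N + 1)))"

text \<open>Since \<open>min 1 (l * m) \<le> l * min 1 m\<close> for \<open>l \<ge> 1\<close>, the
  extra factor scales at most linearly, whatever A and N are. The whole method rests on this
  uniformity.\<close>

lemma moderate_fw: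
  assumes "0 \<le> A"
  shows "moderate a p (fw A N)"
  unfolding moderate_def
proof (intro conjI allI impI)
  fix x y :: real assume xy: "1 \<le> x" "x \<le> y"
  have "min 1 (x / (real N + 1)) \<le> min 1 (y / (real N + 1))"
    using xy by (intro min.mono divide_right_mono) auto
  then show "fw A N x \<le> fw A N y"
    unfolding fw_def using assms xy \<sigma>_pos
    by (intro mult_mono add_left_mono mult_left_mono powr_mono2) (auto intro!: add_nonneg_nonneg mult_nonneg_nonneg)
next
  fix l x :: real assume lx: "1 \<le> l" "1 \<le> x"
  define m where "m = x / (real N + 1)"
  have m: "0 \<le> m" using lx by (simp add: m_def)
  have "min 1 (l * m) \<le> l * min 1 m"
    using lx m mult_right_mono[of 1 l m] by (auto simp: min_def)
  then have "A * min 1 (l * m) \<le> A * (l * min 1 m)"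
    using assms by (intro mult_left_mono) auto
  then have 1: "1 + A * min 1 (l * m) \<le> l * (1 + A * min 1 m)"
    using lx by (simp add: algebra_simps)
  have "l powr \<sigma> \<le> l powr real (nat \<lceil>\<sigma>\<rceil>)"
    using lx by (intro powr_mono) linarith+
  also have "\<dots> = l ^ nat \<lceil>\<sigma>\<rceil>"
    using lx by (simp add: powr_realpow)
  finally have 2: "l powr \<sigma> \<le> l ^ nat \<lceil>\<sigma>\<rceil>" .
  have "fw A N (l * x) = (l powr \<sigma> * x powr \<sigma>) * (1 + A * min 1 (l * m))"
    using lx by (simp add: fw_def powr_mult m_def)
  also have "\<dots> \<le> (l ^ nat \<lceil>\<sigma>\<rceil> * x powr \<sigma>) * (l * (1 + A * min 1 m))"
    using 1 2 lx m assms by (intro mult_mono mult_right_mono) (auto intro!: add_nonneg_nonneg mult_nonneg_nonneg)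
  also have "\<dots> = l ^ p * fw A N x"
    by (simp add: p_def fw_def m_def)
  finally show "fw A N (l * x) \<le> l ^ p * fw A N x" .
next
  fix x :: real assume x: "1 \<le> x"
  have "x powr a \<le> x powr \<sigma> * 1"
    using x a_facts by (simp add: powr_mono)
  also have "\<dots> \<le> fw A N x"
    unfolding fw_def using assms x by (intro mult_left_mono) auto
  finally show "x powr a \<le> fw A N x" .
qed

lemma moderate_powr_\<sigma>: "moderate a p (\<lambda>x. x powr \<sigma>)"
proof -
  have "fw 0 0 = (\<lambda>x. x powr \<sigma>)" by (auto simp: fw_def)
  then show ?thesis using moderate_fw[of 0 0] by simp
qed

lemma moderate_powr_a: "moderate a 1 (\<lambda>x. x powr a)"
  unfolding moderate_def
proof (intro conjI allI impI)
  fix l x :: real assume lx: "1 \<le> l" "1 \<le> x"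
  have "l powr a \<le> l powr 1" using lx a_facts by (intro powr_mono) auto
  then have "l powr a * x powr a \<le> l * x powr a" using lx by (intro mult_right_mono) auto
  then show "(l * x) powr a \<le> l ^ 1 * x powr a" using lx by (simp add: powr_mult)
qed (use a_facts in \<open>auto intro!: powr_mono2\<close>)

definition G :: real where
  "G = (SOME G. \<forall>X. finite X \<longrightarrow> L2_set (\<lambda>k. jap k powr - a) X \<le> G)"

sublocale square_summable "\<lambda>k. jap k powr - a" G
proof
  have "\<exists>G. \<forall>X. finite X \<longrightarrow> L2_set (\<lambda>k. jap k powr - a) X \<le> G"
    using jap_powr_L2_bound[OF a_facts(1)] by metis
  then have *: "\<forall>X. finite X \<longrightarrow> L2_set (\<lambda>k. jap k powr - a) X \<le> G"
    unfolding G_def by (rule someI_ex)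
  fix X :: "int set" assume "finite X"
  then show "L2_set (\<lambda>k. jap k powr - a) X \<le> G" using * by blast
qed simp

subsection \<open>The nonlinearity\<close>

definition dk :: "int \<Rightarrow> real" where "dk k = 2 * pi * real_of_int k"

definition pk :: "int \<Rightarrow> complex" where
  "pk k = - (2 * of_real pi * \<i> * of_int k) / complex_of_real (kdelta k + 4 * pi^2 * (real_of_int k)^2)"

text \<open>\<open>\<kappa>T\<close>, \<open>\<kappa>P\<close>, \<open>\<kappa>B\<close> and
  \<open>\<kappa>D\<close> are the kernels of u u_x, P(D)(2 \<mu>0 u + u_x^2 / 2), P(D)(\<rho>^2 /
  2) and (u \<rho>)_x, with the first factor at frequency k - j and the second at j.\<close>

definition \<kappa>T :: "int \<Rightarrow> int \<Rightarrow> complex" where "\<kappa>T k j = \<i> * of_real (dk j)"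

definition \<kappa>P :: "int \<Rightarrow> int \<Rightarrow> complex" where
  "\<kappa>P k j = pk k * ((if k = j then 2 else 0) + 1/2 * (\<i> * of_real (dk (k - j))) * (\<i> * of_real (dk j)))"

definition \<kappa>B :: "int \<Rightarrow> int \<Rightarrow> complex" where "\<kappa>B k j = pk k / 2"

definition \<kappa>D :: "int \<Rightarrow> int \<Rightarrow> complex" where "\<kappa>D k j = \<i> * of_real (dk k)"

text \<open>The diagonal part of \<open>\<kappa>P\<close> encodes \<open>2 \<mu>\<^sub>0 u\<close>, because \<open>\<mu>\<^sub>0 = u 0\<close> is conserved; hence the
  system is autonomous and, up to the skew part \<open>lin\<close>, homogeneous quadratic.  The second equation is
  used in the conservative form \<open>\<rho>\<^sub>t = (u \<rho>)\<^sub>x + 2 \<gamma>\<^sub>2 \<rho>\<^sub>x\<close>.\<close>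

definition H :: "(int \<times> bool \<Rightarrow> complex) \<Rightarrow> int \<times> bool \<Rightarrow> int \<Rightarrow> complex" where
  "H z i j = (let k = fst i in
     if snd i then (\<kappa>T k j + \<kappa>P k j) * z (k - j, True) * z (j, True) + \<kappa>B k j * z (k - j, False) * z (j, False)
     else \<kappa>D k j * z (k - j, True) * z (j, False))"

definition lin :: "int \<times> bool \<Rightarrow> complex" where
  "lin i = \<i> * of_real ((if snd i then \<gamma>1 else 2 * \<gamma>2) * dk (fst i))"

text \<open>\<open>F\<close> with the convolution index cut to \<open>Y\<close>; the output
  frequency is unrestricted.\<close>

definition FY :: "int set \<Rightarrow> (int \<times> bool \<Rightarrow> complex) \<Rightarrow> int \<times> bool \<Rightarrow> complex" where
  "FY Y z i = (\<Sum>j\<in>Y. H z i j) + lin i * z i"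

definition F :: "(int \<times> bool \<Rightarrow> complex) \<Rightarrow> int \<times> bool \<Rightarrow> complex" where
  "F z i = (\<Sum>\<^sub>\<infinity>j. H z i j) + lin i * z i"

lemma FY_True: "FY Y z (k, True) = bil (\<lambda>k j. \<kappa>T k j + \<kappa>P k j) (\<lambda>k. z (k, True)) (\<lambda>k. z (k, True)) Y k
    + bil \<kappa>B (\<lambda>k. z (k, False)) (\<lambda>k. z (k, False)) Y k + lin (k, True) * z (k, True)"
  by (simp add: FY_def H_def bil_def sum.distrib)

lemma FY_False: "FY Y z (k, False) = bil \<kappa>D (\<lambda>k. z (k, True)) (\<lambda>k. z (k, False)) Y k + lin (k, False) * z (k, False)"
  by (simp add: FY_def H_def bil_def)

lemma dk_le: "\<bar>dk k\<bar> \<le> jap k"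
  unfolding dk_def by (rule abs_le_jap)

lemma dk_diff: "dk k - dk j = dk (k - j)"
  by (simp add: dk_def algebra_simps)

text \<open>P(D) has order -1. For k nonzero the symbol has modulus \<open>1 / D\<close>, and
  \<open>D \<ge> 6\<close> gives \<open>jap k \<le> 2 * D\<close>; at k = 0 it vanishes.\<close>

lemma cmod_pk: "cmod (pk k) \<le> 2 / jap k"
proof (cases "k = 0")
  case True
  then show ?thesis by (simp add: pk_def)
next
  case False
  define D where "D = \<bar>dk k\<bar>"
  have "1 \<le> \<bar>real_of_int k\<bar>" using False by linarith
  then have "6 * 1 \<le> (2 * pi) * \<bar>real_of_int k\<bar>"
    using pi_gt3 by (intro mult_mono) auto
  then have D: "6 \<le> D" by (simp add: D_def dk_def abs_mult)
  have "kdelta k + 4 * pi^2 * (real_of_int k)^2 = D\<^sup>2"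
    using False by (simp add: kdelta_def D_def dk_def power_mult_distrib)
  moreover have "cmod (2 * of_real pi * \<i> * of_int k) = D"
    by (simp add: norm_mult D_def dk_def abs_mult)
  ultimately have "cmod (pk k) = D / D\<^sup>2"
    unfolding pk_def norm_divide norm_minus_cancel norm_of_real by simp
  then have eq: "cmod (pk k) = 1 / D" using D by (simp add: power2_eq_square)
  have "1 \<le> D\<^sup>2" using D by (simp add: one_le_power)
  then have "jap k \<le> sqrt ((2 * D)\<^sup>2)"
    unfolding jap_def by (intro real_sqrt_le_mono) (simp add: D_def dk_def power_mult_distrib)
  then have "jap k \<le> 2 * D" using D unfolding real_sqrt_abs by linarith
  then show ?thesis unfolding eq using D by (simp add: field_simps)
qed

lemma cmod_\<kappa>T: "cmod (\<kappa>T k j) \<le> jap j"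
  using dk_le[of j] by (simp add: \<kappa>T_def norm_mult)

lemma cmod_\<kappa>B: "cmod (\<kappa>B k j) \<le> 1 / jap k"
  using cmod_pk[of k] by (simp add: \<kappa>B_def norm_divide)

lemma cmod_\<kappa>D: "cmod (\<kappa>D k j) \<le> jap k"
  using dk_le[of k] by (simp add: \<kappa>D_def norm_mult)

lemma cmod_\<kappa>P: "cmod (\<kappa>P k j) \<le> 6 * (jap (k - j) * jap j) / jap k"
proof -
  define q where "q = jap (k - j) * jap j"
  have q: "1 \<le> q" unfolding q_def using mult_mono[of 1 "jap (k - j)" 1 "jap j"] by simp
  have "cmod ((if k = j then 2 else 0) + 1/2 * (\<i> * of_real (dk (k - j))) * (\<i> * of_real (dk j)))
      \<le> cmod (if k = j then 2 else 0) + cmod (1/2 * (\<i> * of_real (dk (k - j))) * (\<i> * of_real (dk j)))"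
    by (rule norm_triangle_ineq)
  also have "cmod (if k = j then 2 else 0) \<le> 2 * q" using q by auto
  also have "cmod (1/2 * (\<i> * of_real (dk (k - j))) * (\<i> * of_real (dk j))) = 1/2 * (\<bar>dk (k - j)\<bar> * \<bar>dk j\<bar>)"
    by (simp add: norm_mult norm_divide)
  also have "\<dots> \<le> 1/2 * q"
    unfolding q_def by (intro mult_left_mono mult_mono dk_le) auto
  finally have 1: "cmod ((if k = j then 2 else 0) + 1/2 * (\<i> * of_real (dk (k - j))) * (\<i> * of_real (dk j))) \<le> 3 * q"
    using q by simp
  have "cmod (\<kappa>P k j) \<le> (2 / jap k) * (3 * q)"
    unfolding \<kappa>P_def norm_mult by (intro mult_mono cmod_pk 1) auto
  then show ?thesis by (simp add: q_def)
qed

lemma cmod_\<kappa>A: "cmod (\<kappa>T k j + \<kappa>P k j) \<le> jap j + 6 * (jap (k - j) * jap j) / jap k"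
  by (rule norm_triangle_le[OF add_mono[OF cmod_\<kappa>T cmod_\<kappa>P]])

lemma cmod_\<kappa>A': "cmod (\<kappa>T k j + \<kappa>P k j) \<le> 7 * (jap (k - j) * jap j)"
proof -
  have "1 * jap j \<le> jap (k - j) * jap j" by (intro mult_right_mono) auto
  moreover have "6 * (jap (k - j) * jap j) / jap k \<le> 6 * (jap (k - j) * jap j) / 1"
    by (intro divide_left_mono) auto
  ultimately show ?thesis using cmod_\<kappa>A[of k j] by linarith
qed

definition Sy :: "(int \<times> bool \<Rightarrow> complex) set" where
  "Sy = {z. \<forall>k b. z (- k, b) = cnj (z (k, b))}"

lemma SyD: "z \<in> Sy \<Longrightarrow> z (- k, b) = cnj (z (k, b))"
  by (simp add: Sy_def)

definition w0 where "w0 = pw (\<lambda>x. x * x powr \<sigma>) (\<lambda>x. x powr \<sigma>)"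
definition w1 where "w1 = pw (\<lambda>x. x powr \<sigma>) (\<lambda>x. x powr \<sigma> / x)"
definition wl where "wl = pw (\<lambda>x. x powr a) (\<lambda>x. x powr - (1 - a))"
definition wf where "wf A N = pw (\<lambda>x. x * fw A N x) (fw A N)"

definition S :: "nat \<Rightarrow> (int \<times> bool) set" where "S n = {- int n..int n} \<times> UNIV"

lemma jap_tri: "jap k \<le> jap j + jap (k - j)" "\<bar>jap k - jap j\<bar> \<le> jap (k - j)" "jap j \<le> jap k + jap (k - j)"
  using jap_triangle[of k j] jap_diff[of k j] by linarith+

lemma jap_tri': "jap (k - j) \<le> jap k + jap j"
  using jap_triangle[of "k - j" "k"] by simp

abbreviation gs :: "int \<Rightarrow> int \<Rightarrow> real" where
  "gs k j \<equiv> jap k powr - a + jap j powr - a + jap (k - j) powr - a"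

lemma moderate_algebra_gs:
  assumes "moderate a q f"
  shows "f (jap k) \<le> 2 ^ q * (f (jap (k - j)) * f (jap j) * gs k j)"
proof -
  have "f (jap k) \<le> 2 ^ q * (f (jap j) * f (jap (k - j)) * (jap j powr - a + jap (k - j) powr - a))"
    using assms a_facts(3) by (intro moderate_algebra) (auto simp: jap_tri)
  also have "\<dots> \<le> 2 ^ q * (f (jap j) * f (jap (k - j)) * gs k j)"
    using moderate_pos[OF assms a_facts(3)] by (intro mult_left_mono mult_nonneg_nonneg) (auto intro: less_imp_le)
  finally show ?thesis by (simp add: mult_ac)
qed

lemma one_le_gs: "1 \<le> jap (k - j) powr a * gs k j"
proof -
  have "1 = jap (k - j) powr a * jap (k - j) powr - a"
    by (simp add: powr_minus)
  also have "\<dots> \<le> jap (k - j) powr a * gs k j"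
    by (intro mult_left_mono) auto
  finally show ?thesis .
qed

lemma low_gs: "jap j powr (1 - a) \<le> 4 * (jap k powr (1 - a) * jap (k - j) powr a * gs k j)"
proof -
  have "jap j powr (1 - a) \<le> 4 * (jap k powr (1 - a) * jap (k - j) powr a * (jap k powr - a + jap (k - j) powr - a))"
    using a_facts by (intro powr_low_le) (auto simp: jap_tri)
  also have "\<dots> \<le> 4 * (jap k powr (1 - a) * jap (k - j) powr a * gs k j)"
    by (intro mult_left_mono) auto
  finally show ?thesis .
qed

lemma low_gs': "jap (k - j) powr (1 - a) \<le> 4 * (jap k powr (1 - a) * jap j powr a * gs k j)"
proof -
  have "jap (k - j) powr (1 - a) \<le> 4 * (jap k powr (1 - a) * jap j powr a * (jap k powr - a + jap j powr - a))"
    using a_facts by (intro powr_low_le) (auto simp: jap_tri')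
  also have "\<dots> \<le> 4 * (jap k powr (1 - a) * jap j powr a * gs k j)"
    by (intro mult_left_mono) auto
  finally show ?thesis .
qed

subsection \<open>Energy estimate\<close>

text \<open>\<open>3 * G\<close> times the sum of the constants of the four contributions
  \<open>T\<close>, \<open>P\<close>, \<open>Q\<close>, \<open>R\<close> in
  \<open>FY_energy\<close>; free of A and N.\<close>

definition C0 :: real where "C0 = 3 * G * (4 * ((real p + 1) * 2 ^ (p + 1)) + 4 + 7 * 2 ^ p)"

text \<open>The transport terms of both equations lose a derivative and go through the commutators,
  for which the coefficient u must be real-valued. The terms with P(D) have order zero because its
  symbol compensates one factor \<open>jap k\<close>. The terms with \<gamma>1 and \<gamma>2 are
  skew and drop out. Outer and inner frequencies run over the same \<open>X\<close>, so that they
  can be exchanged.\<close>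

lemma FY_energy:
  assumes z: "z \<in> Sy" and A: "0 \<le> A" and B: "wnorm_le (wf A N) z B" and X: "finite X"
  shows "(\<Sum>i\<in>X \<times> UNIV. (wf A N i)\<^sup>2 * (z i \<bullet> FY X z i)) \<le> C0 * B ^ 3"
proof -
  define f where "f = fw A N"
  have m: "moderate a p f" unfolding f_def by (rule moderate_fw[OF A])
  note fpos = less_imp_le[OF moderate_pos[OF m a_facts(3) jap_ge1]]
  define u \<rho> where "u = (\<lambda>k. z (k, True))" and "\<rho> = (\<lambda>k. z (k, False))"
  define M h where "M = (\<lambda>k. jap k * f (jap k))" and "h = (\<lambda>k. f (jap k))"
  have M: "0 \<le> M k" and h: "0 \<le> h k" for k
    using fpos[of k] by (auto simp: M_def h_def)
  have uB: "wnorm_le M u B" and \<rho>B: "wnorm_le h \<rho> B"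
    using wnorm_le_components[OF B[unfolded wf_def]] by (simp_all add: u_def \<rho>_def M_def h_def f_def)
  have ur: "u (- l) = cnj (u l)" for l unfolding u_def by (rule SyD[OF z])
  define c where "c = (real p + 1) * 2 ^ (p + 1)"
  have c: "0 \<le> c" by (simp add: c_def)
  have dk_simp: "\<bar>dk k - dk j\<bar> \<le> jap (k - j)" for k j
    unfolding dk_diff by (rule dk_le)
  have T: "(\<Sum>k\<in>X. (M k)\<^sup>2 * (u k \<bullet> bil \<kappa>T u u X k)) \<le> 3 * (2 * c + 3) * G * (B * B * B)"
    unfolding \<kappa>T_def
  proof (rule bil_transport_le[OF X M M _ ur uB uB])
    show "\<bar>(M k)\<^sup>2 * dk j - (M j)\<^sup>2 * dk k\<bar> \<le> (2 * c + 3) * (M (k - j) * M j * M k * gs k j)" for k j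
      unfolding M_def c_def
      by (rule commutator_u[OF m a_facts(3)]) (auto simp: jap_tri dk_le dk_simp)
  qed (use c in auto)
  have P: "(\<Sum>k\<in>X. (M k)\<^sup>2 * (u k \<bullet> bil \<kappa>P u u X k)) \<le> 3 * (6 * 2 ^ p) * G * (B * B * B)"
  proof (rule bil_inner_le[OF X X M M M _ uB uB uB])
    fix k j
    have "\<bar>(M k)\<^sup>2\<bar> * cmod (\<kappa>P k j) \<le> (M k)\<^sup>2 * (6 * (jap (k - j) * jap j) / jap k)"
      unfolding abs_power2 by (intro mult_left_mono cmod_\<kappa>P zero_le_power2)
    also have "\<dots> = 6 * M k * (jap (k - j) * jap j) * f (jap k)"
      by (simp add: M_def power2_eq_square)
    also have "\<dots> \<le> 6 * M k * (jap (k - j) * jap j) * (2 ^ p * (f (jap (k - j)) * f (jap j) * gs k j))"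
      using M by (intro mult_left_mono moderate_algebra_gs[OF m]) auto
    finally show "\<bar>(M k)\<^sup>2\<bar> * cmod (\<kappa>P k j) \<le> 6 * 2 ^ p * (M (k - j) * M j * M k * gs k j)"
      by (simp add: M_def mult_ac)
  qed auto
  have Q: "(\<Sum>k\<in>X. (M k)\<^sup>2 * (u k \<bullet> bil \<kappa>B \<rho> \<rho> X k)) \<le> 3 * 2 ^ p * G * (B * B * B)"
  proof (rule bil_inner_le[OF X X h h M _ \<rho>B \<rho>B uB])
    fix k j
    have "\<bar>(M k)\<^sup>2\<bar> * cmod (\<kappa>B k j) \<le> (M k)\<^sup>2 * (1 / jap k)"
      unfolding abs_power2 by (intro mult_left_mono cmod_\<kappa>B zero_le_power2)
    also have "\<dots> = M k * f (jap k)"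
      by (simp add: M_def power2_eq_square)
    also have "\<dots> \<le> M k * (2 ^ p * (f (jap (k - j)) * f (jap j) * gs k j))"
      using M by (intro mult_left_mono moderate_algebra_gs[OF m]) auto
    finally show "\<bar>(M k)\<^sup>2\<bar> * cmod (\<kappa>B k j) \<le> 2 ^ p * (h (k - j) * h j * M k * gs k j)"
      by (simp add: h_def mult_ac)
  qed auto
  have R: "(\<Sum>k\<in>X. (h k)\<^sup>2 * (\<rho> k \<bullet> bil \<kappa>D u \<rho> X k)) \<le> 3 * (2 * c + 1) * G * (B * B * B)"
    unfolding \<kappa>D_def
  proof (rule bil_transport_le[OF X M h _ ur uB \<rho>B])
    show "\<bar>(h k)\<^sup>2 * dk k - (h j)\<^sup>2 * dk j\<bar> \<le> (2 * c + 1) * (M (k - j) * h j * h k * gs k j)" for k j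
      unfolding M_def h_def c_def
      by (rule commutator_rho[OF m a_facts(3)]) (auto simp: jap_tri dk_le dk_simp)
  qed (use c in auto)
  have "(\<Sum>i\<in>X \<times> UNIV. (wf A N i)\<^sup>2 * (z i \<bullet> FY X z i))
      = (\<Sum>k\<in>X. (M k)\<^sup>2 * (u k \<bullet> FY X z (k, True))) + (\<Sum>k\<in>X. (h k)\<^sup>2 * (\<rho> k \<bullet> FY X z (k, False)))"
    unfolding sum_times_bool by (simp add: wf_def M_def h_def f_def u_def \<rho>_def)
  also have "(\<Sum>k\<in>X. (M k)\<^sup>2 * (u k \<bullet> FY X z (k, True)))
      = (\<Sum>k\<in>X. (M k)\<^sup>2 * (u k \<bullet> bil \<kappa>T u u X k)) + (\<Sum>k\<in>X. (M k)\<^sup>2 * (u k \<bullet> bil \<kappa>P u u X k))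
        + (\<Sum>k\<in>X. (M k)\<^sup>2 * (u k \<bullet> bil \<kappa>B \<rho> \<rho> X k))"
    unfolding FY_True bil_add_kernel sum.distrib[symmetric]
    by (simp add: inner_add_right distrib_left lin_def inner_imaginary_multiple u_def \<rho>_def del: of_real_mult)
  also have "(\<Sum>k\<in>X. (h k)\<^sup>2 * (\<rho> k \<bullet> FY X z (k, False))) = (\<Sum>k\<in>X. (h k)\<^sup>2 * (\<rho> k \<bullet> bil \<kappa>D u \<rho> X k))"
    unfolding FY_False
    by (simp add: inner_add_right distrib_left lin_def inner_imaginary_multiple u_def \<rho>_def del: of_real_mult)
  finally have "(\<Sum>i\<in>X \<times> UNIV. (wf A N i)\<^sup>2 * (z i \<bullet> FY X z i))
      \<le> 3 * (2 * c + 3) * G * (B * B * B) + 3 * (6 * 2 ^ p) * G * (B * B * B) + 3 * 2 ^ p * G * (B * B * B)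
        + 3 * (2 * c + 1) * G * (B * B * B)"
    using T P Q R by linarith
  also have "\<dots> = C0 * B ^ 3"
    by (simp add: C0_def c_def power3_eq_cube algebra_simps)
  finally show ?thesis .
qed

subsection \<open>Lipschitz estimate\<close>

text \<open>54 is 48 from the first component plus 6 from the second; the absolute value makes the
  constant nonnegative for every argument.\<close>

definition CL :: "real \<Rightarrow> real" where
  "CL B = 54 * 2 ^ p * G * \<bar>B\<bar> + \<bar>\<gamma>1\<bar> + \<bar>2 * \<gamma>2\<bar>"

lemma wnorm_le_lin:
  assumes "wnorm_le (\<lambda>k. jap k * w k) x d" "\<And>k. 0 \<le> w k"
  shows "wnorm_le w (\<lambda>k. \<i> * of_real (r * dk k) * x k) (\<bar>r\<bar> * d)"
proof (rule wnorm_leI)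
  fix Q :: "int set" assume Q: "finite Q"
  have "L2_set (\<lambda>k. w k * cmod (\<i> * of_real (r * dk k) * x k)) Q \<le> L2_set (\<lambda>k. \<bar>r\<bar> * (jap k * w k * cmod (x k))) Q"
  proof (rule L2_set_mono)
    fix k
    have "w k * cmod (\<i> * of_real (r * dk k) * x k) = \<bar>r\<bar> * (\<bar>dk k\<bar> * (w k * cmod (x k)))"
      by (simp add: norm_mult abs_mult)
    also have "\<dots> \<le> \<bar>r\<bar> * (jap k * (w k * cmod (x k)))"
      using assms(2) by (intro mult_left_mono mult_right_mono dk_le) auto
    finally show "w k * cmod (\<i> * of_real (r * dk k) * x k) \<le> \<bar>r\<bar> * (jap k * w k * cmod (x k))"
      by (simp add: mult.assoc)
  qed (use assms in auto)
  also have "\<dots> = \<bar>r\<bar> * L2_set (\<lambda>k. jap k * w k * cmod (x k)) Q"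
    by (simp add: L2_set_right_distrib)
  also have "\<dots> \<le> \<bar>r\<bar> * d"
    by (intro mult_left_mono wnorm_leD[OF assms(1) Q]) auto
  finally show "L2_set (\<lambda>k. w k * cmod (\<i> * of_real (r * dk k) * x k)) Q \<le> \<bar>r\<bar> * d" .
qed

lemma FY_diff_True: "FY Y z (k, True) - FY Y z' (k, True) =
    bil (\<lambda>k j. \<kappa>T k j + \<kappa>P k j) (\<lambda>k. z (k, True)) (\<lambda>k. z (k, True) - z' (k, True)) Y k
    + bil (\<lambda>k j. \<kappa>T k j + \<kappa>P k j) (\<lambda>k. z (k, True) - z' (k, True)) (\<lambda>k. z' (k, True)) Y k
    + bil \<kappa>B (\<lambda>k. z (k, False)) (\<lambda>k. z (k, False) - z' (k, False)) Y k
    + bil \<kappa>B (\<lambda>k. z (k, False) - z' (k, False)) (\<lambda>k. z' (k, False)) Y k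
    + \<i> * of_real (\<gamma>1 * dk k) * (z (k, True) - z' (k, True))"
proof -
  have "FY Y z (k, True) - FY Y z' (k, True) =
      (bil (\<lambda>k j. \<kappa>T k j + \<kappa>P k j) (\<lambda>k. z (k, True)) (\<lambda>k. z (k, True)) Y k
        - bil (\<lambda>k j. \<kappa>T k j + \<kappa>P k j) (\<lambda>k. z' (k, True)) (\<lambda>k. z' (k, True)) Y k)
      + (bil \<kappa>B (\<lambda>k. z (k, False)) (\<lambda>k. z (k, False)) Y k - bil \<kappa>B (\<lambda>k. z' (k, False)) (\<lambda>k. z' (k, False)) Y k)
      + (lin (k, True) * z (k, True) - lin (k, True) * z' (k, True))"
    unfolding FY_True by (simp only: add_diff_add)
  then show ?thesis
    unfolding bil_diff right_diff_distrib[symmetric] by (simp add: lin_def)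
qed

lemma FY_diff_False: "FY Y z (k, False) - FY Y z' (k, False) =
    bil \<kappa>D (\<lambda>k. z (k, True)) (\<lambda>k. z (k, False) - z' (k, False)) Y k
    + bil \<kappa>D (\<lambda>k. z (k, True) - z' (k, True)) (\<lambda>k. z' (k, False)) Y k
    + \<i> * of_real (2 * \<gamma>2 * dk k) * (z (k, False) - z' (k, False))"
proof -
  have "FY Y z (k, False) - FY Y z' (k, False) =
      (bil \<kappa>D (\<lambda>k. z (k, True)) (\<lambda>k. z (k, False)) Y k - bil \<kappa>D (\<lambda>k. z' (k, True)) (\<lambda>k. z' (k, False)) Y k)
      + (lin (k, False) * z (k, False) - lin (k, False) * z' (k, False))"
    unfolding FY_False by (simp only: add_diff_add)
  then show ?thesis
    unfolding bil_diff right_diff_distrib[symmetric] by (simp add: lin_def)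
qed

text \<open>Here a derivative may be lost, the target weight being one order lower; hence absolute
  values of the kernels and the algebra property suffice, without cancellation.\<close>

lemma FY_lip:
  assumes Y: "finite Y" and z: "wnorm_le w0 z B" "wnorm_le w0 z' B" and d: "wnorm_le w0 (\<lambda>i. z i - z' i) d"
  shows "wnorm_le w1 (\<lambda>i. FY Y z i - FY Y z' i) (CL B * d)"
proof -
  define M h where "M = (\<lambda>k. jap k * jap k powr \<sigma>)" and "h = (\<lambda>k. jap k powr \<sigma>)"
  define u \<rho> where "u = (\<lambda>k. z (k, True))" and "\<rho> = (\<lambda>k. z (k, False))"
  define u' \<rho>' where "u' = (\<lambda>k. z' (k, True))" and "\<rho>' = (\<lambda>k. z' (k, False))"
  define v \<eta> where "v = (\<lambda>k. z (k, True) - z' (k, True))" and "\<eta> = (\<lambda>k. z (k, False) - z' (k, False))"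
  have M: "0 \<le> M k" and h: "0 \<le> h k" for k by (auto simp: M_def h_def)
  note comp = wnorm_le_components[of "\<lambda>x. x * x powr \<sigma>" "\<lambda>x. x powr \<sigma>", folded w0_def M_def h_def]
  have b: "wnorm_le M u B" "wnorm_le h \<rho> B" "wnorm_le M u' B" "wnorm_le h \<rho>' B" "wnorm_le M v d" "wnorm_le h \<eta> d"
    using comp[OF z(1)] comp[OF z(2)] comp[OF d] by (simp_all add: u_def \<rho>_def u'_def \<rho>'_def v_def \<eta>_def)
  have Bd: "0 \<le> B" "0 \<le> d" using wnorm_le_nonneg z d by blast+
  note alg = moderate_algebra_gs[OF moderate_powr_\<sigma>]
  have kA: "h k * cmod (\<kappa>T k j + \<kappa>P k j) \<le> 7 * 2 ^ p * (M (k - j) * M j * gs k j)" for k j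
  proof -
    have "h k * cmod (\<kappa>T k j + \<kappa>P k j)
        \<le> (2 ^ p * (jap (k - j) powr \<sigma> * jap j powr \<sigma> * gs k j)) * (7 * (jap (k - j) * jap j))"
      unfolding h_def by (intro mult_mono alg cmod_\<kappa>A') auto
    then show ?thesis by (simp add: M_def mult_ac)
  qed
  have kB: "h k * cmod (\<kappa>B k j) \<le> 2 ^ p * (h (k - j) * h j * gs k j)" for k j
  proof -
    have "cmod (\<kappa>B k j) \<le> 1" using cmod_\<kappa>B[of k j] by (rule order_trans) simp
    then have "h k * cmod (\<kappa>B k j) \<le> (2 ^ p * (jap (k - j) powr \<sigma> * jap j powr \<sigma> * gs k j)) * 1"
      unfolding h_def by (intro mult_mono alg) auto
    then show ?thesis by (simp add: h_def mult_ac)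
  qed
  have kD: "h k / jap k * cmod (\<kappa>D k j) \<le> 2 ^ p * (M (k - j) * h j * gs k j)" for k j
  proof -
    have "h k / jap k * cmod (\<kappa>D k j) \<le> h k / jap k * jap k"
      by (intro mult_left_mono cmod_\<kappa>D) (auto simp: h_def)
    also have "\<dots> = h k" by simp
    also have "\<dots> \<le> 2 ^ p * (h (k - j) * h j * gs k j)"
      unfolding h_def by (rule alg)
    also have "\<dots> \<le> 2 ^ p * (M (k - j) * h j * gs k j)"
      by (intro mult_left_mono mult_right_mono) (auto simp: M_def h_def mult_le_cancel_right1)
    finally show ?thesis .
  qed
  have U: "wnorm_le h (\<lambda>k. FY Y z (k, True) - FY Y z' (k, True))
      (3 * (7 * 2 ^ p) * G * (B * d) + 3 * (7 * 2 ^ p) * G * (d * B) + 3 * 2 ^ p * G * (B * d)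
        + 3 * 2 ^ p * G * (d * B) + \<bar>\<gamma>1\<bar> * d)"
    unfolding FY_diff_True u_def[symmetric] \<rho>_def[symmetric] u'_def[symmetric] \<rho>'_def[symmetric] v_def[symmetric] \<eta>_def[symmetric]
  proof (intro wnorm_le_add h)
    show "wnorm_le h (bil (\<lambda>k j. \<kappa>T k j + \<kappa>P k j) u v Y) (3 * (7 * 2 ^ p) * G * (B * d))"
      by (rule bil_bound[OF Y M M h kA b(1,5)]) simp
    show "wnorm_le h (bil (\<lambda>k j. \<kappa>T k j + \<kappa>P k j) v u' Y) (3 * (7 * 2 ^ p) * G * (d * B))"
      by (rule bil_bound[OF Y M M h kA b(5,3)]) simp
    show "wnorm_le h (bil \<kappa>B \<rho> \<eta> Y) (3 * 2 ^ p * G * (B * d))"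
      by (rule bil_bound[OF Y h h h kB b(2,6)]) simp
    show "wnorm_le h (bil \<kappa>B \<eta> \<rho>' Y) (3 * 2 ^ p * G * (d * B))"
      by (rule bil_bound[OF Y h h h kB b(6,4)]) simp
    show "wnorm_le h (\<lambda>k. \<i> * of_real (\<gamma>1 * dk k) * (z (k, True) - z' (k, True))) (\<bar>\<gamma>1\<bar> * d)"
      by (rule wnorm_le_lin) (use b(5) in \<open>simp_all add: M_def h_def v_def\<close>)
  qed
  have V: "wnorm_le (\<lambda>k. h k / jap k) (\<lambda>k. FY Y z (k, False) - FY Y z' (k, False))
      (3 * 2 ^ p * G * (B * d) + 3 * 2 ^ p * G * (d * B) + \<bar>2 * \<gamma>2\<bar> * d)"
    unfolding FY_diff_False u_def[symmetric] \<rho>_def[symmetric] u'_def[symmetric] \<rho>'_def[symmetric] v_def[symmetric] \<eta>_def[symmetric]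
  proof (intro wnorm_le_add)
    have h': "0 \<le> h k / jap k" for k by (simp add: h_def)
    then show "0 \<le> h k / jap k" "0 \<le> h k / jap k" for k by blast+
    show "wnorm_le (\<lambda>k. h k / jap k) (bil \<kappa>D u \<eta> Y) (3 * 2 ^ p * G * (B * d))"
      by (rule bil_bound[OF Y M h h' kD b(1,6)]) simp
    show "wnorm_le (\<lambda>k. h k / jap k) (bil \<kappa>D v \<rho>' Y) (3 * 2 ^ p * G * (d * B))"
      by (rule bil_bound[OF Y M h h' kD b(5,4)]) simp
    show "wnorm_le (\<lambda>k. h k / jap k) (\<lambda>k. \<i> * of_real (2 * \<gamma>2 * dk k) * (z (k, False) - z' (k, False))) (\<bar>2 * \<gamma>2\<bar> * d)"
      by (rule wnorm_le_lin) (use b(6) in \<open>simp_all add: h_def \<eta>_def\<close>)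
  qed
  define cu cv where "cu = (48 * 2 ^ p * G * B + \<bar>\<gamma>1\<bar>) * d" and "cv = (6 * 2 ^ p * G * B + \<bar>2 * \<gamma>2\<bar>) * d"
  have cuv: "0 \<le> cu" "0 \<le> cv"
    unfolding cu_def cv_def using Bd G_nonneg by (auto intro!: mult_nonneg_nonneg add_nonneg_nonneg)
  have "wnorm_le w1 (\<lambda>i. FY Y z i - FY Y z' i) (sqrt (cu\<^sup>2 + cv\<^sup>2))"
    unfolding w1_def
  proof (rule wnorm_le_pair)
    show "wnorm_le (\<lambda>k. jap k powr \<sigma>) (\<lambda>k. FY Y z (k, True) - FY Y z' (k, True)) cu"
      using U by (simp add: h_def cu_def algebra_simps)
    show "wnorm_le (\<lambda>k. jap k powr \<sigma> / jap k) (\<lambda>k. FY Y z (k, False) - FY Y z' (k, False)) cv"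
      using V by (simp add: h_def cv_def algebra_simps)
  qed
  moreover have "sqrt (cu\<^sup>2 + cv\<^sup>2) \<le> cu + cv"
    using sqrt_sum_squares_le_sum[OF cuv] .
  moreover have "cu + cv = CL B * d"
    using Bd by (simp add: cu_def cv_def CL_def algebra_simps)
  ultimately show ?thesis by (auto intro: wnorm_le_mono)
qed

subsection \<open>Difference estimate\<close>

text \<open>198 adds the constants of the seven terms quadratic in the difference norm; 816 is 4 *
  198, from the tail contained in that norm, plus 24 from the two terms whose inner frequency lies
  outside the truncation.\<close>

definition CD :: "real \<Rightarrow> real" where "CD B = 198 * G * B + 816 * G * B ^ 3"

text \<open>Bounds the ratio of \<open>wl\<close> to \<open>w0\<close> off
  \<open>S n\<close>.\<close>

definition tail :: "nat \<Rightarrow> real" where "tail n = jap (int n) powr - a"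

lemma tail_bounds: "0 \<le> tail n" "tail n \<le> 1"
  using a_facts by (auto simp: tail_def powr_minus field_simps intro!: ge_one_powr_ge_zero)

lemma tail_ge: "int n \<le> \<bar>k\<bar> \<Longrightarrow> jap k powr - a \<le> tail n"
  unfolding tail_def using a_facts by (intro powr_mono2') (auto intro!: jap_mono)

lemma tail_lim: "tail \<longlonglongrightarrow> 0"
proof -
  have "filterlim (\<lambda>n. jap (int n)) at_top sequentially"
  proof (rule filterlim_at_top_mono[OF filterlim_real_sequentially always_eventually], rule allI)
    show "real n \<le> jap (int n)" for n using abs_int_le_jap[of "int n"] by simp
  qed
  then show ?thesis
    unfolding tail_def using a_facts by (intro tendsto_neg_powr) auto
qed

text \<open>The energy is truncated to \<open>S n\<close>, while the convolution runs over the
  larger \<open>Y\<close>. Only the part of a transport term with both frequencies in the truncation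
  can be symmetrised; the part with inner frequency outside is paid for by the tail. With the
  difference as coefficient, the derivative falls on a full solution, is compensated by P(D), or is
  absorbed by the lower norm of the second component.\<close>

lemma FY_diff_le:
  assumes Sy: "z \<in> Sy" and z: "wnorm_le w0 z B" "wnorm_le w0 z' B"
    and Y: "finite Y" "{- int n..int n} \<subseteq> Y"
  shows "(\<Sum>i\<in>S n. (wl i)\<^sup>2 * ((z i - z' i) \<bullet> (FY Y z i - FY Y z' i)))
    \<le> CD B * ((\<Sum>i\<in>S n. (wl i * cmod (z i - z' i))\<^sup>2) + tail n)"
proof -
  define X where "X = {- int n..int n}"
  have X: "finite X" by (simp add: X_def)
  have YX: "finite (Y - X)" using Y by simp
  define M h where "M = (\<lambda>k. jap k * jap k powr a)" and "h = (\<lambda>k. jap k powr a)"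
  define Nl where "Nl = (\<lambda>k. jap k powr - (1 - a))"
  define u \<rho> where "u = (\<lambda>k. z (k, True))" and "\<rho> = (\<lambda>k. z (k, False))"
  define u' \<rho>' where "u' = (\<lambda>k. z' (k, True))" and "\<rho>' = (\<lambda>k. z' (k, False))"
  define v \<eta> where "v = (\<lambda>k. z (k, True) - z' (k, True))" and "\<eta> = (\<lambda>k. z (k, False) - z' (k, False))"
  define \<kappa> where "\<kappa> = tail n"
  have \<kappa>: "0 \<le> \<kappa>" "\<kappa> \<le> 1" unfolding \<kappa>_def by (rule tail_bounds)+
  have w: "0 \<le> M k" "0 \<le> h k" "0 \<le> Nl k" for k by (auto simp: M_def h_def Nl_def)
  have B: "0 \<le> B" by (rule wnorm_le_nonneg[OF z(1)])
  have mono\<sigma>: "jap k powr a \<le> jap k powr \<sigma>" for k using a_facts by (intro powr_mono) auto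
  have low: "wnorm_le M (\<lambda>k. y (k, True)) b \<and> wnorm_le h (\<lambda>k. y (k, False)) b" if "wnorm_le w0 y b" for y b
  proof
    note comp = wnorm_le_components[OF that[unfolded w0_def]]
    show "wnorm_le M (\<lambda>k. y (k, True)) b"
      by (rule wnorm_le_weight[OF comp(1) w(1)]) (simp add: M_def mono\<sigma>)
    show "wnorm_le h (\<lambda>k. y (k, False)) b"
      by (rule wnorm_le_weight[OF comp(2) w(2)]) (simp add: h_def mono\<sigma>)
  qed
  have z2: "wnorm_le w0 (\<lambda>i. z i - z' i) (2 * B)"
    using wnorm_le_diff[OF z] by (simp add: w0_def pw_def)
  have b: "wnorm_le M u B" "wnorm_le h \<rho> B" "wnorm_le M u' B" "wnorm_le h \<rho>' B" "wnorm_le M v (2 * B)" "wnorm_le h \<eta> (2 * B)"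
    using low[OF z(1)] low[OF z(2)] low[OF z2] by (simp_all add: u_def \<rho>_def u'_def \<rho>'_def v_def \<eta>_def)
  have ur: "u (- l) = cnj (u l)" for l unfolding u_def by (rule SyD[OF Sy])
  define D where "D = (\<Sum>i\<in>S n. (wl i * cmod (z i - z' i))\<^sup>2)"
  \<comment> \<open>Bounds the difference over all frequencies, as the trilinear estimates require:
    \<open>D\<close> inside \<open>S n\<close>, and outside the crude bound \<open>2 * B\<close>
    times the ratio of the weights.\<close>
  define \<Delta> where "\<Delta> = sqrt (D + 4 * B\<^sup>2 * \<kappa>\<^sup>2)"
  have D0: "0 \<le> D" unfolding D_def by (intro sum_nonneg) auto
  have \<Delta>2: "\<Delta> * \<Delta> = D + 4 * B\<^sup>2 * \<kappa>\<^sup>2"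
    unfolding \<Delta>_def using D0 by (simp add: add_nonneg_nonneg)
  have wl_tail: "wl i \<le> \<kappa> * w0 i" if "i \<notin> S n" for i
  proof -
    obtain k c where i: "i = (k, c)" by (cases i)
    have "int n \<le> \<bar>k\<bar>" using that by (auto simp: i S_def)
    then have *: "jap k powr - a \<le> \<kappa>" unfolding \<kappa>_def by (rule tail_ge)
    have 1: "jap k powr - 1 \<le> jap k powr - a" using a_facts by (intro powr_mono) auto
    have "jap k powr a = jap k powr - 1 * (jap k * jap k powr a)"
      by (simp add: powr_minus)
    also have "\<dots> \<le> \<kappa> * (jap k * jap k powr \<sigma>)"
      using * 1 \<kappa> by (intro mult_mono mult_left_mono mono\<sigma>) auto
    finally have "jap k powr a \<le> \<kappa> * (jap k * jap k powr \<sigma>)" .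
    moreover have "jap k powr - (1 - a) = jap k powr - 1 * jap k powr a"
    proof -
      have "- (1 - a) = - 1 + a" by simp
      then show ?thesis by (simp only: powr_add)
    qed
    then have "jap k powr - (1 - a) \<le> \<kappa> * jap k powr \<sigma>"
      using * 1 mult_mono[of "jap k powr - 1" \<kappa> "jap k powr a" "jap k powr \<sigma>"] mono\<sigma>[of k] \<kappa> by simp
    ultimately show ?thesis
      by (cases c) (auto simp: i wl_def w0_def)
  qed
  have wl\<Delta>: "wnorm_le wl (\<lambda>i. z i - z' i) \<Delta>"
  proof (rule wnorm_leI)
    fix Q :: "(int \<times> bool) set" assume Q: "finite Q"
    have "(\<Sum>i\<in>Q. (wl i * cmod (z i - z' i))\<^sup>2)
        = (\<Sum>i\<in>Q \<inter> S n. (wl i * cmod (z i - z' i))\<^sup>2) + (\<Sum>i\<in>Q - S n. (wl i * cmod (z i - z' i))\<^sup>2)"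
      using Q by (rule sum.Int_Diff)
    also have "(\<Sum>i\<in>Q \<inter> S n. (wl i * cmod (z i - z' i))\<^sup>2) \<le> D"
      unfolding D_def by (rule sum_mono2) (auto simp: S_def)
    also have "(\<Sum>i\<in>Q - S n. (wl i * cmod (z i - z' i))\<^sup>2)
        \<le> (\<Sum>i\<in>Q - S n. \<kappa>\<^sup>2 * (w0 i * cmod (z i - z' i))\<^sup>2)"
    proof (rule sum_mono)
      fix i assume "i \<in> Q - S n"
      then have "wl i * cmod (z i - z' i) \<le> \<kappa> * w0 i * cmod (z i - z' i)"
        by (intro mult_right_mono wl_tail) auto
      then have "(wl i * cmod (z i - z' i))\<^sup>2 \<le> (\<kappa> * w0 i * cmod (z i - z' i))\<^sup>2"
        by (intro power_mono) (auto simp: wl_def pw_def)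
      then show "(wl i * cmod (z i - z' i))\<^sup>2 \<le> \<kappa>\<^sup>2 * (w0 i * cmod (z i - z' i))\<^sup>2"
        by (simp add: power_mult_distrib mult.assoc)
    qed
    also have "\<dots> = \<kappa>\<^sup>2 * (L2_set (\<lambda>i. w0 i * cmod (z i - z' i)) (Q - S n))\<^sup>2"
      by (simp add: sum_distrib_left[symmetric] L2_set_def sum_nonneg)
    also have "\<dots> \<le> \<kappa>\<^sup>2 * (2 * B)\<^sup>2"
      using Q by (intro mult_left_mono power_mono wnorm_leD[OF z2] L2_set_nonneg) auto
    finally have "(\<Sum>i\<in>Q. (wl i * cmod (z i - z' i))\<^sup>2) \<le> D + 4 * B\<^sup>2 * \<kappa>\<^sup>2"
      by (simp add: power_mult_distrib mult_ac)
    then show "L2_set (\<lambda>i. wl i * cmod (z i - z' i)) Q \<le> \<Delta>"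
      unfolding L2_set_def \<Delta>_def by (rule real_sqrt_le_mono)
  qed
  have b\<Delta>: "wnorm_le h v \<Delta>" "wnorm_le Nl \<eta> \<Delta>"
    using wnorm_le_components[OF wl\<Delta>[unfolded wl_def]] by (simp_all add: h_def Nl_def v_def \<eta>_def)
  have dk_simp: "\<bar>dk k - dk j\<bar> \<le> jap (k - j)" for k j
    unfolding dk_diff by (rule dk_le)
  note alg = moderate_algebra_gs[OF moderate_powr_a, unfolded power_one_right]
  have gM: "jap (k - j) \<le> M (k - j) * gs k j" for k j
  proof -
    have "jap (k - j) * 1 \<le> jap (k - j) * (jap (k - j) powr a * gs k j)"
      by (intro mult_left_mono one_le_gs) auto
    then show ?thesis by (simp add: M_def mult.assoc)
  qed
  \<comment> \<open>\<open>Nl\<close> is \<open>h\<close> lowered by one order. The gain of P(D)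
    turns the square of \<open>h\<close> into \<open>h * Nl\<close>, so that the product estimate in
    negative order applies.\<close>
  have h2: "(h k)\<^sup>2 / jap k = h k * Nl k" for k
  proof -
    have "jap k powr - (1 - a) = jap k powr (a - 1)" by simp
    also have "\<dots> = jap k powr a / jap k" by (simp add: powr_diff)
    finally show ?thesis by (simp add: h_def Nl_def power2_eq_square)
  qed
  have Nl_jap: "Nl k * jap k = h k" for k
  proof -
    have "jap k powr - (1 - a) = jap k powr (a - 1)" by simp
    also have "\<dots> = jap k powr a / jap k" by (simp add: powr_diff)
    finally show ?thesis by (simp add: h_def Nl_def)
  qed
  have Nl_inv: "Nl k * jap k powr (1 - a) = 1" for k
    unfolding Nl_def powr_add[symmetric] by simp
  \<comment> \<open>Kernel form of the product estimate from H^a times H^(a-1) into H^(a-1),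
    obtained from \<open>low_gs\<close> by multiplying with \<open>Nl k * Nl j\<close>.\<close>
  have lowN: "Nl k \<le> 4 * (h (k - j) * Nl j * gs k j)" for k j
  proof -
    have "Nl k * (Nl j * jap j powr (1 - a)) \<le> Nl k * (Nl j * (4 * (jap k powr (1 - a) * jap (k - j) powr a * gs k j)))"
      using w by (intro mult_left_mono low_gs) auto
    also have "\<dots> = (Nl k * jap k powr (1 - a)) * (4 * (h (k - j) * Nl j * gs k j))"
      by (simp add: h_def mult_ac)
    finally show ?thesis by (simp only: Nl_inv mult_1_left mult_1_right)
  qed
  have lowN': "Nl k \<le> 4 * (Nl (k - j) * h j * gs k j)" for k j
  proof -
    have "Nl k * (Nl (k - j) * jap (k - j) powr (1 - a)) \<le> Nl k * (Nl (k - j) * (4 * (jap k powr (1 - a) * jap j powr a * gs k j)))"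
      using w by (intro mult_left_mono low_gs') auto
    also have "\<dots> = (Nl k * jap k powr (1 - a)) * (4 * (Nl (k - j) * h j * gs k j))"
      by (simp add: h_def mult_ac)
    finally show ?thesis by (simp only: Nl_inv mult_1_left mult_1_right)
  qed
  \<comment> \<open>Trades a factor \<open>h j\<close> at a high inner frequency for the small
    number \<open>\<kappa>\<close>. The factor is available because these terms are estimated with
    the solution bounds, which control more than the difference norm.\<close>
  have tail_j: "1 \<le> \<kappa> * h j" if "j \<in> Y - X" for j
  proof -
    have "int n \<le> \<bar>j\<bar>" using that by (auto simp: X_def)
    then have "jap j powr - a * jap j powr a \<le> \<kappa> * jap j powr a"
      unfolding \<kappa>_def by (intro mult_right_mono tail_ge) auto
    then show ?thesis by (simp add: h_def powr_minus)
  qed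
  have hM: "h k \<le> M k" "1 \<le> h k" for k
    using a_facts by (auto simp: h_def M_def mult_le_cancel_right1 intro!: ge_one_powr_ge_zero)
  have T1: "(\<Sum>k\<in>X. (h k)\<^sup>2 * (v k \<bullet> bil \<kappa>T u v X k)) \<le> 3 * 3 * G * (B * \<Delta> * \<Delta>)"
    unfolding \<kappa>T_def
  proof (rule bil_transport_le[OF X w(1,2) _ ur b(1) b\<Delta>(1)])
    fix k j
    have "\<bar>(h k)\<^sup>2 * dk j - (h j)\<^sup>2 * dk k\<bar> \<le> 3 * (jap (k - j) * h j * h k)"
      unfolding h_def by (rule commutator_powr) (auto simp: jap_tri dk_le dk_simp a_facts)
    also have "\<dots> \<le> 3 * ((M (k - j) * gs k j) * h j * h k)"
      using w gM by (intro mult_left_mono mult_right_mono) auto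
    finally show "\<bar>(h k)\<^sup>2 * dk j - (h j)\<^sup>2 * dk k\<bar> \<le> 3 * (M (k - j) * h j * h k * gs k j)"
      by (simp add: mult_ac)
  qed auto
  have T1t: "(\<Sum>k\<in>X. (h k)\<^sup>2 * (v k \<bullet> bil \<kappa>T u v (Y - X) k)) \<le> 3 * \<kappa> * G * (B * (2 * B) * (2 * B))"
  proof (rule bil_inner_le[OF X YX w(1) w(1) w(1) _ b(1,5,5)])
    fix k j assume "j \<in> Y - X"
    have "h k \<le> jap k" unfolding h_def
      using a_facts powr_mono[of a 1 "jap k"] by simp
    then have "h k * h k \<le> M k" unfolding M_def h_def by (intro mult_right_mono) auto
    moreover have "1 \<le> M (k - j) * gs k j" using gM[of k j] jap_ge1[of "k - j"] by linarith
    ultimately have "(h k * h k) * 1 \<le> M k * (M (k - j) * gs k j)"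
      using w by (intro mult_mono) auto
    then have hh: "(h k * h k) * jap j \<le> (M k * (M (k - j) * gs k j)) * jap j"
      by (intro mult_right_mono) auto
    have "\<bar>(h k)\<^sup>2\<bar> * cmod (\<kappa>T k j) \<le> (h k)\<^sup>2 * jap j"
      unfolding abs_power2 by (intro mult_left_mono cmod_\<kappa>T zero_le_power2)
    also have "\<dots> = 1 * ((h k * h k) * jap j)" by (simp add: power2_eq_square)
    also have "\<dots> \<le> (\<kappa> * h j) * ((M k * (M (k - j) * gs k j)) * jap j)"
      by (rule mult_mono[OF tail_j[OF \<open>j \<in> Y - X\<close>] hh]) (use w \<kappa> in auto)
    finally show "\<bar>(h k)\<^sup>2\<bar> * cmod (\<kappa>T k j) \<le> \<kappa> * (M (k - j) * M j * M k * gs k j)"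
      by (simp add: M_def h_def mult_ac)
  qed (use \<kappa> in auto)
  have P2: "(\<Sum>k\<in>X. (h k)\<^sup>2 * (v k \<bullet> bil \<kappa>P u v Y k)) \<le> 3 * 24 * G * (B * \<Delta> * \<Delta>)"
  proof (rule bil_inner_le[OF X Y(1) w(1,2,2) _ b(1) b\<Delta>(1) b\<Delta>(1)])
    fix k j
    have "\<bar>(h k)\<^sup>2\<bar> * cmod (\<kappa>P k j) \<le> (h k)\<^sup>2 * (6 * (jap (k - j) * jap j) / jap k)"
      unfolding abs_power2 by (intro mult_left_mono cmod_\<kappa>P zero_le_power2)
    also have "\<dots> = 6 * (jap (k - j) * jap j) * ((h k)\<^sup>2 / jap k)" by simp
    also have "\<dots> = 6 * (jap (k - j) * jap j) * h k * Nl k" by (simp add: h2)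
    also have "\<dots> \<le> 6 * (jap (k - j) * jap j) * h k * (4 * (h (k - j) * Nl j * gs k j))"
      using w by (intro mult_left_mono lowN) auto
    also have "\<dots> = 24 * ((jap (k - j) * h (k - j)) * (Nl j * jap j) * h k * gs k j)"
      by (simp add: mult_ac)
    also have "\<dots> = 24 * (M (k - j) * h j * h k * gs k j)"
      unfolding Nl_jap by (simp add: M_def h_def)
    finally show "\<bar>(h k)\<^sup>2\<bar> * cmod (\<kappa>P k j) \<le> 24 * (M (k - j) * h j * h k * gs k j)" .
  qed auto
  have P3: "(\<Sum>k\<in>X. (h k)\<^sup>2 * (v k \<bullet> bil (\<lambda>k j. \<kappa>T k j + \<kappa>P k j) v u' Y k)) \<le> 3 * 26 * G * (\<Delta> * B * \<Delta>)"
  proof (rule bil_inner_le[OF X Y(1) w(2,1,2) _ b\<Delta>(1) b(3) b\<Delta>(1)])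
    fix k j
    have "\<bar>(h k)\<^sup>2\<bar> * cmod (\<kappa>T k j + \<kappa>P k j) \<le> (h k)\<^sup>2 * (jap j + 6 * (jap (k - j) * jap j) / jap k)"
      unfolding abs_power2 by (intro mult_left_mono cmod_\<kappa>A zero_le_power2)
    also have "\<dots> = (h k * jap j) * h k + 6 * (jap (k - j) * jap j) * ((h k)\<^sup>2 / jap k)"
      by (simp add: distrib_left power2_eq_square)
    also have "\<dots> = (h k * jap j) * h k + 6 * (jap (k - j) * jap j) * h k * Nl k"
      by (simp add: h2)
    also have "\<dots> \<le> (h k * jap j) * (2 * (h (k - j) * h j * gs k j))
        + 6 * (jap (k - j) * jap j) * h k * (4 * (Nl (k - j) * h j * gs k j))"
      using w alg by (intro add_mono mult_left_mono lowN') (auto simp: h_def)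
    also have "\<dots> = 2 * (h (k - j) * (jap j * h j) * h k * gs k j)
        + 24 * ((Nl (k - j) * jap (k - j)) * (jap j * h j) * h k * gs k j)"
      by (simp add: mult_ac)
    also have "\<dots> = 26 * (h (k - j) * M j * h k * gs k j)"
      unfolding Nl_jap by (simp add: M_def h_def)
    finally show "\<bar>(h k)\<^sup>2\<bar> * cmod (\<kappa>T k j + \<kappa>P k j) \<le> 26 * (h (k - j) * M j * h k * gs k j)" .
  qed auto
  have kB: "\<bar>(h k)\<^sup>2\<bar> * cmod (\<kappa>B k j) \<le> h k * Nl k" for k j
  proof -
    have "\<bar>(h k)\<^sup>2\<bar> * cmod (\<kappa>B k j) \<le> (h k)\<^sup>2 * (1 / jap k)"
      unfolding abs_power2 by (intro mult_left_mono cmod_\<kappa>B zero_le_power2)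
    then show ?thesis by (simp add: h2)
  qed
  have P4: "(\<Sum>k\<in>X. (h k)\<^sup>2 * (v k \<bullet> bil \<kappa>B \<rho> \<eta> Y k)) \<le> 3 * 4 * G * (B * \<Delta> * \<Delta>)"
  proof (rule bil_inner_le[OF X Y(1) w(2,3,2) _ b(2) b\<Delta>(2) b\<Delta>(1)])
    fix k j
    have "\<bar>(h k)\<^sup>2\<bar> * cmod (\<kappa>B k j) \<le> h k * (4 * (h (k - j) * Nl j * gs k j))"
      using kB[of k j] mult_left_mono[OF lowN[of k j] w(2)[of k]] by linarith
    then show "\<bar>(h k)\<^sup>2\<bar> * cmod (\<kappa>B k j) \<le> 4 * (h (k - j) * Nl j * h k * gs k j)"
      by (simp add: mult_ac)
  qed auto
  have P5: "(\<Sum>k\<in>X. (h k)\<^sup>2 * (v k \<bullet> bil \<kappa>B \<eta> \<rho>' Y k)) \<le> 3 * 4 * G * (\<Delta> * B * \<Delta>)"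
  proof (rule bil_inner_le[OF X Y(1) w(3,2,2) _ b\<Delta>(2) b(4) b\<Delta>(1)])
    fix k j
    have "\<bar>(h k)\<^sup>2\<bar> * cmod (\<kappa>B k j) \<le> h k * (4 * (Nl (k - j) * h j * gs k j))"
      using kB[of k j] mult_left_mono[OF lowN'[of k j] w(2)[of k]] by linarith
    then show "\<bar>(h k)\<^sup>2\<bar> * cmod (\<kappa>B k j) \<le> 4 * (Nl (k - j) * h j * h k * gs k j)"
      by (simp add: mult_ac)
  qed auto
  have R1: "(\<Sum>k\<in>X. (Nl k)\<^sup>2 * (\<eta> k \<bullet> bil \<kappa>D u \<eta> X k)) \<le> 3 * 3 * G * (B * \<Delta> * \<Delta>)"
    unfolding \<kappa>D_def
  proof (rule bil_transport_le[OF X w(1,3) _ ur b(1) b\<Delta>(2)])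
    fix k j
    have "\<bar>(Nl k)\<^sup>2 * dk k - (Nl j)\<^sup>2 * dk j\<bar> \<le> 3 * (jap (k - j) * Nl j * Nl k)"
      unfolding Nl_def by (rule commutator_powr_neg) (use a_facts in \<open>auto simp: jap_tri dk_le dk_simp\<close>)
    also have "\<dots> \<le> 3 * ((M (k - j) * gs k j) * Nl j * Nl k)"
      using w gM by (intro mult_left_mono mult_right_mono) auto
    finally show "\<bar>(Nl k)\<^sup>2 * dk k - (Nl j)\<^sup>2 * dk j\<bar> \<le> 3 * (M (k - j) * Nl j * Nl k * gs k j)"
      by (simp add: mult_ac)
  qed auto
  have kD: "\<bar>(Nl k)\<^sup>2\<bar> * cmod (\<kappa>D k j) \<le> Nl k * h k" for k j
  proof -
    have "\<bar>(Nl k)\<^sup>2\<bar> * cmod (\<kappa>D k j) \<le> (Nl k)\<^sup>2 * jap k"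
      unfolding abs_power2 by (intro mult_left_mono cmod_\<kappa>D zero_le_power2)
    also have "\<dots> = Nl k * (Nl k * jap k)" by (simp add: power2_eq_square)
    finally show ?thesis by (simp only: Nl_jap)
  qed
  have R1t: "(\<Sum>k\<in>X. (Nl k)\<^sup>2 * (\<eta> k \<bullet> bil \<kappa>D u \<eta> (Y - X) k)) \<le> 3 * \<kappa> * G * (B * (2 * B) * (2 * B))"
  proof (rule bil_inner_le[OF X YX w(1,2,2) _ b(1,6,6)])
    fix k j assume "j \<in> Y - X"
    have "Nl k \<le> 1" unfolding Nl_def
      using a_facts powr_mono[of "- (1 - a)" 0 "jap k"] by simp
    then have "Nl k * h k \<le> 1 * h k" using w by (intro mult_right_mono) auto
    then have "Nl k * h k \<le> 1 * (1 * h k)" by simp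
    also have "\<dots> \<le> (\<kappa> * h j) * ((M (k - j) * gs k j) * h k)"
    proof (rule mult_mono[OF tail_j[OF \<open>j \<in> Y - X\<close>] mult_right_mono])
      show "1 \<le> M (k - j) * gs k j" using gM[of k j] jap_ge1[of "k - j"] by linarith
    qed (use w \<kappa> in auto)
    finally show "\<bar>(Nl k)\<^sup>2\<bar> * cmod (\<kappa>D k j) \<le> \<kappa> * (M (k - j) * h j * h k * gs k j)"
      using kD[of k j] by (simp add: mult_ac)
  qed (use \<kappa> in auto)
  have R2: "(\<Sum>k\<in>X. (Nl k)\<^sup>2 * (\<eta> k \<bullet> bil \<kappa>D v \<rho>' Y k)) \<le> 3 * 2 * G * (\<Delta> * B * \<Delta>)"
  proof (rule bil_inner_le[OF X Y(1) w(2,2,3) _ b\<Delta>(1) b(4) b\<Delta>(2)])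
    fix k j
    have "Nl k * h k \<le> Nl k * (2 * (h (k - j) * h j * gs k j))"
      using w alg by (intro mult_left_mono) (auto simp: h_def)
    then show "\<bar>(Nl k)\<^sup>2\<bar> * cmod (\<kappa>D k j) \<le> 2 * (h (k - j) * h j * Nl k * gs k j)"
      using kD[of k j] by (simp add: mult_ac)
  qed auto
  have "(\<Sum>i\<in>S n. (wl i)\<^sup>2 * ((z i - z' i) \<bullet> (FY Y z i - FY Y z' i)))
      = (\<Sum>k\<in>X. (h k)\<^sup>2 * (v k \<bullet> (FY Y z (k, True) - FY Y z' (k, True))))
        + (\<Sum>k\<in>X. (Nl k)\<^sup>2 * (\<eta> k \<bullet> (FY Y z (k, False) - FY Y z' (k, False))))"
    unfolding S_def X_def[symmetric] sum_times_bool by (simp add: wl_def h_def Nl_def v_def \<eta>_def)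
  also have "(\<Sum>k\<in>X. (h k)\<^sup>2 * (v k \<bullet> (FY Y z (k, True) - FY Y z' (k, True))))
      = (\<Sum>k\<in>X. (h k)\<^sup>2 * (v k \<bullet> bil \<kappa>T u v X k)) + (\<Sum>k\<in>X. (h k)\<^sup>2 * (v k \<bullet> bil \<kappa>T u v (Y - X) k))
        + (\<Sum>k\<in>X. (h k)\<^sup>2 * (v k \<bullet> bil \<kappa>P u v Y k))
        + (\<Sum>k\<in>X. (h k)\<^sup>2 * (v k \<bullet> bil (\<lambda>k j. \<kappa>T k j + \<kappa>P k j) v u' Y k))
        + (\<Sum>k\<in>X. (h k)\<^sup>2 * (v k \<bullet> bil \<kappa>B \<rho> \<eta> Y k)) + (\<Sum>k\<in>X. (h k)\<^sup>2 * (v k \<bullet> bil \<kappa>B \<eta> \<rho>' Y k))"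
    unfolding sum.distrib[symmetric]
  proof (intro sum.cong refl)
    fix k
    have "FY Y z (k, True) - FY Y z' (k, True) = bil \<kappa>T u v X k + bil \<kappa>T u v (Y - X) k + bil \<kappa>P u v Y k
        + bil (\<lambda>k j. \<kappa>T k j + \<kappa>P k j) v u' Y k + bil \<kappa>B \<rho> \<eta> Y k + bil \<kappa>B \<eta> \<rho>' Y k
        + \<i> * of_real (\<gamma>1 * dk k) * v k"
      unfolding FY_diff_True u_def[symmetric] \<rho>_def[symmetric] u'_def[symmetric] \<rho>'_def[symmetric] v_def[symmetric] \<eta>_def[symmetric]
      using bil_add_kernel[of \<kappa>T \<kappa>P u v Y k] bil_split[OF Y(1), of X \<kappa>T u v k] Y(2) by (simp add: X_def v_def)
    then show "(h k)\<^sup>2 * (v k \<bullet> (FY Y z (k, True) - FY Y z' (k, True)))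
        = (h k)\<^sup>2 * (v k \<bullet> bil \<kappa>T u v X k) + (h k)\<^sup>2 * (v k \<bullet> bil \<kappa>T u v (Y - X) k)
        + (h k)\<^sup>2 * (v k \<bullet> bil \<kappa>P u v Y k)
        + (h k)\<^sup>2 * (v k \<bullet> bil (\<lambda>k j. \<kappa>T k j + \<kappa>P k j) v u' Y k)
        + (h k)\<^sup>2 * (v k \<bullet> bil \<kappa>B \<rho> \<eta> Y k) + (h k)\<^sup>2 * (v k \<bullet> bil \<kappa>B \<eta> \<rho>' Y k)"
      by (simp only: inner_add_right distrib_left inner_imaginary_multiple mult_zero_right add_0_right)
  qed
  also have "(\<Sum>k\<in>X. (Nl k)\<^sup>2 * (\<eta> k \<bullet> (FY Y z (k, False) - FY Y z' (k, False))))
      = (\<Sum>k\<in>X. (Nl k)\<^sup>2 * (\<eta> k \<bullet> bil \<kappa>D u \<eta> X k)) + (\<Sum>k\<in>X. (Nl k)\<^sup>2 * (\<eta> k \<bullet> bil \<kappa>D u \<eta> (Y - X) k))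
        + (\<Sum>k\<in>X. (Nl k)\<^sup>2 * (\<eta> k \<bullet> bil \<kappa>D v \<rho>' Y k))"
    unfolding sum.distrib[symmetric]
  proof (intro sum.cong refl)
    fix k
    have "FY Y z (k, False) - FY Y z' (k, False) = bil \<kappa>D u \<eta> X k + bil \<kappa>D u \<eta> (Y - X) k
        + bil \<kappa>D v \<rho>' Y k + \<i> * of_real (2 * \<gamma>2 * dk k) * \<eta> k"
      unfolding FY_diff_False u_def[symmetric] \<rho>_def[symmetric] u'_def[symmetric] \<rho>'_def[symmetric] v_def[symmetric] \<eta>_def[symmetric]
      using bil_split[OF Y(1), of X \<kappa>D u \<eta> k] Y(2) by (simp add: X_def \<eta>_def)
    then show "(Nl k)\<^sup>2 * (\<eta> k \<bullet> (FY Y z (k, False) - FY Y z' (k, False)))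
        = (Nl k)\<^sup>2 * (\<eta> k \<bullet> bil \<kappa>D u \<eta> X k) + (Nl k)\<^sup>2 * (\<eta> k \<bullet> bil \<kappa>D u \<eta> (Y - X) k)
        + (Nl k)\<^sup>2 * (\<eta> k \<bullet> bil \<kappa>D v \<rho>' Y k)"
      by (simp only: inner_add_right distrib_left inner_imaginary_multiple mult_zero_right add_0_right)
  qed
  finally have "(\<Sum>i\<in>S n. (wl i)\<^sup>2 * ((z i - z' i) \<bullet> (FY Y z i - FY Y z' i)))
      \<le> 3 * 3 * G * (B * \<Delta> * \<Delta>) + 3 * \<kappa> * G * (B * (2 * B) * (2 * B)) + 3 * 24 * G * (B * \<Delta> * \<Delta>)
        + 3 * 26 * G * (\<Delta> * B * \<Delta>) + 3 * 4 * G * (B * \<Delta> * \<Delta>) + 3 * 4 * G * (\<Delta> * B * \<Delta>)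
        + (3 * 3 * G * (B * \<Delta> * \<Delta>) + 3 * \<kappa> * G * (B * (2 * B) * (2 * B)) + 3 * 2 * G * (\<Delta> * B * \<Delta>))"
    using T1 T1t P2 P3 P4 P5 R1 R1t R2 by linarith
  also have "\<dots> = 198 * G * B * (\<Delta> * \<Delta>) + 24 * G * \<kappa> * B ^ 3"
    by (simp add: power3_eq_cube algebra_simps)
  also have "\<dots> = 198 * G * B * D + G * B ^ 3 * (792 * \<kappa>\<^sup>2 + 24 * \<kappa>)"
    unfolding \<Delta>2 by (simp add: power2_eq_square power3_eq_cube algebra_simps)
  also have "\<dots> \<le> 198 * G * B * D + G * B ^ 3 * (816 * \<kappa>)"
  proof -
    have "\<kappa>\<^sup>2 \<le> \<kappa>" using \<kappa> mult_left_mono[of \<kappa> 1 \<kappa>] by (simp add: power2_eq_square)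
    then have "792 * \<kappa>\<^sup>2 + 24 * \<kappa> \<le> 816 * \<kappa>" by linarith
    then show ?thesis
      using B G_nonneg by (intro add_left_mono mult_left_mono) auto
  qed
  also have "\<dots> \<le> CD B * (D + \<kappa>)"
  proof -
    have "0 \<le> 198 * G * B * \<kappa>" "0 \<le> 816 * G * B ^ 3 * D"
      using B G_nonneg \<kappa> D0 by auto
    then show ?thesis by (simp add: CD_def algebra_simps)
  qed
  finally show ?thesis by (simp add: D_def \<kappa>_def)
qed

subsection \<open>Passage to infinite sums\<close>

text \<open>Majorants uniform over the ball. Each coefficient decays like
  \<open>jap powr - a\<close>; the triangle inequality
  \<open>jap j \<le> 2 * jap k * jap (k - j)\<close> moves the decay from k - j to j at the price of
  a factor depending on k, and the resulting exponent \<open>- 2 * a\<close> is summable.\<close>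

lemma product_bounds:
  assumes "wnorm_le w0 z B"
  defines "q \<equiv> \<lambda>k j. 2 * jap k * B\<^sup>2 * jap j powr (- 2 * a)"
  shows "jap (k - j) * jap j * (cmod (z (k - j, True)) * cmod (z (j, True))) \<le> q k j"
    and "cmod (z (k - j, False)) * cmod (z (j, False)) \<le> q k j"
    and "jap (k - j) * (cmod (z (k - j, True)) * cmod (z (j, False))) \<le> q k j"
proof -
  define x y d where "x = jap k" and "y = jap j" and "d = jap (k - j)"
  define U V P Q where "U = cmod (z (k - j, True))" and "V = cmod (z (j, True))"
    and "P = cmod (z (k - j, False))" and "Q = cmod (z (j, False))"
  have xyd: "1 \<le> x" "1 \<le> y" "1 \<le> d" by (auto simp: x_def y_def d_def)
  have B: "0 \<le> B" by (rule wnorm_le_nonneg[OF assms(1)])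
  have wpos: "0 \<le> w0 i" for i by (simp add: w0_def pw_def)
  have mono\<sigma>: "jap l powr a \<le> jap l powr \<sigma>" for l using a_facts by (intro powr_mono) auto
  have cT: "jap l * cmod (z (l, True)) \<le> B * jap l powr - a" for l
  proof -
    have "jap l powr a * (jap l * cmod (z (l, True))) \<le> jap l powr \<sigma> * (jap l * cmod (z (l, True)))"
      by (intro mult_right_mono mono\<sigma>) auto
    also have "\<dots> \<le> B"
      using wnorm_le_coord[OF assms(1) wpos, of "(l, True)"] by (simp add: w0_def mult_ac)
    finally show ?thesis by (simp add: powr_minus field_simps)
  qed
  have cF: "cmod (z (l, False)) \<le> B * jap l powr - a" for l
  proof -
    have "jap l powr a * cmod (z (l, False)) \<le> jap l powr \<sigma> * cmod (z (l, False))"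
      by (intro mult_right_mono mono\<sigma>) auto
    also have "\<dots> \<le> B"
      using wnorm_le_coord[OF assms(1) wpos, of "(l, False)"] by (simp add: w0_def)
    finally show ?thesis by (simp add: powr_minus field_simps)
  qed
  define r where "r = B\<^sup>2 * (d powr - a * y powr - a)"
  have "(d * U) * (y * V) \<le> (B * d powr - a) * (B * y powr - a)"
    unfolding d_def y_def U_def V_def using B by (intro mult_mono[OF cT cT]) auto
  then have UV: "(d * y) * (U * V) \<le> r" by (simp add: r_def power2_eq_square mult_ac)
  have "P * Q \<le> (B * d powr - a) * (B * y powr - a)"
    unfolding d_def y_def P_def Q_def using B by (intro mult_mono[OF cF cF]) auto
  then have PQ: "P * Q \<le> r" by (simp add: r_def power2_eq_square mult_ac)
  have "(d * U) * Q \<le> (B * d powr - a) * (B * y powr - a)"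
    unfolding d_def y_def U_def Q_def using B by (intro mult_mono[OF cT cF]) auto
  then have UQ: "d * (U * Q) \<le> r" by (simp add: r_def power2_eq_square mult_ac)
  have "y \<le> x + d" using jap_triangle[of j k] by (simp add: x_def y_def d_def jap_minus_commute)
  also have "\<dots> \<le> 2 * x * d"
  proof -
    have "x * 1 \<le> x * d" "1 * d \<le> x * d" using xyd by (intro mult_mono; simp)+
    then show ?thesis by linarith
  qed
  finally have "y powr a \<le> (2 * x * d) powr a" using xyd a_facts by (intro powr_mono2) auto
  also have "\<dots> = (2 * x) powr a * d powr a" using xyd by (simp add: powr_mult)
  also have "(2 * x) powr a \<le> (2 * x) powr 1" using xyd a_facts by (intro powr_mono) auto
  then have "(2 * x) powr a * d powr a \<le> (2 * x) * d powr a" using xyd by (intro mult_right_mono) auto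
  finally have "y powr a * (d powr - a * y powr - a) \<le> (2 * x) * d powr a * (d powr - a * y powr - a)"
    by (intro mult_right_mono) auto
  then have "d powr - a \<le> 2 * x * y powr - a"
    using xyd by (simp add: powr_minus field_simps)
  then have "r \<le> B\<^sup>2 * ((2 * x * y powr - a) * y powr - a)"
    unfolding r_def by (intro mult_left_mono mult_right_mono) auto
  also have "\<dots> = 2 * x * B\<^sup>2 * y powr (- 2 * a)"
    using xyd by (simp add: mult_ac powr_add[symmetric])
  finally have rb: "r \<le> 2 * x * B\<^sup>2 * y powr (- 2 * a)" .
  then have rb: "r \<le> q k j" by (simp add: q_def x_def y_def)
  show "jap (k - j) * jap j * (cmod (z (k - j, True)) * cmod (z (j, True))) \<le> q k j"
    using UV rb by (simp add: d_def y_def U_def V_def)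
  show "cmod (z (k - j, False)) * cmod (z (j, False)) \<le> q k j"
    using PQ rb by (simp add: P_def Q_def)
  show "jap (k - j) * (cmod (z (k - j, True)) * cmod (z (j, False))) \<le> q k j"
    using UQ rb by (simp add: d_def U_def Q_def)
qed

lemma H_bound:
  assumes "wnorm_le w0 z B"
  shows "cmod (H z i j) \<le> 16 * (jap (fst i))\<^sup>2 * B\<^sup>2 * jap j powr (- 2 * a)"
proof -
  obtain k c where i: "i = (k, c)" by (cases i)
  define q where "q = 2 * jap k * B\<^sup>2 * jap j powr (- 2 * a)"
  define U V P Q where "U = cmod (z (k - j, True))" and "V = cmod (z (j, True))"
    and "P = cmod (z (k - j, False))" and "Q = cmod (z (j, False))"
  have nn: "0 \<le> U" "0 \<le> V" "0 \<le> P" "0 \<le> Q" by (auto simp: U_def V_def P_def Q_def)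
  note pb = product_bounds[OF assms, of k j, folded q_def U_def V_def P_def Q_def]
  have q0: "0 \<le> q" by (simp add: q_def)
  have "cmod (H z i j) \<le> 8 * (jap k * q)"
  proof (cases c)
    case True
    have eq: "H z i j = (\<kappa>T k j + \<kappa>P k j) * z (k - j, True) * z (j, True) + \<kappa>B k j * z (k - j, False) * z (j, False)"
      using True by (simp add: H_def i)
    have "cmod (H z i j) \<le> cmod (\<kappa>T k j + \<kappa>P k j) * U * V + cmod (\<kappa>B k j) * P * Q"
      unfolding eq by (rule order_trans[OF norm_triangle_ineq]) (simp add: norm_mult U_def V_def P_def Q_def)
    also have "\<dots> \<le> 7 * (jap (k - j) * jap j) * U * V + 1 * P * Q"
    proof (intro add_mono mult_right_mono nn cmod_\<kappa>A')
      show "cmod (\<kappa>B k j) \<le> 1" using cmod_\<kappa>B[of k j] by (rule order_trans) simp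
    qed
    also have "\<dots> = 7 * (jap (k - j) * jap j * (U * V)) + P * Q" by simp
    also have "\<dots> \<le> 8 * q" using pb by linarith
    also have "\<dots> \<le> 8 * (jap k * q)" using q0 mult_right_mono[of 1 "jap k" q] by simp
    finally show ?thesis .
  next
    case False
    have "U * Q \<le> jap (k - j) * (U * Q)" using nn mult_right_mono[of 1 "jap (k - j)" "U * Q"] by simp
    then have UQ: "U * Q \<le> q" using pb by linarith
    have "cmod (H z i j) = cmod (\<kappa>D k j) * (U * Q)"
      unfolding H_def i using False by (simp add: norm_mult U_def Q_def)
    also have "\<dots> \<le> jap k * q"
      using UQ nn by (intro mult_mono[OF cmod_\<kappa>D]) auto
    finally have "cmod (H z i j) \<le> jap k * q" .
    moreover have "0 \<le> jap k * q" using q0 by (intro mult_nonneg_nonneg) auto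
    ultimately show ?thesis by linarith
  qed
  then show ?thesis
    by (simp add: i q_def power2_eq_square mult_ac)
qed

lemma H_dominating_summable: "(\<lambda>j. 16 * (jap (fst i))\<^sup>2 * B\<^sup>2 * jap j powr (- 2 * a)) summable_on UNIV"
  using jap_powr_L2_bound[OF a_facts(1)] by (metis summable_on_cmult_right)

lemma H_summable:
  assumes "wnorm_le w0 z B"
  shows "H z i summable_on UNIV"
proof (rule abs_summable_summable)
  show "(\<lambda>j. norm (H z i j)) summable_on UNIV"
    by (rule summable_on_comparison_test[OF H_dominating_summable H_bound[OF assms]]) simp
qed

lemma FY_tendsto:
  assumes "wnorm_le w0 z B"
  shows "((\<lambda>Y. FY Y z i) \<longlongrightarrow> F z i) (finite_subsets_at_top UNIV)"
  unfolding FY_def F_def by (intro tendsto_intros infsum_tendsto H_summable[OF assms])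

text \<open>The infinite convolution commutes with coordinatewise limits because its partial sums
  converge uniformly on the ball, by the Weierstrass test with the majorant of
  \<open>H_bound\<close>. Coordinatewise convergence with a norm bound is what compactness
  provides.\<close>

lemma F_continuous:
  assumes "G' \<noteq> bot" "\<And>i. ((\<lambda>x. f x i) \<longlongrightarrow> z i) G'" "eventually (\<lambda>x. wnorm_le w0 (f x) B) G'"
  shows "((\<lambda>x. F (f x) i) \<longlongrightarrow> F z i) G'"
proof -
  have zB: "wnorm_le w0 z B" by (rule wnorm_le_limit[OF assms])
  have H_lim: "((\<lambda>x. H (f x) i j) \<longlongrightarrow> H z i j) G'" for j
    unfolding H_def Let_def by (cases "snd i") (auto intro!: tendsto_intros assms(2))
  have "((\<lambda>x. \<Sum>\<^sub>\<infinity>j. H (f x) i j) \<longlongrightarrow> (\<Sum>\<^sub>\<infinity>j. H z i j)) G'"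
  proof (rule swap_uniform_limit'[where F = "finite_subsets_at_top UNIV" and S = "{x. wnorm_le w0 (f x) B}"
        and f = "\<lambda>Y x. \<Sum>j\<in>Y. H (f x) i j" and g = "\<lambda>Y. \<Sum>j\<in>Y. H z i j"])
    show "\<forall>\<^sub>F Y in finite_subsets_at_top UNIV. ((\<lambda>x. \<Sum>j\<in>Y. H (f x) i j) \<longlongrightarrow> (\<Sum>j\<in>Y. H z i j)) G'"
      by (intro always_eventually allI tendsto_sum H_lim)
    show "(sum (H z i) \<longlongrightarrow> (\<Sum>\<^sub>\<infinity>j. H z i j)) (finite_subsets_at_top UNIV)"
      by (intro infsum_tendsto H_summable[OF zB])
    show "uniform_limit {x. wnorm_le w0 (f x) B} (\<lambda>Y x. \<Sum>j\<in>Y. H (f x) i j) (\<lambda>x. \<Sum>\<^sub>\<infinity>j. H (f x) i j)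
        (finite_subsets_at_top UNIV)"
      by (rule Weierstrass_m_test_general[OF _ H_dominating_summable[of i B]]) (rule H_bound, simp)
  qed (use assms in auto)
  then show ?thesis
    unfolding F_def by (intro tendsto_intros assms(2))
qed

lemma F_in_Sy:
  assumes "z \<in> Sy"
  shows "F z \<in> Sy"
  unfolding Sy_def
proof (intro CollectI allI)
  fix k b
  have pk: "pk (- k) = cnj (pk k)" for k
    by (simp add: pk_def kdelta_def)
  have dk: "dk (- k) = - dk k" for k by (simp add: dk_def)
  have zc: "z (- l, c) = cnj (z (l, c))" for l c by (rule SyD[OF assms])
  have zc': "z (- k - - j, c) = cnj (z (k - j, c))" for j c
    using zc[of "k - j" c] by simp
  have H: "H z (- k, b) (- j) = cnj (H z (k, b) j)" for j
  proof -
    have "dk (- k - - j) = - dk (k - j)" using dk[of "k - j"] by simp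
    then have P: "\<kappa>P (- k) (- j) = cnj (\<kappa>P k j)"
      unfolding \<kappa>P_def by (simp add: pk dk)
    have T: "\<kappa>T (- k) (- j) = cnj (\<kappa>T k j)" "\<kappa>B (- k) (- j) = cnj (\<kappa>B k j)" "\<kappa>D (- k) (- j) = cnj (\<kappa>D k j)"
      unfolding \<kappa>T_def \<kappa>B_def \<kappa>D_def by (simp_all add: pk dk)
    show ?thesis
      unfolding H_def Let_def fst_conv snd_conv P T zc' zc[of j] by simp
  qed
  have "(\<Sum>\<^sub>\<infinity>j. H z (- k, b) j) = (\<Sum>\<^sub>\<infinity>j. H z (- k, b) (- j))"
    by (rule infsum_reindex_bij_betw[symmetric]) (rule bij_uminus)
  also have "\<dots> = cnj (\<Sum>\<^sub>\<infinity>j. H z (k, b) j)"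
    unfolding H by (rule infsum_cnj)
  finally have "(\<Sum>\<^sub>\<infinity>j. H z (- k, b) j) = cnj (\<Sum>\<^sub>\<infinity>j. H z (k, b) j)" .
  moreover have "lin (- k, b) = cnj (lin (k, b))" by (simp add: lin_def dk)
  ultimately show "F z (- k, b) = cnj (F z (k, b))"
    by (simp add: F_def zc)
qed

section \<open>Verification of the abstract hypotheses\<close>

lemma fw_bounds:
  assumes "0 \<le> A" "1 \<le> x"
  shows "x powr \<sigma> \<le> fw A N x" "fw A N x \<le> (1 + A) * x powr \<sigma>"
proof -
  have "1 * x powr \<sigma> \<le> (1 + A * min 1 (x / (real N + 1))) * x powr \<sigma>"
    using assms by (intro mult_right_mono) auto
  then show "x powr \<sigma> \<le> fw A N x" by (simp add: fw_def mult.commute)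
  have "A * min 1 (x / (real N + 1)) \<le> A * 1"
    using assms by (intro mult_left_mono) auto
  then have "(1 + A * min 1 (x / (real N + 1))) * x powr \<sigma> \<le> (1 + A) * x powr \<sigma>"
    by (intro mult_right_mono) auto
  then show "fw A N x \<le> (1 + A) * x powr \<sigma>" by (simp add: fw_def mult.commute)
qed

lemma fw_lim: "(\<lambda>N. fw A N x) \<longlonglongrightarrow> x powr \<sigma>"
proof -
  have "(\<lambda>N. inverse (real (Suc N))) \<longlonglongrightarrow> 0" by (rule LIMSEQ_inverse_real_of_nat)
  then have "(\<lambda>N. x * inverse (real (Suc N))) \<longlonglongrightarrow> x * 0" by (intro tendsto_intros)
  then have "(\<lambda>N. x / (real N + 1)) \<longlonglongrightarrow> 0" by (simp add: divide_inverse add.commute)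
  then have "(\<lambda>N. x powr \<sigma> * (1 + A * min 1 (x / (real N + 1)))) \<longlonglongrightarrow> x powr \<sigma> * (1 + A * min 1 0)"
    by (intro tendsto_intros)
  then show ?thesis by (simp add: fw_def)
qed

lemma one_le_powr_\<sigma>: "1 \<le> jap k powr \<sigma>"
  using \<sigma>_pos by (intro ge_one_powr_ge_zero) auto

lemma powr_\<sigma>_le_w: "jap k powr \<sigma> \<le> jap k * jap k powr \<sigma>"
  by (simp add: mult_le_cancel_right1)

lemma F_lipschitz:
  assumes z: "wnorm_le w0 z B" "wnorm_le w0 z' B" and d: "wnorm_le w0 (\<lambda>i. z i - z' i) d"
  shows "wnorm_le w1 (\<lambda>i. F z i - F z' i) (CL B * d)"
proof (rule wnorm_le_limit[where G = "finite_subsets_at_top UNIV"])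
  show "((\<lambda>Y. FY Y z i - FY Y z' i) \<longlongrightarrow> F z i - F z' i) (finite_subsets_at_top UNIV)" for i
    by (intro tendsto_intros FY_tendsto[OF z(1)] FY_tendsto[OF z(2)])
  show "\<forall>\<^sub>F Y in finite_subsets_at_top UNIV. wnorm_le w1 (\<lambda>i. FY Y z i - FY Y z' i) (CL B * d)"
    by (rule eventually_finite_subsets_at_top_weakI) (rule FY_lip[OF _ z d])
qed simp

text \<open>For z supported in \<open>S n\<close> the convolution is a finite sum whose inner
  frequencies run over the same set as the outer ones, as in \<open>FY_energy\<close>.\<close>

lemma F_energy_le:
  assumes z: "z \<in> Sy" and A: "0 \<le> A" and B: "wnorm_le (wf A N) z B" and supp: "\<And>i. i \<notin> S n \<Longrightarrow> z i = 0"
  shows "(\<Sum>i\<in>S n. (wf A N i)\<^sup>2 * (z i \<bullet> F z i)) \<le> C0 * B ^ 3"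
proof -
  define X where "X = {- int n..int n}"
  have X: "finite X" by (simp add: X_def)
  have H0: "H z i j = 0" if "j \<notin> X" for i j
    using supp[of "(j, True)"] supp[of "(j, False)"] that by (simp add: H_def S_def X_def Let_def)
  have "F z i = FY X z i" for i
  proof -
    have "(\<Sum>\<^sub>\<infinity>j. H z i j) = (\<Sum>\<^sub>\<infinity>j\<in>X. H z i j)"
      by (rule infsum_cong_neutral) (use H0 in auto)
    then show ?thesis using X by (simp add: F_def FY_def)
  qed
  then show ?thesis
    using FY_energy[OF z A B X] by (simp add: S_def X_def)
qed

lemma F_diff_le:
  assumes "z \<in> Sy" and z: "wnorm_le w0 z B" "wnorm_le w0 z' B"
  shows "(\<Sum>i\<in>S n. (wl i)\<^sup>2 * ((z i - z' i) \<bullet> (F z i - F z' i)))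
    \<le> CD B * ((\<Sum>i\<in>S n. (wl i * cmod (z i - z' i))\<^sup>2) + tail n)"
proof (rule tendsto_upperbound[where F = "finite_subsets_at_top UNIV"])
  show "((\<lambda>Y. \<Sum>i\<in>S n. (wl i)\<^sup>2 * ((z i - z' i) \<bullet> (FY Y z i - FY Y z' i)))
      \<longlongrightarrow> (\<Sum>i\<in>S n. (wl i)\<^sup>2 * ((z i - z' i) \<bullet> (F z i - F z' i)))) (finite_subsets_at_top UNIV)"
    by (intro tendsto_intros FY_tendsto[OF z(1)] FY_tendsto[OF z(2)])
  show "\<forall>\<^sub>F Y in finite_subsets_at_top UNIV. (\<Sum>i\<in>S n. (wl i)\<^sup>2 * ((z i - z' i) \<bullet> (FY Y z i - FY Y z' i)))
      \<le> CD B * ((\<Sum>i\<in>S n. (wl i * cmod (z i - z' i))\<^sup>2) + tail n)"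
    unfolding eventually_finite_subsets_at_top
    by (intro exI[of _ "{- int n..int n}"] conjI allI impI FY_diff_le[OF assms]) auto
qed simp

sublocale energy_system S Sy F w0 w1 wl wf C0 CL CD tail
proof
  fix A B d :: real and N n :: nat and i :: "int \<times> bool" and z z' :: "int \<times> bool \<Rightarrow> complex" and h :: real
  obtain k c where i: "i = (k, c)" by (cases i)
  show "finite (S n)" by (simp add: S_def)
  show "\<forall>\<^sub>F n in sequentially. i \<in> S n"
    unfolding eventually_sequentially by (intro exI[of _ "nat \<bar>k\<bar>"]) (auto simp: S_def i)
  show "(\<lambda>_. 0) \<in> Sy" by (simp add: Sy_def)
  show "z \<in> Sy \<Longrightarrow> z' \<in> Sy \<Longrightarrow> (\<lambda>i. z i + of_real h * z' i) \<in> Sy" by (simp add: Sy_def)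
  show "z \<in> Sy \<Longrightarrow> (\<lambda>i. if i \<in> S n then z i else 0) \<in> Sy" by (auto simp: Sy_def S_def)
  show "z \<in> Sy" if "G' \<noteq> bot" "\<And>i. ((\<lambda>x. f' x i) \<longlongrightarrow> z i) G'" "\<forall>\<^sub>F x in G'. f' x \<in> Sy"
    for G' :: "nat filter" and f'
    unfolding Sy_def
  proof (intro CollectI allI)
    fix k b
    have "((\<lambda>x. cnj (f' x (k, b))) \<longlongrightarrow> cnj (z (k, b))) G'"
      by (intro tendsto_intros that)
    moreover have "\<forall>\<^sub>F x in G'. cnj (f' x (k, b)) = f' x (- k, b)"
      using that(3) by (rule eventually_mono) (simp add: Sy_def)
    ultimately have "((\<lambda>x. f' x (- k, b)) \<longlongrightarrow> cnj (z (k, b))) G'"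
      by (rule Lim_transform_eventually)
    then show "z (- k, b) = cnj (z (k, b))"
      using tendsto_unique[OF that(1) that(2)] by blast
  qed
  show "z \<in> Sy \<Longrightarrow> F z \<in> Sy" by (rule F_in_Sy)
  have s1: "1 \<le> jap k powr \<sigma>" by (rule one_le_powr_\<sigma>)
  show "1 \<le> w0 i"
    using s1 order_trans[OF s1 powr_\<sigma>_le_w] by (cases c) (simp_all add: w0_def i)
  show "0 < w1 i" "0 < wl i"
    by (cases c; simp add: w1_def wl_def i)+
  have as: "jap k powr a \<le> jap k powr \<sigma>" using a_facts by (intro powr_mono) auto
  have neg: "jap k powr - (1 - a) \<le> 1"
    using a_facts powr_mono[of "- (1 - a)" 0 "jap k"] by simp
  show "wl i \<le> w0 i"
  proof (cases c)
    case True
    then show ?thesis using order_trans[OF as powr_\<sigma>_le_w] by (simp add: wl_def w0_def i)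
  next
    case False
    then show ?thesis using order_trans[OF neg s1] by (simp add: wl_def w0_def i)
  qed
  show "w0 i \<le> wf A N i" if "0 \<le> A"
    using fw_bounds(1)[OF that, of "jap k" N] by (cases c) (auto simp: w0_def wf_def i intro!: mult_left_mono)
  show "wf A N i \<le> (1 + A) * w0 i" if "0 \<le> A"
    using fw_bounds(2)[OF that, of "jap k" N] mult_left_mono[of "fw A N (jap k)" "(1 + A) * jap k powr \<sigma>" "jap k"]
    by (cases c) (auto simp: w0_def wf_def i mult.left_commute)
  show "finite {i. wf A N i < (1 + A) * w0 i}"
  proof (rule finite_subset)
    \<comment> \<open>The minimum in \<open>fw\<close> is saturated from
      \<open>jap k = N + 1\<close> on, where the weight equals \<open>(1 + A) * w0\<close>.\<close>
    show "{i. wf A N i < (1 + A) * w0 i} \<subseteq> {k. jap k < real N + 1} \<times> UNIV"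
    proof
      fix i assume *: "i \<in> {i. wf A N i < (1 + A) * w0 i}"
      obtain k c where i: "i = (k, c)" by (cases i)
      have "jap k < real N + 1"
      proof (rule ccontr)
        assume "\<not> jap k < real N + 1"
        then have "min 1 (jap k / (real N + 1)) = 1" by simp
        then have "fw A N (jap k) = (1 + A) * jap k powr \<sigma>" by (simp add: fw_def)
        then show False using * by (cases c) (auto simp: i wf_def w0_def)
      qed
      then show "i \<in> {k. jap k < real N + 1} \<times> UNIV" by (simp add: i)
    qed
  qed (simp add: finite_jap_less)
  show "(\<lambda>N. wf A N i) \<longlonglongrightarrow> w0 i"
    by (cases c) (simp_all add: i wf_def w0_def fw_lim tendsto_mult_left)
  show "0 \<le> C0" unfolding C0_def using G_nonneg by (intro mult_nonneg_nonneg) auto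
  show "0 \<le> CL B" unfolding CL_def using G_nonneg by (intro add_nonneg_nonneg mult_nonneg_nonneg) auto
  show "0 \<le> tail n" by (rule tail_bounds)
  show "tail \<longlonglongrightarrow> 0" by (rule tail_lim)
  show "F (\<lambda>_. 0) = (\<lambda>_. 0)" proof
    fix i :: "int \<times> bool"
    have "H (\<lambda>_. 0) i j = 0" for j by (cases "snd i") (simp_all add: H_def Let_def)
    then show "F (\<lambda>_. 0) i = 0" by (simp add: F_def)
  qed
  show "wnorm_le w0 z B \<Longrightarrow> wnorm_le w0 z' B \<Longrightarrow> wnorm_le w0 (\<lambda>i. z i - z' i) d \<Longrightarrow>
      wnorm_le w1 (\<lambda>i. F z i - F z' i) (CL B * d)"
    by (rule F_lipschitz)
  show "((\<lambda>x. F (f x) i) \<longlongrightarrow> F z i) G'"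
    if "G' \<noteq> bot" "\<And>i. ((\<lambda>x. f x i) \<longlongrightarrow> z i) G'" "\<forall>\<^sub>F x in G'. f x \<in> Sy \<and> wnorm_le w0 (f x) B"
    for G' :: "(nat \<times> real) filter" and f
    by (rule F_continuous[OF that(1,2)]) (use that(3) in \<open>auto elim: eventually_mono\<close>)
  show "(\<Sum>i\<in>S n. (wf A N i)\<^sup>2 * (z i \<bullet> F z i)) \<le> C0 * B ^ 3"
    if "z \<in> Sy" "0 \<le> A" "wnorm_le (wf A N) z B" "\<And>i. i \<notin> S n \<Longrightarrow> z i = 0"
    using that by (rule F_energy_le)
  show "(\<Sum>i\<in>S n. (wl i)\<^sup>2 * ((z i - z' i) \<bullet> (F z i - F z' i)))
      \<le> CD B * ((\<Sum>i\<in>S n. (wl i * cmod (z i - z' i))\<^sup>2) + tail n)"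
    if "z \<in> Sy" "wnorm_le w0 z B" "wnorm_le w0 z' B"
    using that by (rule F_diff_le)
qed

end

section \<open>Sobolev norms of coefficient sequences\<close>

lemma sob_weight_jap: "sob_weight r k = (jap k powr r)\<^sup>2"
proof -
  have eq: "1 + (2 * pi * real_of_int k)\<^sup>2 = jap k powr 2"
    by (simp add: jap_def)
  have "sob_weight r k = jap k powr (2 * r)"
    unfolding sob_weight_def eq powr_powr ..
  also have "\<dots> = (jap k powr r)\<^sup>2"
    by (simp add: power2_eq_square powr_add[symmetric])
  finally show ?thesis .
qed

lemma sob_term: "sob_weight r k * (cmod (c k))\<^sup>2 = (jap k powr r * cmod (c k))\<^sup>2"
  by (simp add: sob_weight_jap power_mult_distrib)

lemma hs_norm_nonneg: "0 \<le> hs_norm r c"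
  unfolding hs_norm_def by (simp add: sob_term infsum_nonneg)

lemma wnorm_le_hs_norm:
  assumes "(\<lambda>k. sob_weight r k * (cmod (c k))\<^sup>2) summable_on UNIV"
  shows "wnorm_le (\<lambda>k. jap k powr r) c (hs_norm r c)"
proof (rule wnorm_leI)
  fix X :: "int set" assume X: "finite X"
  have "(\<Sum>k\<in>X. sob_weight r k * (cmod (c k))\<^sup>2) \<le> (\<Sum>\<^sub>\<infinity>k. sob_weight r k * (cmod (c k))\<^sup>2)"
    by (rule finite_sum_le_infsum[OF assms X]) (auto simp: sob_term)
  then show "L2_set (\<lambda>k. jap k powr r * cmod (c k)) X \<le> hs_norm r c"
    unfolding L2_set_def hs_norm_def sob_term by (rule real_sqrt_le_mono)
qed

lemma summable_of_wnorm_le: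
  assumes "wnorm_le (\<lambda>k. jap k powr r) c B"
  shows "(\<lambda>k. sob_weight r k * (cmod (c k))\<^sup>2) summable_on UNIV" "hs_norm r c \<le> B"
proof -
  have B: "0 \<le> B" by (rule wnorm_le_nonneg[OF assms])
  have fin: "(\<Sum>k\<in>X. sob_weight r k * (cmod (c k))\<^sup>2) \<le> B\<^sup>2" if "finite X" for X
  proof -
    have "sqrt (\<Sum>k\<in>X. sob_weight r k * (cmod (c k))\<^sup>2) \<le> B"
      using wnorm_leD[OF assms that] by (simp add: L2_set_def sob_term)
    then show ?thesis by (rule sqrt_le_D)
  qed
  show sm: "(\<lambda>k. sob_weight r k * (cmod (c k))\<^sup>2) summable_on UNIV"
  proof (rule nonneg_bdd_above_summable_on)
    show "bdd_above (sum (\<lambda>k. sob_weight r k * (cmod (c k))\<^sup>2) ` {F. F \<subseteq> UNIV \<and> finite F})"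
      by (rule bdd_aboveI[of _ "B\<^sup>2"]) (use fin in auto)
  qed (auto simp: sob_term)
  have "(\<Sum>\<^sub>\<infinity>k. sob_weight r k * (cmod (c k))\<^sup>2) \<le> B\<^sup>2"
    by (rule infsum_le_finite_sums[OF sm fin])
  then show "hs_norm r c \<le> B"
    unfolding hs_norm_def using B by (intro real_le_lsqrt) auto
qed

lemma Hs_iff: "c \<in> Hs r \<longleftrightarrow> (\<forall>k. c (- k) = cnj (c k)) \<and> (\<exists>B. wnorm_le (\<lambda>k. jap k powr r) c B)"
  unfolding Hs_def using wnorm_le_hs_norm summable_of_wnorm_le(1) by blast

lemma Hs_wnorm_le: "c \<in> Hs r \<Longrightarrow> wnorm_le (\<lambda>k. jap k powr r) c (hs_norm r c)"
  unfolding Hs_def by (blast intro: wnorm_le_hs_norm)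

lemma Hs_csub:
  assumes "b \<in> Hs r" "c \<in> Hs r"
  shows "csub b c \<in> Hs r"
  unfolding Hs_iff csub_def
proof
  show "\<forall>k. b (- k) - c (- k) = cnj (b k - c k)" using assms by (simp add: Hs_def)
  show "\<exists>B. wnorm_le (\<lambda>k. jap k powr r) (\<lambda>k. b k - c k) B"
    using wnorm_le_diff[OF Hs_wnorm_le[OF assms(1)] Hs_wnorm_le[OF assms(2)]] by auto
qed

definition pack :: "coeffs \<Rightarrow> coeffs \<Rightarrow> int \<times> bool \<Rightarrow> complex" where
  "pack u \<rho> i = (if snd i then u (fst i) else \<rho> (fst i))"

lemma pack_simps [simp]: "pack u \<rho> (k, True) = u k" "pack u \<rho> (k, False) = \<rho> k"
  by (simp_all add: pack_def)

lemma pack_eqI: "(\<And>k. z (k, True) = u k) \<Longrightarrow> (\<And>k. z (k, False) = \<rho> k) \<Longrightarrow> z = pack u \<rho>"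
  by (rule ext) (metis (full_types) pack_simps surj_pair)

abbreviation sw :: "real \<Rightarrow> int \<times> bool \<Rightarrow> real" where
  "sw r \<equiv> pw (\<lambda>x. x powr r) (\<lambda>x. x powr (r - 1))"

lemma wnorm_le_pack:
  assumes "u \<in> Hs r" "\<rho> \<in> Hs (r - 1)"
  shows "wnorm_le (sw r) (pack u \<rho>) (prod_norm r u \<rho>)"
  unfolding prod_norm_def by (rule wnorm_le_pair) (simp_all add: Hs_wnorm_le assms)

lemma wnorm_le_sw:
  assumes "wnorm_le (sw r) z B"
  shows "hs_norm r (\<lambda>k. z (k, True)) \<le> B" "hs_norm (r - 1) (\<lambda>k. z (k, False)) \<le> B"
    "prod_norm r (\<lambda>k. z (k, True)) (\<lambda>k. z (k, False)) \<le> 2 * B"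
proof -
  note c = wnorm_le_components[OF assms]
  show 1: "hs_norm r (\<lambda>k. z (k, True)) \<le> B" and 2: "hs_norm (r - 1) (\<lambda>k. z (k, False)) \<le> B"
    using summable_of_wnorm_le(2)[OF c(1)] summable_of_wnorm_le(2)[OF c(2)] by auto
  have "prod_norm r (\<lambda>k. z (k, True)) (\<lambda>k. z (k, False)) \<le> hs_norm r (\<lambda>k. z (k, True)) + hs_norm (r - 1) (\<lambda>k. z (k, False))"
    unfolding prod_norm_def by (intro sqrt_sum_squares_le_sum hs_norm_nonneg)
  then show "prod_norm r (\<lambda>k. z (k, True)) (\<lambda>k. z (k, False)) \<le> 2 * B" using 1 2 by linarith
qed

lemma components_Hs:
  assumes "\<And>k b. z (- k, b) = cnj (z (k, b))" "wnorm_le (sw r) z B"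
  shows "(\<lambda>k. z (k, True)) \<in> Hs r" "(\<lambda>k. z (k, False)) \<in> Hs (r - 1)"
  unfolding Hs_iff using assms(1) wnorm_le_components[OF assms(2)] by blast+

section \<open>Identification with the abstract system\<close>

lemma has_sum_single: "((\<lambda>j. if j = k then f j else 0) has_sum f k) UNIV"
proof -
  have "((\<lambda>j. if j = k then f j else 0) has_sum f k) {k}"
    using has_sum_finite[of "{k}" "\<lambda>j. if j = k then f j else 0"] by simp
  then show ?thesis
    by (rule has_sum_cong_neutral[THEN iffD1, rotated -1]) auto
qed

lemma at_within_atLeastLessThan:
  fixes t T :: real
  assumes "t < T"
  shows "at t within {0..<T} = at t within {0..}"
  by (rule at_within_nhd[of _ "{..<T}"]) (use assms in auto)

lemma has_vector_derivative_iff_quotient: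
  fixes f :: "real \<Rightarrow> complex"
  shows "(f has_vector_derivative D) (at t within A) \<longleftrightarrow>
    ((\<lambda>\<tau>. (f \<tau> - f t) / of_real (\<tau> - t) - D) \<longlongrightarrow> 0) (at t within A)"
proof -
  have "(f has_vector_derivative D) (at t within A) \<longleftrightarrow>
      ((\<lambda>\<tau>. (f \<tau> - (f t + (\<tau> - t) *\<^sub>R D)) /\<^sub>R norm (\<tau> - t)) \<longlongrightarrow> 0) (at t within A)"
    unfolding has_vector_derivative_def has_derivative_within
    by (simp add: inverse_eq_divide bounded_linear_scaleR_left)
  also have "\<dots> \<longleftrightarrow> ((\<lambda>\<tau>. norm ((f \<tau> - (f t + (\<tau> - t) *\<^sub>R D)) /\<^sub>R norm (\<tau> - t))) \<longlongrightarrow> 0) (at t within A)"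
    by (rule tendsto_norm_zero_iff[symmetric])
  also have "\<dots> \<longleftrightarrow> ((\<lambda>\<tau>. norm ((f \<tau> - f t) / of_real (\<tau> - t) - D)) \<longlongrightarrow> 0) (at t within A)"
  proof (rule filterlim_cong[OF refl refl])
    show "\<forall>\<^sub>F \<tau> in at t within A. norm ((f \<tau> - (f t + (\<tau> - t) *\<^sub>R D)) /\<^sub>R norm (\<tau> - t))
        = norm ((f \<tau> - f t) / of_real (\<tau> - t) - D)"
      unfolding eventually_at_filter
    proof (intro always_eventually allI impI)
      fix \<tau> assume "\<tau> \<noteq> t"
      then have "(f \<tau> - f t) / of_real (\<tau> - t) - D = (f \<tau> - (f t + (\<tau> - t) *\<^sub>R D)) / of_real (\<tau> - t)"
        by (simp add: scaleR_conv_of_real diff_divide_distrib add_divide_distrib del: of_real_diff)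
      then show "norm ((f \<tau> - (f t + (\<tau> - t) *\<^sub>R D)) /\<^sub>R norm (\<tau> - t)) = norm ((f \<tau> - f t) / of_real (\<tau> - t) - D)"
        by (simp add: norm_mult norm_inverse divide_inverse mult.commute del: of_real_diff)
    qed
  qed
  also have "\<dots> \<longleftrightarrow> ((\<lambda>\<tau>. (f \<tau> - f t) / of_real (\<tau> - t) - D) \<longlongrightarrow> 0) (at t within A)"
    by (rule tendsto_norm_zero_iff)
  finally show ?thesis .
qed

lemma tendsto_zero_of_eventually_le:
  fixes f :: "'a \<Rightarrow> real"
  assumes "\<And>\<epsilon>. 0 < \<epsilon> \<Longrightarrow> eventually (\<lambda>x. f x \<le> \<epsilon>) G" "\<And>x. 0 \<le> f x"
  shows "(f \<longlongrightarrow> 0) G"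
proof (rule tendstoI)
  fix \<epsilon> :: real assume "0 < \<epsilon>"
  then have "eventually (\<lambda>x. f x \<le> \<epsilon> / 2) G" by (intro assms) simp
  then show "eventually (\<lambda>x. dist (f x) 0 < \<epsilon>) G"
    by eventually_elim (use assms(2) \<open>0 < \<epsilon>\<close> in \<open>auto simp: abs_of_nonneg intro: le_less_trans\<close>)
qed

text \<open>Conservation of the mean: the symbol of P(D) vanishes at 0, and the zeroth coefficient
  of (u + \<gamma>) u_x is a sum of terms odd in j. Negation and reindexing commute with
  \<open>infsum\<close> unconditionally.\<close>

lemma rhs_u_0: "rhs_u \<gamma> m u \<rho> 0 = 0"
proof -
  define g where "g = (\<lambda>j. (u (0 - j) + cst \<gamma> (0 - j)) * dx u j)"
  have "g (- j) = - g j" for j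
    by (simp add: g_def dx_def cst_def algebra_simps)
  then have "(\<Sum>\<^sub>\<infinity>j. g (- j)) = - (\<Sum>\<^sub>\<infinity>j. g j)"
    by (simp add: infsum_uminus)
  moreover have "(\<Sum>\<^sub>\<infinity>j. g (- j)) = (\<Sum>\<^sub>\<infinity>j. g j)"
    by (rule infsum_reindex_bij_betw) (rule bij_uminus)
  ultimately have "(\<Sum>\<^sub>\<infinity>j. g j) = 0" by simp
  then show ?thesis by (simp add: rhs_u_def cmult_def PD_def g_def)
qed

section \<open>From the equations in Fourier coefficients to the abstract flow and back\<close>

context mu_ch2
begin

lemma w0_eq: "w0 = sw s"
  unfolding w0_def pw_def
  by (rule ext) (simp add: \<sigma>_def powr_diff)

lemma w1_eq: "w1 = sw (s - 1)"
  unfolding w1_def pw_def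
  by (rule ext) (simp add: \<sigma>_def powr_diff power2_eq_square)

lemma dx_eq: "dx c = (\<lambda>k. \<i> * of_real (dk k) * c k)"
  by (rule ext) (simp add: dx_def dk_def)

text \<open>\<open>rhs_u\<close> and \<open>rhs_rho\<close> are built from separate convolutions,
  \<open>F\<close> from a single one, so splitting the infinite sum requires convergence of each
  piece. The series with \<open>dx \<rho>\<close> costs one more factor \<open>2 * jap k\<close>,
  because the derivative sits on the rougher component.\<close>

lemma convolution_summable:
  assumes "wnorm_le w0 (pack u \<rho>) B"
  shows "(\<lambda>j. u (k - j) * dx u j) summable_on UNIV"
    and "(\<lambda>j. dx u (k - j) * dx u j) summable_on UNIV"
    and "(\<lambda>j. \<rho> (k - j) * \<rho> j) summable_on UNIV"
    and "(\<lambda>j. u (k - j) * dx \<rho> j) summable_on UNIV"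
    and "(\<lambda>j. dx u (k - j) * \<rho> j) summable_on UNIV"
proof -
  define q where "q = (\<lambda>j. 2 * jap k * B\<^sup>2 * jap j powr (- 2 * a))"
  define Q where "Q = (\<lambda>j. 2 * jap k * q j)"
  have "(\<lambda>j. jap j powr (- 2 * a)) summable_on UNIV"
    using jap_powr_L2_bound[OF a_facts(1)] by metis
  then have Qs: "Q summable_on UNIV"
    unfolding Q_def q_def by (intro summable_on_cmult_right)
  have sm: "f summable_on UNIV" if "\<And>j. cmod (f j) \<le> Q j" for f :: "int \<Rightarrow> complex"
  proof (rule abs_summable_summable)
    show "(\<lambda>j. norm (f j)) summable_on UNIV"
      by (rule summable_on_comparison_test[OF Qs that]) simp
  qed
  have pb: "jap (k - j) * jap j * (cmod (u (k - j)) * cmod (u j)) \<le> q j"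
    "cmod (\<rho> (k - j)) * cmod (\<rho> j) \<le> q j"
    "jap (k - j) * (cmod (u (k - j)) * cmod (\<rho> j)) \<le> q j" for j
    using product_bounds[OF assms, of k j] by (simp_all only: q_def pack_simps)
  have q0: "0 \<le> q j" for j by (simp add: q_def)
  have qQ: "x \<le> q j \<Longrightarrow> x \<le> Q j" for x j
    using mult_right_mono[of 1 "2 * jap k" "q j"] q0[of j] jap_ge1[of k] unfolding Q_def by linarith
  have dxc: "cmod (dx c l) \<le> jap l * cmod (c l)" for c l
    unfolding dx_eq using dk_le[of l] by (simp add: norm_mult mult_right_mono)
  show "(\<lambda>j. u (k - j) * dx u j) summable_on UNIV"
  proof (rule sm, rule qQ)
    fix j
    have "cmod (u (k - j) * dx u j) \<le> cmod (u (k - j)) * (jap j * cmod (u j))"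
      unfolding norm_mult by (intro mult_left_mono dxc) auto
    also have "\<dots> = 1 * (jap j * (cmod (u (k - j)) * cmod (u j)))" by simp
    also have "\<dots> \<le> jap (k - j) * (jap j * (cmod (u (k - j)) * cmod (u j)))"
      by (intro mult_right_mono) auto
    also have "\<dots> \<le> q j" using pb(1)[of j] by (simp add: mult.assoc)
    finally show "cmod (u (k - j) * dx u j) \<le> q j" .
  qed
  show "(\<lambda>j. dx u (k - j) * dx u j) summable_on UNIV"
  proof (rule sm, rule qQ)
    fix j
    have "cmod (dx u (k - j) * dx u j) \<le> (jap (k - j) * cmod (u (k - j))) * (jap j * cmod (u j))"
      unfolding norm_mult by (intro mult_mono dxc) auto
    also have "\<dots> \<le> q j" using pb(1)[of j] by (simp add: mult_ac)
    finally show "cmod (dx u (k - j) * dx u j) \<le> q j" .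
  qed
  show "(\<lambda>j. \<rho> (k - j) * \<rho> j) summable_on UNIV"
    by (rule sm, rule qQ) (use pb(2) in \<open>simp add: norm_mult\<close>)
  show "(\<lambda>j. u (k - j) * dx \<rho> j) summable_on UNIV"
  proof (rule sm)
    fix j
    have "jap j \<le> jap k + jap (k - j)" by (rule jap_tri(3))
    also have "\<dots> \<le> 2 * jap k * jap (k - j)"
    proof -
      have "jap k * 1 \<le> jap k * jap (k - j)" "1 * jap (k - j) \<le> jap k * jap (k - j)"
        by (intro mult_mono; simp)+
      then show ?thesis by linarith
    qed
    finally have y: "jap j \<le> 2 * jap k * jap (k - j)" .
    have "cmod (u (k - j) * dx \<rho> j) \<le> cmod (u (k - j)) * (jap j * cmod (\<rho> j))"
      unfolding norm_mult by (intro mult_left_mono dxc) auto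
    also have "\<dots> = jap j * (cmod (u (k - j)) * cmod (\<rho> j))" by simp
    also have "\<dots> \<le> (2 * jap k * jap (k - j)) * (cmod (u (k - j)) * cmod (\<rho> j))"
      by (intro mult_right_mono y) auto
    also have "\<dots> = 2 * jap k * (jap (k - j) * (cmod (u (k - j)) * cmod (\<rho> j)))" by simp
    also have "\<dots> \<le> 2 * jap k * q j"
      using pb(3)[of j] by (intro mult_left_mono) auto
    finally show "cmod (u (k - j) * dx \<rho> j) \<le> Q j" by (simp add: Q_def)
  qed
  show "(\<lambda>j. dx u (k - j) * \<rho> j) summable_on UNIV"
  proof (rule sm, rule qQ)
    fix j
    have "cmod (dx u (k - j) * \<rho> j) \<le> (jap (k - j) * cmod (u (k - j))) * cmod (\<rho> j)"
      unfolding norm_mult by (intro mult_right_mono dxc) auto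
    also have "\<dots> \<le> q j" using pb(3)[of j] by (simp add: mult_ac)
    finally show "cmod (dx u (k - j) * \<rho> j) \<le> q j" .
  qed
qed

lemma cmult_add_cst:
  assumes "(\<lambda>j. x (k - j) * y j) summable_on UNIV"
  shows "cmult (\<lambda>j. x j + cst c j) y k = cmult x y k + of_real c * y k"
proof -
  have "((\<lambda>j. x (k - j) * y j) has_sum cmult x y k) UNIV"
    unfolding cmult_def using assms by (rule has_sum_infsum)
  from has_sum_add[OF this has_sum_single[of k "\<lambda>j. of_real c * y j"]]
  have "((\<lambda>j. (x (k - j) + cst c (k - j)) * y j) has_sum cmult x y k + of_real c * y k) UNIV"
    by (rule has_sum_cong[THEN iffD1, rotated]) (simp add: cst_def distrib_right)
  then show ?thesis unfolding cmult_def by (rule infsumI)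
qed

text \<open>Identity at a fixed time, with \<open>m\<close> the mean of the current u: the diagonal
  of \<open>\<kappa>P\<close> supplies the term with \<open>2 * m\<close>, since \<open>u 0\<close>
  is real. The product rule \<open>dk k = dk j + dk (k - j)\<close> gives the conservative form of
  the second equation.\<close>

lemma rhs_eq_F:
  assumes z: "pack u \<rho> \<in> Sy" "wnorm_le w0 (pack u \<rho>) B" and m: "mean u = m"
  shows "rhs_u \<gamma>1 m u \<rho> k = F (pack u \<rho>) (k, True)" "rhs_rho \<gamma>2 u \<rho> k = F (pack u \<rho>) (k, False)"
proof -
  note sm = convolution_summable[OF z(2), of k]
  have cm: "((\<lambda>j. x (k - j) * y j) has_sum cmult x y k) UNIV" if "(\<lambda>j. x (k - j) * y j) summable_on UNIV" for x y
    unfolding cmult_def using that by (rule has_sum_infsum)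
  have "u 0 = cnj (u 0)" using SyD[OF z(1), of 0 True] by simp
  then have "Im (u 0) = 0" by (simp add: complex_eq_iff)
  then have u0: "u 0 = of_real m" using m by (simp add: mean_def complex_eq_iff)
  have pk: "PD c k = pk k * c k" for c
    by (simp add: PD_def pk_def)
  have "((\<lambda>j. u (k - j) * dx u j + (if j = k then pk k * (2 * of_real m * u j) else 0)
      + pk k * (1/2) * (dx u (k - j) * dx u j) + pk k * (1/2) * (\<rho> (k - j) * \<rho> j)) has_sum
      cmult u (dx u) k + pk k * (2 * of_real m * u k) + pk k * (1/2) * cmult (dx u) (dx u) k
      + pk k * (1/2) * cmult \<rho> \<rho> k) UNIV"
    by (intro has_sum_add has_sum_cmult_right cm sm has_sum_single)
  moreover have "u (k - j) * dx u j + (if j = k then pk k * (2 * of_real m * u j) else 0)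
      + pk k * (1/2) * (dx u (k - j) * dx u j) + pk k * (1/2) * (\<rho> (k - j) * \<rho> j) = H (pack u \<rho>) (k, True) j" for j
    unfolding H_def Let_def \<kappa>T_def \<kappa>P_def \<kappa>B_def dx_eq
    by (cases "j = k") (simp_all add: u0 algebra_simps)
  ultimately have "(H (pack u \<rho>) (k, True) has_sum
      cmult u (dx u) k + pk k * (2 * of_real m * u k) + pk k * (1/2) * cmult (dx u) (dx u) k
      + pk k * (1/2) * cmult \<rho> \<rho> k) UNIV" by simp
  then have "F (pack u \<rho>) (k, True) = cmult u (dx u) k + pk k * (2 * of_real m * u k)
      + pk k * (1/2) * cmult (dx u) (dx u) k + pk k * (1/2) * cmult \<rho> \<rho> k + of_real \<gamma>1 * dx u k"
    unfolding F_def by (simp add: infsumI lin_def dx_eq)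
  then show "rhs_u \<gamma>1 m u \<rho> k = F (pack u \<rho>) (k, True)"
    unfolding rhs_u_def pk cmult_add_cst[OF sm(1)] by (simp add: algebra_simps)
  have "((\<lambda>j. u (k - j) * dx \<rho> j + dx u (k - j) * \<rho> j) has_sum cmult u (dx \<rho>) k + cmult (dx u) \<rho> k) UNIV"
    by (intro has_sum_add cm sm)
  moreover have "u (k - j) * dx \<rho> j + dx u (k - j) * \<rho> j = H (pack u \<rho>) (k, False) j" for j
    unfolding H_def Let_def \<kappa>D_def dx_eq dk_diff[symmetric] by (simp add: algebra_simps)
  ultimately have "(H (pack u \<rho>) (k, False) has_sum cmult u (dx \<rho>) k + cmult (dx u) \<rho> k) UNIV" by simp
  then have "F (pack u \<rho>) (k, False) = cmult u (dx \<rho>) k + cmult (dx u) \<rho> k + of_real (2 * \<gamma>2) * dx \<rho> k"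
    unfolding F_def by (simp add: infsumI lin_def dx_eq)
  then show "rhs_rho \<gamma>2 u \<rho> k = F (pack u \<rho>) (k, False)"
    unfolding rhs_rho_def cmult_add_cst[OF sm(4)] by simp
qed

lemma pack_Sy: "u \<in> Hs r \<Longrightarrow> \<rho> \<in> Hs r' \<Longrightarrow> pack u \<rho> \<in> Sy"
  by (auto simp: Sy_def Hs_def pack_def)

lemma mean_conserved:
  assumes d: "\<And>t. t \<in> {0..<T} \<Longrightarrow> ((\<lambda>\<tau>. f \<tau> 0) has_vector_derivative 0) (at t within {0..})" and t: "t \<in> {0..<T}"
  shows "mean (f t) = mean (f 0)"
proof -
  have "((\<lambda>\<tau>. f \<tau> 0) has_vector_derivative 0) (at r within {0..t})" if "r \<in> {0..t}" for r
    by (rule has_vector_derivative_within_subset[OF d]) (use that t in auto)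
  then obtain c where "\<And>r. r \<in> {0..t} \<Longrightarrow> f r 0 = c"
    using has_vector_derivative_zero_constant[of "{0..t}" "\<lambda>\<tau>. f \<tau> 0"] by auto
  then have "f t 0 = f 0 0" using t by auto
  then show ?thesis by (simp add: mean_def)
qed

lemma evol_pack:
  assumes "evol z T" "t \<in> {0..<T}"
  shows "z t = pack (\<lambda>k. z t (k, True)) (\<lambda>k. z t (k, False))" "(\<lambda>k. z t (k, True)) \<in> Hs s" "(\<lambda>k. z t (k, False)) \<in> Hs (s - 1)"
proof -
  show "z t = pack (\<lambda>k. z t (k, True)) (\<lambda>k. z t (k, False))" by (rule pack_eqI) auto
  have e: "evol_at z t" using assms by (auto simp: evol_def)
  then obtain B where "wnorm_le w0 (z t) B" unfolding evol_at_def by blast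
  then have B: "wnorm_le (sw s) (z t) B" by (simp only: w0_eq)
  show "(\<lambda>k. z t (k, True)) \<in> Hs s" "(\<lambda>k. z t (k, False)) \<in> Hs (s - 1)"
    by (rule components_Hs[OF SyD B], use e in \<open>simp add: evol_at_def\<close>)+
qed

text \<open>\<open>F\<close> contains the mean of the current state, the equation that of the datum;
  by \<open>rhs_u_0\<close> the zeroth coefficient is constant in time, which reconciles the
  two.\<close>

lemma evol_rhs:
  assumes z: "evol z T" and t: "t \<in> {0..<T}"
  shows "rhs_u \<gamma>1 (mean (\<lambda>k. z 0 (k, True))) (\<lambda>k. z t (k, True)) (\<lambda>k. z t (k, False)) = (\<lambda>k. F (z t) (k, True))"
    and "rhs_rho \<gamma>2 (\<lambda>k. z t (k, True)) (\<lambda>k. z t (k, False)) = (\<lambda>k. F (z t) (k, False))"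
proof -
  have at: "evol_at z t" if "t \<in> {0..<T}" for t using z that by (auto simp: evol_def)
  have eq: "rhs_u \<gamma>1 (mean (\<lambda>k. z t (k, True))) (\<lambda>k. z t (k, True)) (\<lambda>k. z t (k, False)) k = F (z t) (k, True)"
    "rhs_rho \<gamma>2 (\<lambda>k. z t (k, True)) (\<lambda>k. z t (k, False)) k = F (z t) (k, False)" if t: "t \<in> {0..<T}" for t k
  proof -
    obtain B where "z t \<in> Sy" "wnorm_le w0 (z t) B" using at[OF t] unfolding evol_at_def by blast
    then show "rhs_u \<gamma>1 (mean (\<lambda>k. z t (k, True))) (\<lambda>k. z t (k, True)) (\<lambda>k. z t (k, False)) k = F (z t) (k, True)"
      "rhs_rho \<gamma>2 (\<lambda>k. z t (k, True)) (\<lambda>k. z t (k, False)) k = F (z t) (k, False)"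
      using rhs_eq_F[of "\<lambda>k. z t (k, True)" "\<lambda>k. z t (k, False)"] evol_pack(1)[OF z t] by auto
  qed
  have "mean (\<lambda>k. z t (k, True)) = mean (\<lambda>k. z 0 (k, True))"
  proof (rule mean_conserved[where f = "\<lambda>t k. z t (k, True)", OF _ t])
    fix r assume r: "r \<in> {0..<T}"
    have "F (z r) (0, True) = 0" using eq(1)[OF r, of 0] by (simp add: rhs_u_0)
    then show "((\<lambda>\<tau>. z \<tau> (0, True)) has_vector_derivative 0) (at r within {0..})"
      using at[OF r] unfolding evol_at_def by metis
  qed
  then show "rhs_u \<gamma>1 (mean (\<lambda>k. z 0 (k, True))) (\<lambda>k. z t (k, True)) (\<lambda>k. z t (k, False)) = (\<lambda>k. F (z t) (k, True))"
    using eq(1)[OF t] by auto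
  show "rhs_rho \<gamma>2 (\<lambda>k. z t (k, True)) (\<lambda>k. z t (k, False)) = (\<lambda>k. F (z t) (k, False))"
    using eq(2)[OF t] by auto
qed

lemma F_evol_Hs:
  assumes z: "evol z T" and t: "t \<in> {0..<T}"
  shows "(\<lambda>k. F (z t) (k, True)) \<in> Hs (s - 1)" "(\<lambda>k. F (z t) (k, False)) \<in> Hs (s - 2)"
proof -
  obtain B where B: "z t \<in> Sy" "wnorm_le w0 (z t) B" using z t unfolding evol_def evol_at_def by blast
  have "wnorm_le (sw (s - 1)) (F (z t)) (CL B * B)"
    using F_bound[OF B] by (simp add: w1_eq)
  from components_Hs[OF SyD[OF Sy_F[OF B(1)]] this]
  show "(\<lambda>k. F (z t) (k, True)) \<in> Hs (s - 1)" "(\<lambda>k. F (z t) (k, False)) \<in> Hs (s - 2)"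
    by (simp_all add: algebra_simps)
qed

lemma is_solution_of_evol:
  assumes z: "evol z T" and init: "z 0 = pack u0 \<rho>0"
  shows "is_solution \<gamma>1 \<gamma>2 s u0 \<rho>0 T (\<lambda>t k. z t (k, True)) (\<lambda>t k. z t (k, False))"
proof -
  let ?u = "\<lambda>t k. z t (k, True)" and ?\<rho> = "\<lambda>t k. z t (k, False)"
  have T: "0 < T" using z by (simp add: evol_def)
  have i0: "?u 0 = u0" "?\<rho> 0 = \<rho>0" by (auto simp: init)
  note Fu = evol_rhs(1)[OF z, unfolded i0] and Fr = evol_rhs(2)[OF z]
  have at: "at t within {0..<T} = at t within {0..}" if "t \<in> {0..<T}" for t
    by (rule at_within_atLeastLessThan) (use that in auto)
  have lim: "((\<lambda>\<tau>. hs_norm r (\<lambda>k. f \<tau> (k, True))) \<longlongrightarrow> 0) (at t within {0..<T})"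
    "((\<lambda>\<tau>. hs_norm (r - 1) (\<lambda>k. f \<tau> (k, False))) \<longlongrightarrow> 0) (at t within {0..<T})"
    if ev: "\<And>\<epsilon>. 0 < \<epsilon> \<Longrightarrow> eventually (\<lambda>\<tau>. wnorm_le (sw r) (f \<tau>) \<epsilon>) (at t within {0..})" and t: "t \<in> {0..<T}"
    for r f t
    unfolding at[OF t]
  proof -
    have 1: "eventually (\<lambda>\<tau>. hs_norm r (\<lambda>k. f \<tau> (k, True)) \<le> \<epsilon>) (at t within {0..})" if "0 < \<epsilon>" for \<epsilon>
      by (rule eventually_mono[OF ev[OF that]]) (rule wnorm_le_sw(1))
    have 2: "eventually (\<lambda>\<tau>. hs_norm (r - 1) (\<lambda>k. f \<tau> (k, False)) \<le> \<epsilon>) (at t within {0..})" if "0 < \<epsilon>" for \<epsilon>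
      by (rule eventually_mono[OF ev[OF that]]) (rule wnorm_le_sw(2))
    show "((\<lambda>\<tau>. hs_norm r (\<lambda>k. f \<tau> (k, True))) \<longlongrightarrow> 0) (at t within {0..})"
      by (rule tendsto_zero_of_eventually_le[OF 1 hs_norm_nonneg])
    show "((\<lambda>\<tau>. hs_norm (r - 1) (\<lambda>k. f \<tau> (k, False))) \<longlongrightarrow> 0) (at t within {0..})"
      by (rule tendsto_zero_of_eventually_le[OF 2 hs_norm_nonneg])
  qed
  have "eventually (\<lambda>\<tau>. wnorm_le (sw s) (\<lambda>i. z \<tau> i - z t i) \<epsilon>) (at t within {0..})"
    if "t \<in> {0..<T}" "0 < \<epsilon>" for t \<epsilon>
    using z that unfolding evol_def evol_at_def w0_eq[symmetric] by blast
  note cont = lim[where r = s and f = "\<lambda>\<tau> i. z \<tau> i - z t i" and t = t for t, OF this]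
  have "eventually (\<lambda>\<tau>. wnorm_le (sw (s - 1)) (\<lambda>i. F (z \<tau>) i - F (z t) i) \<epsilon>) (at t within {0..})"
    if "t \<in> {0..<T}" "0 < \<epsilon>" for t \<epsilon>
    using F_evol_continuous[OF z that] by (simp add: w1_eq)
  note Fcont = lim[where r = "s - 1" and f = "\<lambda>\<tau> i. F (z \<tau>) i - F (z t) i" and t = t for t, OF this]
  have "eventually (\<lambda>\<tau>. wnorm_le (sw (s - 1)) (\<lambda>i. (z \<tau> i - z t i) / of_real (\<tau> - t) - F (z t) i) \<epsilon>) (at t within {0..})"
    if "t \<in> {0..<T}" "0 < \<epsilon>" for t \<epsilon>
    using evol_strong_derivative[OF z that] by (simp add: w1_eq)
  note deriv = lim[where r = "s - 1" and f = "\<lambda>\<tau> i. (z \<tau> i - z t i) / of_real (\<tau> - t) - F (z t) i" and t = t for t, OF this]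
  have s2: "s - 1 - 1 = s - 2" by simp
  have cc: "cont_curve r T f" if "\<And>t. t \<in> {0..<T} \<Longrightarrow> f t = g t" "\<And>t. t \<in> {0..<T} \<Longrightarrow> g t \<in> Hs r"
    "\<And>t. t \<in> {0..<T} \<Longrightarrow> ((\<lambda>\<tau>. hs_norm r (\<lambda>k. g \<tau> k - g t k)) \<longlongrightarrow> 0) (at t within {0..<T})" for r f g
    unfolding cont_curve_def
  proof (intro conjI ballI)
    fix t assume t: "t \<in> {0..<T}"
    then show "f t \<in> Hs r" using that by auto
    have "\<forall>\<^sub>F \<tau> in at t within {0..<T}. hs_norm r (\<lambda>k. g \<tau> k - g t k) = hs_norm r (csub (f \<tau>) (f t))"
      unfolding eventually_at_filter
      by (intro always_eventually allI impI) (use that(1) t in \<open>simp add: csub_def\<close>)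
    then show "((\<lambda>\<tau>. hs_norm r (csub (f \<tau>) (f t))) \<longlongrightarrow> 0) (at t within {0..<T})"
      by (rule Lim_transform_eventually[OF that(3)[OF t]])
  qed
  show ?thesis
    unfolding is_solution_def
  proof (intro conjI ballI)
    show "cont_curve s T ?u"
      by (rule cc[where g = ?u]) (use evol_pack(2)[OF z] cont(1) in auto)
    show "cont_curve (s - 1) T ?\<rho>"
      by (rule cc[where g = ?\<rho>]) (use evol_pack(3)[OF z] cont(2) in auto)
    show "cont_curve (s - 1) T (\<lambda>t. rhs_u \<gamma>1 (mean u0) (?u t) (?\<rho> t))"
      by (rule cc[where g = "\<lambda>t k. F (z t) (k, True)"]) (use Fu F_evol_Hs(1)[OF z] Fcont(1) in auto)
    show "cont_curve (s - 2) T (\<lambda>t. rhs_rho \<gamma>2 (?u t) (?\<rho> t))"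
      by (rule cc[where g = "\<lambda>t k. F (z t) (k, False)"]) (use Fr F_evol_Hs(2)[OF z] Fcont(2)[unfolded s2] in auto)
    fix t assume t: "t \<in> {0..<T}"
    show "hs_deriv (s - 1) T ?u (rhs_u \<gamma>1 (mean u0) (?u t) (?\<rho> t)) t"
      unfolding hs_deriv_def Fu[OF t] by (rule deriv(1)[OF t]) (use t in auto)
    show "hs_deriv (s - 2) T ?\<rho> (rhs_rho \<gamma>2 (?u t) (?\<rho> t)) t"
      unfolding hs_deriv_def Fr[OF t] by (rule deriv(2)[OF t, unfolded s2]) (use t in auto)
  qed (use T i0 in auto)
qed

text \<open>A non-summable family has \<open>infsum\<close> 0, so smallness of
  \<open>hs_norm\<close> alone says nothing about coordinates. The difference quotients are
  therefore first shown to lie in the space, using the memberships of \<open>f\<close> and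
  \<open>f'\<close>.\<close>

lemma hs_deriv_coord:
  assumes d: "hs_deriv r T f f' t" and t: "t \<in> {0..<T}"
    and f: "\<And>\<tau>. \<tau> \<in> {0..<T} \<Longrightarrow> f \<tau> \<in> Hs r'" "r \<le> r'" and f': "f' \<in> Hs r"
  shows "((\<lambda>\<tau>. f \<tau> k) has_vector_derivative f' k) (at t within {0..})"
proof -
  define q where "q = (\<lambda>\<tau> k. (f \<tau> k - f t k) / of_real (\<tau> - t) - f' k)"
  have q: "wnorm_le (\<lambda>k. jap k powr r) (q \<tau>) (hs_norm r (q \<tau>))" if \<tau>: "\<tau> \<in> {0..<T}" for \<tau>
  proof -
    have h: "wnorm_le (\<lambda>k. jap k powr r) (f \<tau>') (hs_norm r' (f \<tau>'))" if "\<tau>' \<in> {0..<T}" for \<tau>'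
      by (rule wnorm_le_weight[OF Hs_wnorm_le[OF f(1)[OF that]]]) (simp_all add: powr_mono f(2))
    define c where "c = inverse \<bar>\<tau> - t\<bar>"
    define D where "D = hs_norm r' (f \<tau>) + hs_norm r' (f t)"
    have diff: "wnorm_le (\<lambda>k. jap k powr r) (\<lambda>k. f \<tau> k - f t k) D"
      unfolding D_def by (rule wnorm_le_diff[OF h[OF \<tau>] h[OF t]]) simp
    have "wnorm_le (\<lambda>k. jap k powr r) (\<lambda>k. (f \<tau> k - f t k) / of_real (\<tau> - t)) (c * D)"
    proof (rule wnorm_leI)
      fix X :: "int set" assume X: "finite X"
      have "L2_set (\<lambda>k. jap k powr r * cmod ((f \<tau> k - f t k) / of_real (\<tau> - t))) X
          = L2_set (\<lambda>k. c * (jap k powr r * cmod (f \<tau> k - f t k))) X"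
      proof (rule L2_set_cong[OF refl])
        fix k
        have "cmod ((f \<tau> k - f t k) / of_real (\<tau> - t)) = c * cmod (f \<tau> k - f t k)"
          unfolding norm_divide norm_of_real c_def by (simp add: divide_inverse mult.commute)
        then show "jap k powr r * cmod ((f \<tau> k - f t k) / of_real (\<tau> - t)) = c * (jap k powr r * cmod (f \<tau> k - f t k))"
          by (simp only: mult.left_commute)
      qed
      also have "\<dots> = c * L2_set (\<lambda>k. jap k powr r * cmod (f \<tau> k - f t k)) X"
        by (rule L2_set_right_distrib[symmetric]) (simp add: c_def)
      also have "\<dots> \<le> c * D"
        by (intro mult_left_mono wnorm_leD[OF diff X]) (simp add: c_def)
      finally show "L2_set (\<lambda>k. jap k powr r * cmod ((f \<tau> k - f t k) / of_real (\<tau> - t))) X \<le> c * D" .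
    qed
    from wnorm_le_diff[OF this Hs_wnorm_le[OF f']]
    have "wnorm_le (\<lambda>k. jap k powr r) (q \<tau>) (c * D + hs_norm r f')"
      by (simp only: q_def powr_ge_zero)
    from summable_of_wnorm_le(1)[OF this] show ?thesis by (rule wnorm_le_hs_norm)
  qed
  have at: "at t within {0..<T} = at t within {0..}"
    by (rule at_within_atLeastLessThan) (use t in auto)
  have "((\<lambda>\<tau>. hs_norm r (q \<tau>)) \<longlongrightarrow> 0) (at t within {0..<T})"
    using d unfolding hs_deriv_def q_def .
  from tendsto_mult_right[OF this, of "jap k powr - r"]
  have lim: "((\<lambda>\<tau>. hs_norm r (q \<tau>) * jap k powr - r) \<longlongrightarrow> 0) (at t within {0..<T})"
    by simp
  have "cmod (q \<tau> k) \<le> hs_norm r (q \<tau>) * jap k powr - r" if "\<tau> \<in> {0..<T}" for \<tau>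
  proof -
    have "jap k powr r * cmod (q \<tau> k) \<le> hs_norm r (q \<tau>)"
      by (rule wnorm_le_coord[OF q[OF that]]) simp
    then have "jap k powr - r * (jap k powr r * cmod (q \<tau> k)) \<le> jap k powr - r * hs_norm r (q \<tau>)"
      by (intro mult_left_mono) auto
    moreover have "jap k powr - r * jap k powr r = 1"
      unfolding powr_add[symmetric] by simp
    ultimately show ?thesis by (simp only: mult.assoc[symmetric] mult_1_left mult.commute[of _ "jap k powr - r"])
  qed
  then have "\<forall>\<^sub>F \<tau> in at t within {0..<T}. cmod (q \<tau> k) \<le> hs_norm r (q \<tau>) * jap k powr - r"
    unfolding eventually_at_filter by (intro always_eventually) auto
  then have "((\<lambda>\<tau>. q \<tau> k) \<longlongrightarrow> 0) (at t within {0..<T})"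
    using lim by (rule Lim_null_comparison)
  then show ?thesis
    unfolding has_vector_derivative_iff_quotient at q_def .
qed

text \<open>Uniqueness is claimed among all solutions in the stated class; viewing each of them as
  an abstract evolution brings it under \<open>evol_unique\<close>.\<close>

lemma evol_of_is_solution:
  assumes sol: "is_solution \<gamma>1 \<gamma>2 s u0 \<rho>0 T u \<rho>"
  shows "evol (\<lambda>t. pack (u t) (\<rho> t)) T"
  unfolding evol_def
proof (intro conjI ballI)
  show "0 < T" using sol by (simp add: is_solution_def)
  have Hu: "u t \<in> Hs s" and Hr: "\<rho> t \<in> Hs (s - 1)" if "t \<in> {0..<T}" for t
    using sol that unfolding is_solution_def cont_curve_def by blast+
  have du: "((\<lambda>\<tau>. u \<tau> k) has_vector_derivative rhs_u \<gamma>1 (mean u0) (u t) (\<rho> t) k) (at t within {0..})"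
    if t: "t \<in> {0..<T}" for t k
    by (rule hs_deriv_coord[where r = "s - 1" and r' = s and T = T and f = u])
      (use sol t Hu in \<open>auto simp: is_solution_def cont_curve_def\<close>)
  have dr: "((\<lambda>\<tau>. \<rho> \<tau> k) has_vector_derivative rhs_rho \<gamma>2 (u t) (\<rho> t) k) (at t within {0..})"
    if t: "t \<in> {0..<T}" for t k
    by (rule hs_deriv_coord[where r = "s - 2" and r' = "s - 1" and T = T and f = \<rho>])
      (use sol t Hr in \<open>auto simp: is_solution_def cont_curve_def\<close>)
  fix t assume t: "t \<in> {0..<T}"
  have Sy: "pack (u t) (\<rho> t) \<in> Sy" by (rule pack_Sy[OF Hu[OF t] Hr[OF t]])
  have bd: "wnorm_le w0 (pack (u t) (\<rho> t)) (prod_norm s (u t) (\<rho> t))"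
    unfolding w0_eq by (rule wnorm_le_pack[OF Hu[OF t] Hr[OF t]])
  have "mean (u t) = mean (u 0)"
    by (rule mean_conserved[OF _ t]) (use du[of _ 0] in \<open>simp add: rhs_u_0\<close>)
  then have m: "mean (u t) = mean u0" using sol by (simp add: is_solution_def)
  note F = rhs_eq_F[OF Sy bd m]
  have at: "at t within {0..<T} = at t within {0..}"
    by (rule at_within_atLeastLessThan) (use t in auto)
  show "evol_at (\<lambda>t. pack (u t) (\<rho> t)) t"
    unfolding evol_at_def
  proof (intro conjI allI impI)
    show "pack (u t) (\<rho> t) \<in> Sy" by (rule Sy)
    show "\<exists>B. wnorm_le w0 (pack (u t) (\<rho> t)) B" using bd by blast
  next
    fix i :: "int \<times> bool"
    obtain k c where i: "i = (k, c)" by (cases i)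
    show "((\<lambda>\<tau>. pack (u \<tau>) (\<rho> \<tau>) i) has_vector_derivative F (pack (u t) (\<rho> t)) i) (at t within {0..})"
      using du[OF t, of k] dr[OF t, of k] F[of k] by (cases c) (simp_all add: i)
  next
    fix \<epsilon> :: real assume \<epsilon>: "0 < \<epsilon>"
    have "((\<lambda>\<tau>. hs_norm s (csub (u \<tau>) (u t))) \<longlongrightarrow> 0) (at t within {0..<T})"
      and 2: "((\<lambda>\<tau>. hs_norm (s - 1) (csub (\<rho> \<tau>) (\<rho> t))) \<longlongrightarrow> 0) (at t within {0..<T})"
      using sol t by (auto simp: is_solution_def cont_curve_def)
    from this(1) have "\<forall>\<^sub>F \<tau> in at t within {0..<T}. hs_norm s (csub (u \<tau>) (u t)) < \<epsilon> / 2"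
      by (rule order_tendstoD(2)) (use \<epsilon> in simp)
    moreover from 2 have "\<forall>\<^sub>F \<tau> in at t within {0..<T}. hs_norm (s - 1) (csub (\<rho> \<tau>) (\<rho> t)) < \<epsilon> / 2"
      by (rule order_tendstoD(2)) (use \<epsilon> in simp)
    moreover have "\<forall>\<^sub>F \<tau> in at t within {0..<T}. \<tau> \<in> {0..<T}"
      by (simp add: eventually_at_filter)
    ultimately have "\<forall>\<^sub>F \<tau> in at t within {0..<T}. wnorm_le w0 (\<lambda>i. pack (u \<tau>) (\<rho> \<tau>) i - pack (u t) (\<rho> t) i) \<epsilon>"
    proof eventually_elim
      case (elim \<tau>)
      have "wnorm_le w0 (pack (csub (u \<tau>) (u t)) (csub (\<rho> \<tau>) (\<rho> t)))
          (prod_norm s (csub (u \<tau>) (u t)) (csub (\<rho> \<tau>) (\<rho> t)))"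
        unfolding w0_eq by (intro wnorm_le_pack Hs_csub Hu Hr elim t)
      moreover have "pack (csub (u \<tau>) (u t)) (csub (\<rho> \<tau>) (\<rho> t)) = (\<lambda>i. pack (u \<tau>) (\<rho> \<tau>) i - pack (u t) (\<rho> t) i)"
        by (rule pack_eqI[symmetric]) (auto simp: csub_def)
      moreover have "prod_norm s (csub (u \<tau>) (u t)) (csub (\<rho> \<tau>) (\<rho> t)) \<le> \<epsilon>"
        unfolding prod_norm_def
        using sqrt_sum_squares_le_sum[OF hs_norm_nonneg[of s "csub (u \<tau>) (u t)"] hs_norm_nonneg[of "s - 1" "csub (\<rho> \<tau>) (\<rho> t)"]] elim
        by linarith
      ultimately show ?case by (auto intro: wnorm_le_mono)
    qed
    then show "\<forall>\<^sub>F \<tau> in at t within {0..}. wnorm_le w0 (\<lambda>i. pack (u \<tau>) (\<rho> \<tau>) i - pack (u t) (\<rho> t) i) \<epsilon>"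
      by (simp only: at)
  qed
qed

section \<open>Continuous dependence in Sobolev norms\<close>

definition Umax where "Umax u0 \<rho>0 t k = flow (pack u0 \<rho>0) t (k, True)"
definition Rmax where "Rmax u0 \<rho>0 t k = flow (pack u0 \<rho>0) t (k, False)"

lemma flow_dependence:
  assumes z0: "u0 \<in> Hs s" "\<rho>0 \<in> Hs (s - 1)" and T: "0 < T" "ereal T < max_time (pack u0 \<rho>0)" and \<epsilon>: "0 < \<epsilon>"
  shows "\<exists>\<delta>>0. \<forall>v0\<in>Hs s. \<forall>\<sigma>0\<in>Hs (s - 1). prod_norm s (csub v0 u0) (csub \<sigma>0 \<rho>0) < \<delta> \<longrightarrow>
      ereal T < max_time (pack v0 \<sigma>0) \<and>
      (\<forall>t\<in>{0..T}.
        prod_norm s (csub (Umax v0 \<sigma>0 t) (Umax u0 \<rho>0 t)) (csub (Rmax v0 \<sigma>0 t) (Rmax u0 \<rho>0 t))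
        + prod_norm (s - 1)
            (csub (rhs_u \<gamma>1 (mean v0) (Umax v0 \<sigma>0 t) (Rmax v0 \<sigma>0 t)) (rhs_u \<gamma>1 (mean u0) (Umax u0 \<rho>0 t) (Rmax u0 \<rho>0 t)))
            (csub (rhs_rho \<gamma>2 (Umax v0 \<sigma>0 t) (Rmax v0 \<sigma>0 t)) (rhs_rho \<gamma>2 (Umax u0 \<rho>0 t) (Rmax u0 \<rho>0 t)))
        < \<epsilon>)"
proof -
  have zb: "pack u0 \<rho>0 \<in> Sy" "wnorm_le w0 (pack u0 \<rho>0) (prod_norm s u0 \<rho>0)"
    using pack_Sy[OF z0] wnorm_le_pack[OF z0] by (auto simp: w0_eq)
  obtain M where M: "0 < M" "\<And>t. t \<in> {0..T} \<Longrightarrow> wnorm_le w0 (flow (pack u0 \<rho>0) t) M"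
    "\<And>t. t \<in> {0..T} \<Longrightarrow> flow (pack u0 \<rho>0) t \<in> Sy"
    using flow_bound[OF T] by blast
  define C where "C = CL (M + 1)"
  have C: "0 \<le> C" unfolding C_def by (rule CL_nonneg)
  \<comment> \<open>At most 1, so that perturbed solutions stay in the ball of radius
    \<open>M + 1\<close>, on which \<open>C\<close> is the Lipschitz constant; the other bound
    yields \<open>2 * \<eta> + 2 * (C * \<eta>) < \<epsilon>\<close>, the factors 2 coming from
    \<open>wnorm_le_sw\<close>.\<close>
  define \<eta> where "\<eta> = min 1 (\<epsilon> / (4 * (1 + C)))"
  have \<eta>: "0 < \<eta>" "\<eta> \<le> 1" using \<epsilon> C by (auto simp: \<eta>_def)
  have "(2 * (1 + C)) * \<eta> \<le> (2 * (1 + C)) * (\<epsilon> / (4 * (1 + C)))"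
    using C by (intro mult_left_mono) (auto simp: \<eta>_def)
  also have "\<dots> = \<epsilon> / 2" using C by (simp add: field_simps)
  finally have small: "2 * \<eta> + 2 * (C * \<eta>) < \<epsilon>" using \<epsilon> by (simp add: algebra_simps)
  obtain \<delta> where \<delta>: "0 < \<delta>" "\<And>v. v \<in> Sy \<Longrightarrow> wnorm_le w0 (\<lambda>i. v i - pack u0 \<rho>0 i) \<delta> \<Longrightarrow>
      ereal T < max_time v \<and> (\<forall>t\<in>{0..T}. wnorm_le w0 (\<lambda>i. flow v t i - flow (pack u0 \<rho>0) t i) \<eta>)"
    by (rule continuous_dependence[OF zb T \<eta>(1)]) blast
  have rhs: "rhs_u \<gamma>1 (mean v0) (Umax v0 \<sigma>0 t) (Rmax v0 \<sigma>0 t) = (\<lambda>k. F (flow (pack v0 \<sigma>0) t) (k, True))"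
    "rhs_rho \<gamma>2 (Umax v0 \<sigma>0 t) (Rmax v0 \<sigma>0 t) = (\<lambda>k. F (flow (pack v0 \<sigma>0) t) (k, False))"
    if Tv: "ereal T < max_time (pack v0 \<sigma>0)" and t: "t \<in> {0..T}" for v0 \<sigma>0 t
  proof -
    obtain zz T1 where T1: "T < T1" "evol zz T1" "zz 0 = pack v0 \<sigma>0"
      using lt_max_time[OF Tv] by blast
    have le: "ereal T1 \<le> max_time (pack v0 \<sigma>0)" by (rule evol_le_max_time[OF T1(2,3)])
    have pos: "0 < T1" using T T1 by simp
    note e = evol_flow[OF pos le]
    have U: "Umax v0 \<sigma>0 t = (\<lambda>k. flow (pack v0 \<sigma>0) t (k, True))" "Rmax v0 \<sigma>0 t = (\<lambda>k. flow (pack v0 \<sigma>0) t (k, False))"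
      by (auto simp: Umax_def Rmax_def)
    have m: "(\<lambda>k. flow (pack v0 \<sigma>0) 0 (k, True)) = v0" by (simp add: e(2))
    show "rhs_u \<gamma>1 (mean v0) (Umax v0 \<sigma>0 t) (Rmax v0 \<sigma>0 t) = (\<lambda>k. F (flow (pack v0 \<sigma>0) t) (k, True))"
      "rhs_rho \<gamma>2 (Umax v0 \<sigma>0 t) (Rmax v0 \<sigma>0 t) = (\<lambda>k. F (flow (pack v0 \<sigma>0) t) (k, False))"
      unfolding U using evol_rhs[OF e(1), of t, unfolded m] t T1 by auto
  qed
  have main: "ereal T < max_time (pack v0 \<sigma>0) \<and>
      (\<forall>t\<in>{0..T}.
        prod_norm s (csub (Umax v0 \<sigma>0 t) (Umax u0 \<rho>0 t)) (csub (Rmax v0 \<sigma>0 t) (Rmax u0 \<rho>0 t))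
        + prod_norm (s - 1)
            (csub (rhs_u \<gamma>1 (mean v0) (Umax v0 \<sigma>0 t) (Rmax v0 \<sigma>0 t)) (rhs_u \<gamma>1 (mean u0) (Umax u0 \<rho>0 t) (Rmax u0 \<rho>0 t)))
            (csub (rhs_rho \<gamma>2 (Umax v0 \<sigma>0 t) (Rmax v0 \<sigma>0 t)) (rhs_rho \<gamma>2 (Umax u0 \<rho>0 t) (Rmax u0 \<rho>0 t)))
        < \<epsilon>)"
    if v: "v0 \<in> Hs s" "\<sigma>0 \<in> Hs (s - 1)" "prod_norm s (csub v0 u0) (csub \<sigma>0 \<rho>0) < \<delta>" for v0 \<sigma>0
  proof -
    have "wnorm_le w0 (pack (csub v0 u0) (csub \<sigma>0 \<rho>0)) (prod_norm s (csub v0 u0) (csub \<sigma>0 \<rho>0))"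
      unfolding w0_eq by (intro wnorm_le_pack Hs_csub v z0)
    moreover have "pack (csub v0 u0) (csub \<sigma>0 \<rho>0) = (\<lambda>i. pack v0 \<sigma>0 i - pack u0 \<rho>0 i)"
      by (rule pack_eqI[symmetric]) (auto simp: csub_def)
    ultimately have "wnorm_le w0 (\<lambda>i. pack v0 \<sigma>0 i - pack u0 \<rho>0 i) \<delta>"
      using v(3) by (auto intro: wnorm_le_mono)
    note d = \<delta>(2)[OF pack_Sy[OF v(1,2)] this]
    then have Tv: "ereal T < max_time (pack v0 \<sigma>0)" by blast
    obtain Mv where Mv: "\<And>t. t \<in> {0..T} \<Longrightarrow> flow (pack v0 \<sigma>0) t \<in> Sy"
      using flow_bound[OF T(1) Tv] by blast
    show ?thesis
    proof (intro conjI ballI Tv)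
      fix t assume t: "t \<in> {0..T}"
      define zv zu where "zv = flow (pack v0 \<sigma>0) t" and "zu = flow (pack u0 \<rho>0) t"
      have dist: "wnorm_le w0 (\<lambda>i. zv i - zu i) \<eta>"
        using d t by (simp add: zv_def zu_def)
      have zuM: "wnorm_le w0 zu M" unfolding zu_def by (rule M(2)[OF t])
      have zvM: "wnorm_le w0 zv (M + 1)"
        by (rule wnorm_le_mono[OF wnorm_le_of_diff[OF dist zuM]]) (use \<eta> in auto)
      have "wnorm_le w1 (\<lambda>i. F zv i - F zu i) (C * \<eta>)"
        unfolding C_def
        by (rule F_lip[OF _ _ zvM wnorm_le_mono[OF zuM] dist]) (use Mv[OF t] M(3)[OF t] in \<open>auto simp: zv_def zu_def\<close>)
      then have "prod_norm (s - 1) (\<lambda>k. F zv (k, True) - F zu (k, True)) (\<lambda>k. F zv (k, False) - F zu (k, False)) \<le> 2 * (C * \<eta>)"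
        unfolding w1_eq by (rule wnorm_le_sw(3))
      moreover have "prod_norm s (\<lambda>k. zv (k, True) - zu (k, True)) (\<lambda>k. zv (k, False) - zu (k, False)) \<le> 2 * \<eta>"
        using dist unfolding w0_eq by (rule wnorm_le_sw(3))
      ultimately show "prod_norm s (csub (Umax v0 \<sigma>0 t) (Umax u0 \<rho>0 t)) (csub (Rmax v0 \<sigma>0 t) (Rmax u0 \<rho>0 t))
        + prod_norm (s - 1)
            (csub (rhs_u \<gamma>1 (mean v0) (Umax v0 \<sigma>0 t) (Rmax v0 \<sigma>0 t)) (rhs_u \<gamma>1 (mean u0) (Umax u0 \<rho>0 t) (Rmax u0 \<rho>0 t)))
            (csub (rhs_rho \<gamma>2 (Umax v0 \<sigma>0 t) (Rmax v0 \<sigma>0 t)) (rhs_rho \<gamma>2 (Umax u0 \<rho>0 t) (Rmax u0 \<rho>0 t)))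
        < \<epsilon>"
        unfolding rhs[OF Tv t] rhs[OF T(2) t] csub_def Umax_def Rmax_def zv_def[symmetric] zu_def[symmetric]
        using small by linarith
    qed
  qed
  show ?thesis using \<delta>(1) main by blast
qed

end

theorem theorem3p2:
  fixes \<gamma>1 \<gamma>2 s :: real
  assumes "s > 3/2"
  shows "\<exists>(Tf :: real \<Rightarrow> real) (Tmax :: coeffs \<Rightarrow> coeffs \<Rightarrow> ereal)
            (U :: coeffs \<Rightarrow> coeffs \<Rightarrow> real \<Rightarrow> coeffs) (R :: coeffs \<Rightarrow> coeffs \<Rightarrow> real \<Rightarrow> coeffs).
     (\<forall>r. 0 < Tf r) \<and>
     (\<forall>u0 \<in> Hs s. \<forall>\<rho>0 \<in> Hs (s - 1).
        ereal (Tf (prod_norm s u0 \<rho>0)) \<le> Tmax u0 \<rho>0 \<and>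
        (\<forall>T. 0 < T \<and> ereal T \<le> Tmax u0 \<rho>0 \<longrightarrow>
              is_solution \<gamma>1 \<gamma>2 s u0 \<rho>0 T (U u0 \<rho>0) (R u0 \<rho>0)) \<and>
        (\<forall>T u \<rho>. is_solution \<gamma>1 \<gamma>2 s u0 \<rho>0 T u \<rho> \<longrightarrow>
              ereal T \<le> Tmax u0 \<rho>0 \<and>
              (\<forall>t\<in>{0..<T}. u t = U u0 \<rho>0 t \<and> \<rho> t = R u0 \<rho>0 t)) \<and>
        (\<forall>T. 0 < T \<and> ereal T < Tmax u0 \<rho>0 \<longrightarrow>
          (\<forall>\<epsilon>>0. \<exists>\<delta>>0. \<forall>v0 \<in> Hs s. \<forall>\<sigma>0 \<in> Hs (s - 1).
             prod_norm s (csub v0 u0) (csub \<sigma>0 \<rho>0) < \<delta> \<longrightarrow>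
               ereal T < Tmax v0 \<sigma>0 \<and>
               (\<forall>t\<in>{0..T}.
                  prod_norm s (csub (U v0 \<sigma>0 t) (U u0 \<rho>0 t)) (csub (R v0 \<sigma>0 t) (R u0 \<rho>0 t))
                  + prod_norm (s - 1)
                      (csub (rhs_u \<gamma>1 (mean v0) (U v0 \<sigma>0 t) (R v0 \<sigma>0 t))
                            (rhs_u \<gamma>1 (mean u0) (U u0 \<rho>0 t) (R u0 \<rho>0 t)))
                      (csub (rhs_rho \<gamma>2 (U v0 \<sigma>0 t) (R v0 \<sigma>0 t))
                            (rhs_rho \<gamma>2 (U u0 \<rho>0 t) (R u0 \<rho>0 t)))
                  < \<epsilon>))))"
proof -
  interpret mu_ch2 \<gamma>1 \<gamma>2 s
    by unfold_locales (rule assms)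
  have norm: "wnorm_le w0 (pack u0 \<rho>0) (prod_norm s u0 \<rho>0)" "pack u0 \<rho>0 \<in> Sy"
    if "u0 \<in> Hs s" "\<rho>0 \<in> Hs (s - 1)" for u0 \<rho>0
    using wnorm_le_pack[OF that] pack_Sy[OF that] by (auto simp: w0_eq)
  show ?thesis
  \<comment> \<open>The guaranteed time is \<open>lifespan\<close> at a radius strictly above the
    norm, as \<open>lifespan_le_max_time\<close> asks; the absolute value makes it positive for
    every real r.\<close>
  proof (rule exI[of _ "\<lambda>r. lifespan (\<bar>r\<bar> + 1)"], rule exI[of _ "\<lambda>u0 \<rho>0. max_time (pack u0 \<rho>0)"],
      rule exI[of _ Umax], rule exI[of _ Rmax], intro conjI ballI allI)
    show "0 < lifespan (\<bar>r\<bar> + 1)" for r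
      by (rule lifespan_pos) simp
    fix u0 \<rho>0 assume z0: "u0 \<in> Hs s" "\<rho>0 \<in> Hs (s - 1)"
    show "ereal (lifespan (\<bar>prod_norm s u0 \<rho>0\<bar> + 1)) \<le> max_time (pack u0 \<rho>0)"
      by (rule lifespan_le_max_time[OF norm(2)[OF z0] norm(1)[OF z0]]) simp
    show "0 < T \<and> ereal T \<le> max_time (pack u0 \<rho>0) \<longrightarrow>
        is_solution \<gamma>1 \<gamma>2 s u0 \<rho>0 T (Umax u0 \<rho>0) (Rmax u0 \<rho>0)" for T
    proof
      assume T: "0 < T \<and> ereal T \<le> max_time (pack u0 \<rho>0)"
      have "is_solution \<gamma>1 \<gamma>2 s u0 \<rho>0 T (\<lambda>t k. flow (pack u0 \<rho>0) t (k, True)) (\<lambda>t k. flow (pack u0 \<rho>0) t (k, False))"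
        by (rule is_solution_of_evol[OF evol_flow]) (use T in auto)
      then show "is_solution \<gamma>1 \<gamma>2 s u0 \<rho>0 T (Umax u0 \<rho>0) (Rmax u0 \<rho>0)"
        unfolding Umax_def[abs_def] Rmax_def[abs_def] .
    qed
    show "is_solution \<gamma>1 \<gamma>2 s u0 \<rho>0 T u \<rho> \<longrightarrow> ereal T \<le> max_time (pack u0 \<rho>0) \<and>
        (\<forall>t\<in>{0..<T}. u t = Umax u0 \<rho>0 t \<and> \<rho> t = Rmax u0 \<rho>0 t)" for T u \<rho>
    proof (intro impI conjI ballI)
      assume sol: "is_solution \<gamma>1 \<gamma>2 s u0 \<rho>0 T u \<rho>"
      then have init: "pack (u 0) (\<rho> 0) = pack u0 \<rho>0" by (simp add: is_solution_def)
      note e = evol_of_is_solution[OF sol]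
      show "ereal T \<le> max_time (pack u0 \<rho>0)"
        by (rule evol_le_max_time[OF e init])
      fix t assume t: "t \<in> {0..<T}"
      have "flow (pack u0 \<rho>0) t = pack (u t) (\<rho> t)"
        by (rule flow_eq[OF e init]) (use t in auto)
      then show "u t = Umax u0 \<rho>0 t" "\<rho> t = Rmax u0 \<rho>0 t"
        by (auto simp: Umax_def Rmax_def)
    qed
    fix T
    show "0 < T \<and> ereal T < max_time (pack u0 \<rho>0) \<longrightarrow>
          (\<forall>\<epsilon>>0. \<exists>\<delta>>0. \<forall>v0 \<in> Hs s. \<forall>\<sigma>0 \<in> Hs (s - 1).
             prod_norm s (csub v0 u0) (csub \<sigma>0 \<rho>0) < \<delta> \<longrightarrow>
               ereal T < max_time (pack v0 \<sigma>0) \<and>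
               (\<forall>t\<in>{0..T}.
                  prod_norm s (csub (Umax v0 \<sigma>0 t) (Umax u0 \<rho>0 t)) (csub (Rmax v0 \<sigma>0 t) (Rmax u0 \<rho>0 t))
                  + prod_norm (s - 1)
                      (csub (rhs_u \<gamma>1 (mean v0) (Umax v0 \<sigma>0 t) (Rmax v0 \<sigma>0 t))
                            (rhs_u \<gamma>1 (mean u0) (Umax u0 \<rho>0 t) (Rmax u0 \<rho>0 t)))
                      (csub (rhs_rho \<gamma>2 (Umax v0 \<sigma>0 t) (Rmax v0 \<sigma>0 t))
                            (rhs_rho \<gamma>2 (Umax u0 \<rho>0 t) (Rmax u0 \<rho>0 t)))
                  < \<epsilon>))"
      using flow_dependence[OF z0] by blast
  qed
qed

end
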